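(* Let $(M^3,g)$ and $(N^3,h)$ be connected oriented real-analytic Riemannian three-manifolds. Let $f:(M^3,g)\to(N^3,h)$ be a nonconstant sense-preserving $K$-quasiregular mapping which is a classical real-analytic harmonic map. Then its Riemannian Jacobian satisfies $$J_f^{g,h}(p)>0,\qquad p\in M.$$ Consequently, $f$ is a local real-analytic diffeomorphism.
   Context: A sense-preserving $K$-quasiregular mapping between oriented Riemannian three-manifolds is a nonconstant mapping satisfying $J_f^{g,h}\ge0$ a.e. and $\|\mathrm{d}f\|_{g,h}^3\le KJ_f^{g,h}$ a.e., where $J_f^{g,h}$ is the Riemannian Jacobian determined by the metrics and orientations and $\|\mathrm{d}f\|_{g,h}$ is the operator norm of the differential with respect to $g$ and $h$; $K$ is a finite constant. A harmonic map satisfies in local coordinates $$g^{\alpha\beta}(x)\bigl(\partial_{\alpha\beta}f^i-\Gamma^\gamma_{\alpha\beta}(x)\partial_\gamma f^i+\widetilde\Gamma^i_{jk}(f(x))\partial_\alpha f^j\partial_\beta f^k\bigr)=0,\qquad i=1,2,3,$$ with $\Gamma$, $\widetilde\Gamma$ the Christoffel symbols of $g$ and $h$. Real-analytic Riemannian manifold means that the manifold and its metric are real analytic. *)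

theory Defs
  imports "HOL-Analysis.Analysis"
begin

section \<open>Real-analytic functions of several real variables\<close>

text \<open>Local expansion in a power series over multi-indices \<open>\<alpha>\<close>. Unconditional summability
  (\<open>has_sum\<close>) is absolute convergence when the codomain is finite-dimensional.\<close>

definition real_analytic_at :: "(real^'n \<Rightarrow> 'b::real_normed_vector) \<Rightarrow> real^'n \<Rightarrow> bool" where
  "real_analytic_at F x \<longleftrightarrow>
     (\<exists>r>0. \<exists>a :: nat^'n \<Rightarrow> 'b. \<forall>y\<in>ball x r.
        ((\<lambda>\<alpha>. (\<Prod>i\<in>UNIV. (y$i - x$i) ^ (\<alpha>$i)) *\<^sub>R a \<alpha>) has_sum F y) UNIV)"

definition real_analytic_on :: "(real^'n \<Rightarrow> 'b::real_normed_vector) \<Rightarrow> (real^'n) set \<Rightarrow> bool" where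
  "real_analytic_on F S \<longleftrightarrow> (\<forall>x\<in>S. real_analytic_at F x)"

definition partial_deriv :: "'n \<Rightarrow> (real^'n \<Rightarrow> 'b::real_normed_vector) \<Rightarrow> real^'n \<Rightarrow> 'b" where
  "partial_deriv i F x = frechet_derivative F (at x) (axis i 1)"


section \<open>Oriented real-analytic Riemannian three-manifolds\<close>

text \<open>Only the values of \<open>coord c\<close> on \<open>chart_dom c\<close> matter.\<close>

datatype 'a chart = Chart (chart_dom: "'a set") (coord: "'a \<Rightarrow> real^3")

definition chart_image :: "'a chart \<Rightarrow> (real^3) set" where
  "chart_image c = coord c ` chart_dom c"

definition coord_inv :: "'a chart \<Rightarrow> real^3 \<Rightarrow> 'a" where
  "coord_inv c = inv_into (chart_dom c) (coord c)"

definition is_chart :: "'a topology \<Rightarrow> 'a chart \<Rightarrow> bool" where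
  "is_chart X c \<longleftrightarrow>
     openin X (chart_dom c) \<and> open (chart_image c) \<and>
     homeomorphic_map (subtopology X (chart_dom c)) (top_of_set (chart_image c)) (coord c)"

text \<open>The coordinate expression of a map \<open>f\<close> in a chart \<open>c\<close> of the source and a chart \<open>d\<close> of the
  target; on the second line the set of coordinates (of points of \<open>U\<close>) where it is meaningful.\<close>

definition coord_rep :: "'a chart \<Rightarrow> 'b chart \<Rightarrow> ('a \<Rightarrow> 'b) \<Rightarrow> real^3 \<Rightarrow> real^3" where
  "coord_rep c d f = coord d \<circ> f \<circ> coord_inv c"

definition rep_dom :: "'a chart \<Rightarrow> 'b chart \<Rightarrow> 'a set \<Rightarrow> ('a \<Rightarrow> 'b) \<Rightarrow> (real^3) set" where
  "rep_dom c d U f = coord c ` {p \<in> U. p \<in> chart_dom c \<and> f p \<in> chart_dom d}"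

text \<open>A manifold is given by its topology, an atlas (not necessarily maximal) of positively
  oriented charts, and the matrices \<open>(g\<^sub>\<alpha>\<^sub>\<beta>)\<close> of the metric in those charts, as functions of the
  coordinates.\<close>

record 'a riem3 =
  man_top :: "'a topology"
  atlas :: "'a chart set"
  metric_mat :: "'a chart \<Rightarrow> real^3 \<Rightarrow> real^3^3"

definition oriented_analytic_atlas :: "'a topology \<Rightarrow> 'a chart set \<Rightarrow> bool" where
  "oriented_analytic_atlas X A \<longleftrightarrow>
     (\<forall>c\<in>A. is_chart X c) \<and> \<Union> (chart_dom ` A) = topspace X \<and>
     (\<forall>c\<in>A. \<forall>d\<in>A. real_analytic_on (coord_rep c d id) (rep_dom c d (topspace X) id) \<and>
        (\<forall>x\<in>rep_dom c d (topspace X) id. det (jacobian (coord_rep c d id) (at x)) > 0))"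

definition positive_definite :: "real^3^3 \<Rightarrow> bool" where
  "positive_definite G \<longleftrightarrow> transpose G = G \<and> (\<forall>v. v \<noteq> 0 \<longrightarrow> v \<bullet> (G *v v) > 0)"

text \<open>The last clause says that the local matrices are those of one metric tensor.\<close>

definition analytic_metric :: "'a riem3 \<Rightarrow> bool" where
  "analytic_metric M \<longleftrightarrow>
     (\<forall>c\<in>atlas M. real_analytic_on (metric_mat M c) (chart_image c) \<and>
        (\<forall>x\<in>chart_image c. positive_definite (metric_mat M c x))) \<and>
     (\<forall>c\<in>atlas M. \<forall>d\<in>atlas M. \<forall>x\<in>rep_dom c d (topspace (man_top M)) id.
        let T = jacobian (coord_rep c d id) (at x) in
        metric_mat M c x = transpose T ** metric_mat M d (coord_rep c d id x) ** T)"

definition oriented_analytic_riemannian3 :: "'a riem3 \<Rightarrow> bool" where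
  "oriented_analytic_riemannian3 M \<longleftrightarrow>
     Hausdorff_space (man_top M) \<and> second_countable (man_top M) \<and>
     oriented_analytic_atlas (man_top M) (atlas M) \<and> analytic_metric M"


section \<open>Real-analytic maps and local diffeomorphisms\<close>

definition analytic_map_on ::
  "'a riem3 \<Rightarrow> 'b riem3 \<Rightarrow> 'a set \<Rightarrow> ('a \<Rightarrow> 'b) \<Rightarrow> bool" where
  "analytic_map_on M N U f \<longleftrightarrow>
     openin (man_top M) U \<and> continuous_map (subtopology (man_top M) U) (man_top N) f \<and>
     (\<forall>c\<in>atlas M. \<forall>d\<in>atlas N. real_analytic_on (coord_rep c d f) (rep_dom c d U f))"

definition analytic_map :: "'a riem3 \<Rightarrow> 'b riem3 \<Rightarrow> ('a \<Rightarrow> 'b) \<Rightarrow> bool" where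
  "analytic_map M N f \<longleftrightarrow> analytic_map_on M N (topspace (man_top M)) f"

definition local_analytic_diffeo :: "'a riem3 \<Rightarrow> 'b riem3 \<Rightarrow> ('a \<Rightarrow> 'b) \<Rightarrow> bool" where
  "local_analytic_diffeo M N f \<longleftrightarrow>
     (\<forall>p\<in>topspace (man_top M). \<exists>U. openin (man_top M) U \<and> p \<in> U \<and>
        openin (man_top N) (f ` U) \<and> inj_on f U \<and>
        analytic_map_on M N U f \<and> analytic_map_on N M (f ` U) (inv_into U f))"


section \<open>Riemannian Jacobian, operator norm and quasiregularity\<close>

text \<open>In positive charts the volume form is \<open>sqrt (det g) dx\<^sup>1 dx\<^sup>2 dx\<^sup>3\<close>, and the Jacobian is defined
  by \<open>f\<^sup>* vol\<^sub>h = J vol\<^sub>g\<close>. Neither this Jacobian nor the norm below depends on the chosen charts,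
  because transition maps have positive determinant and transform the metric matrices.\<close>

definition chart_at :: "'a riem3 \<Rightarrow> 'a \<Rightarrow> 'a chart" where
  "chart_at M p = (SOME c. c \<in> atlas M \<and> p \<in> chart_dom c)"

definition metric_at :: "'a riem3 \<Rightarrow> 'a \<Rightarrow> real^3^3" where
  "metric_at M p = metric_mat M (chart_at M p) (coord (chart_at M p) p)"

definition differentiable_at_pt :: "'a riem3 \<Rightarrow> 'b riem3 \<Rightarrow> ('a \<Rightarrow> 'b) \<Rightarrow> 'a \<Rightarrow> bool" where
  "differentiable_at_pt M N f p \<longleftrightarrow>
     coord_rep (chart_at M p) (chart_at N (f p)) f differentiable at (coord (chart_at M p) p)"

definition differential_at :: "'a riem3 \<Rightarrow> 'b riem3 \<Rightarrow> ('a \<Rightarrow> 'b) \<Rightarrow> 'a \<Rightarrow> real^3^3" where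
  "differential_at M N f p =
     jacobian (coord_rep (chart_at M p) (chart_at N (f p)) f) (at (coord (chart_at M p) p))"

definition riem_jacobian :: "'a riem3 \<Rightarrow> 'b riem3 \<Rightarrow> ('a \<Rightarrow> 'b) \<Rightarrow> 'a \<Rightarrow> real" where
  "riem_jacobian M N f p =
     sqrt (det (metric_at N (f p))) / sqrt (det (metric_at M p)) * det (differential_at M N f p)"

definition metric_norm :: "'a riem3 \<Rightarrow> 'a \<Rightarrow> real^3 \<Rightarrow> real" where
  "metric_norm M p v = sqrt (v \<bullet> (metric_at M p *v v))"

definition riem_opnorm :: "'a riem3 \<Rightarrow> 'b riem3 \<Rightarrow> ('a \<Rightarrow> 'b) \<Rightarrow> 'a \<Rightarrow> real" where
  "riem_opnorm M N f p =
     Sup {metric_norm N (f p) (differential_at M N f p *v v) | v. metric_norm M p v = 1}"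

definition almost_everywhere :: "'a riem3 \<Rightarrow> ('a \<Rightarrow> bool) \<Rightarrow> bool" where
  "almost_everywhere M P \<longleftrightarrow>
     (\<forall>c\<in>atlas M. AE x in lebesgue. x \<in> chart_image c \<longrightarrow> P (coord_inv c x))"

text \<open>Differentiability almost everywhere makes the differential meaningful; together with the
  Sobolev regularity usually required of quasiregular maps, it is automatic for analytic maps.\<close>

definition quasiregular :: "real \<Rightarrow> 'a riem3 \<Rightarrow> 'b riem3 \<Rightarrow> ('a \<Rightarrow> 'b) \<Rightarrow> bool" where
  "quasiregular K M N f \<longleftrightarrow>
     continuous_map (man_top M) (man_top N) f \<and> \<not> f constant_on topspace (man_top M) \<and>
     almost_everywhere M (differentiable_at_pt M N f) \<and>
     almost_everywhere M (\<lambda>p. riem_jacobian M N f p \<ge> 0) \<and>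
     almost_everywhere M (\<lambda>p. riem_opnorm M N f p ^ 3 \<le> K * riem_jacobian M N f p)"


section \<open>Harmonic maps\<close>

text \<open>\<open>christoffel G \<gamma> \<alpha> \<beta>\<close> is \<open>\<Gamma>\<close> with upper index \<open>\<gamma>\<close> and lower indices \<open>\<alpha> \<beta>\<close>.\<close>

definition christoffel :: "(real^3 \<Rightarrow> real^3^3) \<Rightarrow> 3 \<Rightarrow> 3 \<Rightarrow> 3 \<Rightarrow> real^3 \<Rightarrow> real" where
  "christoffel G \<gamma> \<alpha> \<beta> x =
     (\<Sum>\<delta>\<in>UNIV. matrix_inv (G x) $ \<gamma> $ \<delta> *
        (partial_deriv \<alpha> (\<lambda>y. G y $ \<beta> $ \<delta>) x + partial_deriv \<beta> (\<lambda>y. G y $ \<alpha> $ \<delta>) x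
         - partial_deriv \<delta> (\<lambda>y. G y $ \<alpha> $ \<beta>) x)) / 2"

definition harmonic_in_coords ::
  "(real^3 \<Rightarrow> real^3^3) \<Rightarrow> (real^3 \<Rightarrow> real^3^3) \<Rightarrow> (real^3 \<Rightarrow> real^3) \<Rightarrow> real^3 \<Rightarrow> bool" where
  "harmonic_in_coords G H F x \<longleftrightarrow>
     (\<forall>i. (\<Sum>\<alpha>\<in>UNIV. \<Sum>\<beta>\<in>UNIV. matrix_inv (G x) $ \<alpha> $ \<beta> *
        (partial_deriv \<alpha> (partial_deriv \<beta> (\<lambda>y. F y $ i)) x
         - (\<Sum>\<gamma>\<in>UNIV. christoffel G \<gamma> \<alpha> \<beta> x * partial_deriv \<gamma> (\<lambda>y. F y $ i) x)
         + (\<Sum>j\<in>UNIV. \<Sum>k\<in>UNIV. christoffel H i j k (F x) *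
              partial_deriv \<alpha> (\<lambda>y. F y $ j) x * partial_deriv \<beta> (\<lambda>y. F y $ k) x))) = 0)"

text \<open>The derivatives are classical only for maps that are at least \<open>C\<^sup>2\<close>; regularity is a separate
  assumption.\<close>

definition harmonic_map :: "'a riem3 \<Rightarrow> 'b riem3 \<Rightarrow> ('a \<Rightarrow> 'b) \<Rightarrow> bool" where
  "harmonic_map M N f \<longleftrightarrow>
     (\<forall>c\<in>atlas M. \<forall>d\<in>atlas N. \<forall>x\<in>rep_dom c d (topspace (man_top M)) f.
        harmonic_in_coords (metric_mat M c) (metric_mat N d) (coord_rep c d f) x)"

end

theory Submission
  imports Defs "HOL-Complex_Analysis.Great_Picard"
begin

text \<open>
  Suppose that \<open>J(p) = 0\<close>. By quasiregularity \<open>df(p) = 0\<close>, so in charts at \<open>p\<close> the leading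
  homogeneous part \<open>P\<close> of \<open>f - f(p)\<close> has degree \<open>s + 1 \<ge> 2\<close>; it exists by the identity theorem. The
  blow-up \<open>P\<close> inherits the quasiregularity inequality, and it is harmonic for the constant metric
  \<open>g(p)\<close>. If \<open>DP(q) = 0\<close> for some \<open>q \<noteq> 0\<close>, the leading part of \<open>P\<close> at \<open>q\<close> is invariant along \<open>q\<close>, so
  its differential is singular and hence zero by quasiregularity, which is absurd. Therefore
  \<open>det DP > 0\<close> away from the origin. Comparing the second derivatives of \<open>det DP\<close> at a minimum on the
  unit sphere of \<open>g(p)\<close> with its homogeneity gives \<open>4 s \<le> 3 s - s\<^sup>2\<close>, a contradiction.

  Since \<open>J > 0\<close>, the map is locally injective and open, and the local inverse is analytic because it
  is a limit of Picard iterates whose power series have uniformly bounded weighted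
  \<open>\<ell>\<^sup>1\<close>-norms.\<close>

section \<open>Power series in several variables\<close>

text \<open>The second variation of \<open>det DP\<close> contains minus the trace of the square of
  a matrix of second derivatives, a term without a sign in general. Dimension three makes it
  tractable: the tangent space at the minimum is a plane, and there Euler's relation, harmonicity
  and criticality force the tangential blocks to be symmetric and trace-free. They are given by two
  numbers a and b and enter as -4 (a^2 + b^2). The other terms are determined: the mixed radial ones
  contribute 2 s^2, the third derivatives -3 s (s - 1), and these add up to 3 s - s^2, while each of
  the two tangential directions demands at least 2 s.

  The sphere is that of the metric so that an orthonormal frame turns the constant-coefficient
  equation into the Laplace equation. Harmonicity alone cannot suffice: (x^3 - 3 x z^2 + y z, y - 3
  x z, z) is harmonic with Jacobian 3 x^2. Quasiregularity leaves only the ranks 0 and 3, which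
  makes the minimum on the sphere positive.\<close>

definition mpow :: "real^'n \<Rightarrow> nat^'n \<Rightarrow> real" where
  "mpow y \<alpha> = (\<Prod>i\<in>UNIV. (y$i) ^ (\<alpha>$i))"

definition mdeg :: "nat^'n \<Rightarrow> nat" where
  "mdeg \<alpha> = (\<Sum>i\<in>UNIV. \<alpha>$i)"

text \<open>Grouping by total degree turns a multi-index series into an ordinary series, and along a
  ray t y into a power series in the single variable t with coefficients
  \<open>hom_part a k y\<close>. One-variable results then apply.\<close>

definition hom_part :: "(nat^'n \<Rightarrow> real) \<Rightarrow> nat \<Rightarrow> real^'n \<Rightarrow> real" where
  "hom_part a k y = (\<Sum>\<alpha> | mdeg \<alpha> = k. mpow y \<alpha> * a \<alpha>)"

definition abs_part :: "(nat^'n \<Rightarrow> real) \<Rightarrow> nat \<Rightarrow> real" where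
  "abs_part a k = (\<Sum>\<alpha> | mdeg \<alpha> = k. \<bar>a \<alpha>\<bar>)"

text \<open>Coefficients of the formal partial derivative. Higher derivatives are kept at the level
  of coefficients, where the symmetry of mixed derivatives is an index computation.\<close>

definition dcoef :: "'n \<Rightarrow> (nat^'n \<Rightarrow> real) \<Rightarrow> nat^'n \<Rightarrow> real" where
  "dcoef i a \<alpha> = real (\<alpha>$i + 1) * a (\<alpha> + axis i 1)"

definition dir_coef :: "real^'n \<Rightarrow> (nat^'n \<Rightarrow> real) \<Rightarrow> nat^'n \<Rightarrow> real" where
  "dir_coef u a \<alpha> = (\<Sum>i\<in>UNIV. u$i * dcoef i a \<alpha>)"

section \<open>Monomials, homogeneous parts and formal differentiation\<close>

lemma component_le_mdeg: "\<alpha>$i \<le> mdeg \<alpha>"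
  unfolding mdeg_def by (rule member_le_sum) auto

lemma finite_mdeg_le [simp]: "finite {\<alpha>::nat^'n. mdeg \<alpha> \<le> k}"
proof -
  have "{\<alpha>::nat^'n. mdeg \<alpha> \<le> k} \<subseteq> vec_lambda ` (PiE UNIV (\<lambda>_. {..k}))"
  proof
    fix \<alpha> :: "nat^'n" assume "\<alpha> \<in> {\<alpha>. mdeg \<alpha> \<le> k}"
    then have "vec_nth \<alpha> \<in> PiE UNIV (\<lambda>_. {..k})"
      using component_le_mdeg[of \<alpha>] by (auto intro: order_trans)
    then show "\<alpha> \<in> vec_lambda ` (PiE UNIV (\<lambda>_. {..k}))"
      by (metis imageI vec_nth_inverse)
  qed
  then show ?thesis by (rule finite_subset) (intro finite_imageI finite_PiE, auto)
qed

lemma finite_mdeg [simp]: "finite {\<alpha>::nat^'n. mdeg \<alpha> = k}"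
  by (rule finite_subset[OF _ finite_mdeg_le[of k]]) auto

lemma mdeg_add: "mdeg (\<alpha> + \<beta>) = mdeg \<alpha> + mdeg \<beta>"
  by (simp add: mdeg_def sum.distrib)

lemma mdeg_axis [simp]: "mdeg (axis i k) = k"
  by (simp add: mdeg_def axis_def)

lemma mpow_add: "mpow y (\<alpha> + \<beta>) = mpow y \<alpha> * mpow y \<beta>"
  by (simp add: mpow_def power_add prod.distrib)

lemma mpow_axis: "mpow y (axis i k) = (y$i) ^ k"
proof -
  have "mpow y (axis i k) = (\<Prod>j\<in>UNIV. if j = i then (y$i)^k else 1)"
    unfolding mpow_def by (rule prod.cong) (auto simp: axis_def)
  then show ?thesis by simp
qed

lemma mpow_scale: "mpow (t *\<^sub>R y) \<alpha> = t ^ mdeg \<alpha> * mpow y \<alpha>"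
  by (simp add: mpow_def mdeg_def power_mult_distrib prod.distrib power_sum)

lemma abs_mpow_le: "\<bar>mpow y \<alpha>\<bar> \<le> norm y ^ mdeg \<alpha>"
proof -
  have "\<bar>mpow y \<alpha>\<bar> = (\<Prod>i\<in>UNIV. \<bar>y$i\<bar> ^ (\<alpha>$i))"
    by (simp add: mpow_def abs_prod power_abs)
  also have "\<dots> \<le> (\<Prod>i\<in>UNIV. norm y ^ (\<alpha>$i))"
    by (intro prod_mono conjI power_mono component_le_norm_cart) auto
  finally show ?thesis by (simp add: mdeg_def power_sum)
qed

lemma hom_part_scale: "hom_part a k (t *\<^sub>R y) = t ^ k * hom_part a k y"
  by (auto simp: hom_part_def mpow_scale sum_distrib_left mult.assoc intro!: sum.cong)

lemma abs_part_nonneg: "0 \<le> abs_part a k"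
  by (simp add: abs_part_def sum_nonneg)

lemma abs_hom_part_le: "\<bar>hom_part a k y\<bar> \<le> abs_part a k * norm y ^ k"
proof -
  have "\<bar>hom_part a k y\<bar> \<le> (\<Sum>\<alpha> | mdeg \<alpha> = k. \<bar>mpow y \<alpha> * a \<alpha>\<bar>)"
    unfolding hom_part_def by (rule sum_abs)
  also have "\<dots> \<le> (\<Sum>\<alpha> | mdeg \<alpha> = k. norm y ^ k * \<bar>a \<alpha>\<bar>)"
    by (intro sum_mono) (use abs_mpow_le[of y] in \<open>auto simp: abs_mult intro!: mult_right_mono\<close>)
  finally show ?thesis by (simp add: abs_part_def sum_distrib_left mult.commute)
qed

lemma mdeg_eq_0_iff: "mdeg \<alpha> = 0 \<longleftrightarrow> \<alpha> = 0"
  by (auto simp: mdeg_def vec_eq_iff)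

lemma hom_part_0 [simp]: "hom_part a 0 y = a 0"
  by (simp add: hom_part_def mdeg_eq_0_iff mpow_def)

lemma hom_part_dir_coef: "hom_part (dir_coef u a) k y = (\<Sum>i\<in>UNIV. u$i * hom_part (dcoef i a) k y)"
  unfolding hom_part_def dir_coef_def
  by (simp add: sum_distrib_left mult.left_commute sum.swap[of _ _ "{\<alpha>. mdeg \<alpha> = k}"])

lemma dir_coef_axis: "dir_coef (axis i 1) a = dcoef i a"
proof
  fix \<alpha>
  have "dir_coef (axis i 1) a \<alpha> = (\<Sum>j\<in>UNIV. if j = i then dcoef i a \<alpha> else 0)"
    unfolding dir_coef_def by (rule sum.cong) (auto simp: axis_def)
  then show "dir_coef (axis i 1) a \<alpha> = dcoef i a \<alpha>" by simp
qed

lemma dcoef_commute: "dcoef i (dcoef j a) = dcoef j (dcoef i a)"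
proof
  fix \<alpha>
  show "dcoef i (dcoef j a) \<alpha> = dcoef j (dcoef i a) \<alpha>"
    by (cases "i = j") (auto simp: dcoef_def axis_def add.assoc add.commute algebra_simps)
qed

lemma dir_coef_commute: "dir_coef u (dir_coef v a) = dir_coef v (dir_coef u a)"
proof
  fix \<alpha>
  have *: "dir_coef u (dir_coef v a) \<alpha> = (\<Sum>i\<in>UNIV. \<Sum>j\<in>UNIV. u$i * v$j * dcoef i (dcoef j a) \<alpha>)" for u v
    by (simp add: dir_coef_def dcoef_def sum_distrib_left algebra_simps)
  show "dir_coef u (dir_coef v a) \<alpha> = dir_coef v (dir_coef u a) \<alpha>"
    unfolding * by (subst sum.swap) (simp add: dcoef_commute mult.commute)
qed

text \<open>The shift by \<open>axis i 1\<close> is a bijection onto the multi-indices with positive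
  entry at \<open>i\<close>. The factor \<open>\<alpha>$i\<close> removes all others, on which
  truncated subtraction could not be undone.\<close>

lemma sum_mdeg_Suc:
  fixes g :: "nat^'n \<Rightarrow> real"
  shows "(\<Sum>\<alpha> | mdeg \<alpha> = Suc k. real (\<alpha>$i) * g \<alpha>)
    = (\<Sum>\<beta> | mdeg \<beta> = k. real (\<beta>$i + 1) * g (\<beta> + axis i 1))"
proof -
  have "(\<Sum>\<alpha> | mdeg \<alpha> = Suc k. real (\<alpha>$i) * g \<alpha>)
      = (\<Sum>\<alpha> | mdeg \<alpha> = Suc k \<and> \<alpha>$i > 0. real (\<alpha>$i) * g \<alpha>)"
    by (rule sum.mono_neutral_right) auto
  also have "\<dots> = (\<Sum>\<beta> | mdeg \<beta> = k. real (\<beta>$i + 1) * g (\<beta> + axis i 1))"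
  proof (rule sum.reindex_bij_witness[where i="\<lambda>\<beta>. \<beta> + axis i 1" and j="\<lambda>\<alpha>. \<alpha> - axis i 1"])
    fix \<alpha> :: "nat^'n" assume a: "\<alpha> \<in> {\<alpha>. mdeg \<alpha> = Suc k \<and> \<alpha>$i > 0}"
    show e: "\<alpha> - axis i 1 + axis i 1 = \<alpha>"
      using a by (auto simp: vec_eq_iff axis_def)
    have "mdeg (\<alpha> - axis i 1) + 1 = mdeg \<alpha>"
      using arg_cong[OF e, of mdeg] by (simp add: mdeg_add)
    then show "\<alpha> - axis i 1 \<in> {\<beta>. mdeg \<beta> = k}" using a by auto
    show "real ((\<alpha> - axis i 1)$i + 1) * g (\<alpha> - axis i 1 + axis i 1) = real (\<alpha>$i) * g \<alpha>"
      unfolding e using a by (simp add: axis_def)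
  qed (auto simp: mdeg_add vec_eq_iff)
  finally show ?thesis .
qed

lemma mpow_has_derivative:
  fixes y :: "real^'n"
  shows "((\<lambda>y. mpow y \<alpha>) has_derivative
     (\<lambda>h. \<Sum>i\<in>UNIV. h$i * (real (\<alpha>$i) * mpow y (\<alpha> - axis i 1)))) (at y)"
proof -
  have "((\<lambda>y. \<Prod>i\<in>UNIV. (y$i) ^ (\<alpha>$i)) has_derivative
      (\<lambda>h. \<Sum>i\<in>UNIV. (real (\<alpha>$i) * (h$i * (y$i)^(\<alpha>$i - 1))) * (\<Prod>j\<in>UNIV - {i}. (y$j)^(\<alpha>$j)))) (at y)"
    by (rule has_derivative_prod, rule has_derivative_eq_rhs[OF has_derivative_power])
      (auto intro!: bounded_linear_imp_has_derivative bounded_linear_vec_nth simp: algebra_simps)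
  moreover have "(y$i)^(\<alpha>$i - 1) * (\<Prod>j\<in>UNIV - {i}. (y$j)^(\<alpha>$j)) = mpow y (\<alpha> - axis i 1)" for i
  proof -
    have "mpow y (\<alpha> - axis i 1) = (y$i)^((\<alpha> - axis i 1)$i) * (\<Prod>j\<in>UNIV - {i}. (y$j)^((\<alpha> - axis i 1)$j))"
      unfolding mpow_def by (rule prod.remove) auto
    also have "(\<Prod>j\<in>UNIV - {i}. (y$j)^((\<alpha> - axis i 1)$j)) = (\<Prod>j\<in>UNIV - {i}. (y$j)^(\<alpha>$j))"
      by (rule prod.cong) (auto simp: axis_def)
    finally show ?thesis by (simp add: axis_def)
  qed
  then have "(real (\<alpha>$i) * (h$i * (y$i)^(\<alpha>$i - 1))) * (\<Prod>j\<in>UNIV - {i}. (y$j)^(\<alpha>$j))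
      = h$i * (real (\<alpha>$i) * mpow y (\<alpha> - axis i 1))" for i and h :: "real^'n"
    by (metis (no_types, lifting) mult.assoc mult.left_commute)
  ultimately show ?thesis by (simp only: mpow_def[symmetric])
qed

lemma hom_part_has_derivative:
  "(hom_part a (Suc k) has_derivative (\<lambda>h. hom_part (dir_coef h a) k y)) (at y)"
proof -
  have "((\<lambda>y. \<Sum>\<alpha> | mdeg \<alpha> = Suc k. mpow y \<alpha> * a \<alpha>) has_derivative
     (\<lambda>h. \<Sum>\<alpha> | mdeg \<alpha> = Suc k. (\<Sum>i\<in>UNIV. h$i * (real (\<alpha>$i) * mpow y (\<alpha> - axis i 1))) * a \<alpha>)) (at y)"
    by (intro has_derivative_sum has_derivative_mult_left mpow_has_derivative)
  moreover have "(\<Sum>\<alpha> | mdeg \<alpha> = Suc k. (\<Sum>i\<in>UNIV. h$i * (real (\<alpha>$i) * mpow y (\<alpha> - axis i 1))) * a \<alpha>)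
      = hom_part (dir_coef h a) k y" for h
  proof -
    have "(\<Sum>\<alpha> | mdeg \<alpha> = Suc k. (\<Sum>i\<in>UNIV. h$i * (real (\<alpha>$i) * mpow y (\<alpha> - axis i 1))) * a \<alpha>)
       = (\<Sum>i\<in>UNIV. h$i * (\<Sum>\<alpha> | mdeg \<alpha> = Suc k. real (\<alpha>$i) * (mpow y (\<alpha> - axis i 1) * a \<alpha>)))"
      by (simp add: sum_distrib_left sum_distrib_right sum.swap[of _ _ "{\<alpha>. mdeg \<alpha> = Suc k}"] mult.assoc)
    also have "\<dots> = (\<Sum>i\<in>UNIV. h$i * hom_part (dcoef i a) k y)"
      unfolding sum_mdeg_Suc hom_part_def dcoef_def
      by (simp add: algebra_simps)
    finally show ?thesis by (simp add: hom_part_dir_coef)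
  qed
  ultimately show ?thesis by (simp add: hom_part_def[abs_def])
qed

lemma abs_part_dcoef_le:
  fixes a :: "nat^'n \<Rightarrow> real"
  shows "abs_part (dcoef i a) k \<le> real (Suc k) * abs_part a (Suc k)"
proof -
  have "abs_part (dcoef i a) k = (\<Sum>\<beta> | mdeg \<beta> = k. real (\<beta>$i + 1) * \<bar>a (\<beta> + axis i 1)\<bar>)"
    by (simp add: abs_part_def dcoef_def abs_mult)
  also have "\<dots> = (\<Sum>\<alpha> | mdeg \<alpha> = Suc k. real (\<alpha>$i) * \<bar>a \<alpha>\<bar>)"
    by (rule sum_mdeg_Suc[symmetric])
  also have "\<dots> \<le> (\<Sum>\<alpha> | mdeg \<alpha> = Suc k. real (Suc k) * \<bar>a \<alpha>\<bar>)"
  proof (intro sum_mono mult_right_mono)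
    fix \<alpha> :: "nat^'n" assume "\<alpha> \<in> {\<alpha>. mdeg \<alpha> = Suc k}"
    then show "real (\<alpha>$i) \<le> real (Suc k)" using component_le_mdeg[of \<alpha> i] by simp
  qed auto
  finally show ?thesis by (simp add: abs_part_def sum_distrib_left)
qed

text \<open>Along the ray t y the homogeneous part is t^(k+1) times its value at y. Its derivative
  at t = 1 is computed once by the chain rule and once from this monomial.\<close>

lemma Euler_hom_part: "hom_part (dir_coef y a) k y = real (Suc k) * hom_part a (Suc k) y"
proof -
  have "((\<lambda>t. hom_part a (Suc k) (t *\<^sub>R y)) has_derivative (\<lambda>s. hom_part (dir_coef (s *\<^sub>R y) a) k (1 *\<^sub>R y))) (at 1)"
    by (rule has_derivative_compose[OF _ hom_part_has_derivative])
      (auto intro!: derivative_eq_intros)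
  then have "((\<lambda>t. t ^ Suc k * hom_part a (Suc k) y) has_derivative (\<lambda>s. hom_part (dir_coef (s *\<^sub>R y) a) k y)) (at 1)"
    by (simp add: hom_part_scale del: power_Suc)
  moreover have "((\<lambda>t. t ^ Suc k * hom_part a (Suc k) y) has_derivative (\<lambda>s. s * (real (Suc k) * hom_part a (Suc k) y))) (at (1::real))"
    by (auto intro!: derivative_eq_intros simp del: power_Suc of_nat_Suc simp: algebra_simps)
  ultimately have "(\<lambda>s. hom_part (dir_coef (s *\<^sub>R y) a) k y) = (\<lambda>s. s * (real (Suc k) * hom_part a (Suc k) y))"
    by (rule has_derivative_unique)
  from fun_cong[OF this, of 1] show ?thesis by simp
qed

definition bounded_pseries :: "(real^'n \<Rightarrow> real) \<Rightarrow> real \<Rightarrow> real \<Rightarrow> bool" where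
  "bounded_pseries \<phi> \<rho> R \<longleftrightarrow>
     (\<exists>b. (\<forall>A. finite A \<longrightarrow> (\<Sum>\<alpha>\<in>A. \<bar>b \<alpha>\<bar> * \<rho> ^ mdeg \<alpha>) \<le> R) \<and>
       (\<forall>y. norm y < \<rho> \<longrightarrow> ((\<lambda>\<alpha>. mpow y \<alpha> * b \<alpha>) has_sum \<phi> y) UNIV))"

text \<open>Companion of \<open>bounded_pseries\<close> with named coefficients and summation by
  degree, the form in which series are differentiated and blown up. Absolute summability is demanded
  at the radius \<open>r\<close> itself, convergence to \<open>F\<close> only inside.\<close>

definition pseries :: "(nat^'n \<Rightarrow> real) \<Rightarrow> (real^'n \<Rightarrow> real) \<Rightarrow> real^'n \<Rightarrow> real \<Rightarrow> bool" where
  "pseries a F x r \<longleftrightarrow> 0 < r \<and> summable (\<lambda>k. abs_part a k * r ^ k) \<and>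
     (\<forall>y. norm y < r \<longrightarrow> (\<lambda>k. hom_part a k y) sums F (x + y))"

lemma has_sum_imp_hom_part_sums:
  assumes "((\<lambda>\<alpha>. mpow y \<alpha> * b \<alpha>) has_sum s) UNIV"
  shows "(\<lambda>k. hom_part b k y) sums s"
proof -
  have "((\<lambda>(k,\<alpha>). mpow y \<alpha> * b \<alpha>) has_sum s) (Sigma UNIV (\<lambda>k. {\<alpha>. mdeg \<alpha> = k}))
      = ((\<lambda>\<alpha>. mpow y \<alpha> * b \<alpha>) has_sum s) UNIV"
    by (rule has_sum_reindex_bij_witness[where i="\<lambda>\<alpha>. (mdeg \<alpha>, \<alpha>)" and j=snd]) auto
  with assms have "((\<lambda>(k,\<alpha>). mpow y \<alpha> * b \<alpha>) has_sum s) (Sigma UNIV (\<lambda>k. {\<alpha>. mdeg \<alpha> = k}))"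
    by simp
  then have "((\<lambda>k. hom_part b k y) has_sum s) UNIV"
  proof (rule has_sum_SigmaD)
    show "((\<lambda>\<alpha>. case (k, \<alpha>) of (k, \<alpha>) \<Rightarrow> mpow y \<alpha> * b \<alpha>) has_sum hom_part b k y) {\<alpha>. mdeg \<alpha> = k}" for k
      using has_sum_finite[of "{\<alpha>. mdeg \<alpha> = k}" "\<lambda>\<alpha>. mpow y \<alpha> * b \<alpha>"] by (simp add: hom_part_def)
  qed
  then show ?thesis by (rule has_sum_imp_sums)
qed

lemma bounded_coeffs_imp_summable:
  assumes "0 \<le> \<rho>" "\<And>A. finite A \<Longrightarrow> (\<Sum>\<alpha>\<in>A. \<bar>b \<alpha>\<bar> * \<rho> ^ mdeg \<alpha>) \<le> R"
  shows "summable (\<lambda>k. abs_part b k * \<rho> ^ k)"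
proof (rule summableI_nonneg_bounded)
  show "0 \<le> abs_part b k * \<rho> ^ k" for k
    using assms by (simp add: abs_part_nonneg)
  fix n
  have fin: "finite {\<alpha>::nat^'a. mdeg \<alpha> < n}"
    by (rule finite_subset[OF _ finite_mdeg_le[of n]]) auto
  have "(\<Sum>k<n. abs_part b k * \<rho> ^ k)
      = (\<Sum>k<n. \<Sum>\<alpha>\<in>{\<alpha>\<in>{\<alpha>. mdeg \<alpha> < n}. mdeg \<alpha> = k}. \<bar>b \<alpha>\<bar> * \<rho> ^ mdeg \<alpha>)"
    unfolding abs_part_def sum_distrib_right by (intro sum.cong) auto
  also have "\<dots> = (\<Sum>\<alpha> | mdeg \<alpha> < n. \<bar>b \<alpha>\<bar> * \<rho> ^ mdeg \<alpha>)"
    by (rule sum.group) (use fin in auto)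
  also have "\<dots> \<le> R" by (rule assms(2)[OF fin])
  finally show "(\<Sum>k<n. abs_part b k * \<rho> ^ k) \<le> R" .
qed

lemma bounded_pseries_imp_pseries:
  assumes "bounded_pseries (\<lambda>y. F (x + y)) \<rho> R" "0 < \<rho>"
  shows "\<exists>a. pseries a F x \<rho>"
proof -
  obtain b where b: "\<And>A. finite A \<Longrightarrow> (\<Sum>\<alpha>\<in>A. \<bar>b \<alpha>\<bar> * \<rho> ^ mdeg \<alpha>) \<le> R"
    and F: "\<And>y. norm y < \<rho> \<Longrightarrow> ((\<lambda>\<alpha>. mpow y \<alpha> * b \<alpha>) has_sum F (x + y)) UNIV"
    using assms(1) unfolding bounded_pseries_def by blast
  have "summable (\<lambda>k. abs_part b k * \<rho> ^ k)"
    by (rule bounded_coeffs_imp_summable[OF _ b]) (use assms(2) in auto)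
  then have "pseries b F x \<rho>"
    using assms(2) has_sum_imp_hom_part_sums[OF F] by (simp add: pseries_def)
  then show ?thesis by blast
qed

text \<open>At the diagonal point (\<rho>, ..., \<rho>) every monomial equals \<rho> to the power of
  its degree, so unconditional convergence there, which is absolute for real terms, is precisely the
  weighted bound. With n coordinates this point has norm at most n \<rho>, whence the choice \<rho>
  = r / (2 n).\<close>

lemma real_analytic_at_imp_bounded_pseries:
  fixes F :: "real^'n \<Rightarrow> real"
  assumes "real_analytic_at F x"
  shows "\<exists>\<rho> R. 0 < \<rho> \<and> bounded_pseries (\<lambda>y. F (x + y)) \<rho> R"
proof -
  obtain r a where r: "0 < r" and a: "\<And>y. y \<in> ball x r \<Longrightarrow>
      ((\<lambda>\<alpha>. (\<Prod>i\<in>UNIV. (y$i - x$i) ^ (\<alpha>$i)) *\<^sub>R a \<alpha>) has_sum F y) UNIV"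
    using assms unfolding real_analytic_at_def by blast
  have a': "((\<lambda>\<alpha>. mpow y \<alpha> * a \<alpha>) has_sum F (x + y)) UNIV" if "norm y < r" for y
    using a[of "x + y"] that by (simp add: dist_norm mpow_def)
  define n where "n = real CARD('n)"
  have n: "n \<ge> 1" by (simp add: n_def Suc_leI)
  define \<rho> where "\<rho> = r / (2 * n)"
  define z where "z = (\<chi> i::'n. \<rho>)"
  have \<rho>: "0 < \<rho>" using r n by (simp add: \<rho>_def)
  have "norm z \<le> (\<Sum>i\<in>UNIV. \<bar>z$i\<bar>)" by (rule norm_le_l1_cart)
  also have "\<dots> = n * \<rho>" using \<rho> by (simp add: z_def n_def)
  also have "\<dots> < r" using r n by (simp add: \<rho>_def)
  finally have z: "norm z < r" .
  have "\<rho> = r / 2 / n" by (simp add: \<rho>_def)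
  also have "\<dots> \<le> r / 2 / 1" using r n by (intro divide_left_mono) auto
  finally have \<rho>r: "\<rho> < r" using r by simp
  have mz: "mpow z \<alpha> = \<rho> ^ mdeg \<alpha>" for \<alpha> by (simp add: mpow_def z_def mdeg_def power_sum)
  have "(\<lambda>\<alpha>. mpow z \<alpha> * a \<alpha>) summable_on UNIV"
    using a'[OF z] by (rule has_sum_imp_summable)
  then have "(\<lambda>\<alpha>. norm (mpow z \<alpha> * a \<alpha>)) summable_on UNIV"
    by (rule summable_on_iff_abs_summable_on_real[THEN iffD1])
  moreover have "norm (mpow z \<alpha> * a \<alpha>) = \<bar>a \<alpha>\<bar> * \<rho> ^ mdeg \<alpha>" for \<alpha>
    using \<rho> by (simp add: mz abs_mult)
  ultimately have s: "(\<lambda>\<alpha>. \<bar>a \<alpha>\<bar> * \<rho> ^ mdeg \<alpha>) summable_on UNIV"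
    by simp
  have "(\<Sum>\<alpha>\<in>A. \<bar>a \<alpha>\<bar> * \<rho> ^ mdeg \<alpha>) \<le> infsum (\<lambda>\<alpha>. \<bar>a \<alpha>\<bar> * \<rho> ^ mdeg \<alpha>) UNIV" if "finite A" for A
    by (rule finite_sum_le_infsum[OF s that]) (use \<rho> in auto)
  then have "bounded_pseries (\<lambda>y. F (x + y)) \<rho> (infsum (\<lambda>\<alpha>. \<bar>a \<alpha>\<bar> * \<rho> ^ mdeg \<alpha>) UNIV)"
    unfolding bounded_pseries_def using a' \<rho>r by (intro exI[of _ a]) auto
  with \<rho> show ?thesis by blast
qed

lemma real_analytic_at_imp_pseries:
  fixes F :: "real^'n \<Rightarrow> real"
  assumes "real_analytic_at F x"
  obtains a r where "pseries a F x r"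
  using real_analytic_at_imp_bounded_pseries[OF assms] bounded_pseries_imp_pseries by blast

lemma real_analytic_at_component:
  fixes F :: "real^'n \<Rightarrow> 'b::real_normed_vector^'m"
  assumes "real_analytic_at F x"
  shows "real_analytic_at (\<lambda>y. F y $ i) x"
proof -
  obtain r a where r: "0 < r" and a: "\<And>y. y \<in> ball x r \<Longrightarrow>
      ((\<lambda>\<alpha>. (\<Prod>i\<in>UNIV. (y$i - x$i) ^ (\<alpha>$i)) *\<^sub>R a \<alpha>) has_sum F y) UNIV"
    using assms unfolding real_analytic_at_def by blast
  show ?thesis unfolding real_analytic_at_def
  proof (intro exI[of _ r] conjI exI[of _ "\<lambda>\<alpha>. a \<alpha> $ i"] ballI)
    fix y assume "y \<in> ball x r"
    from has_sum_bounded_linear[OF bounded_linear_vec_nth[of i] a[OF this]]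
    show "((\<lambda>\<alpha>. (\<Prod>i\<in>UNIV. (y$i - x$i) ^ (\<alpha>$i)) *\<^sub>R (a \<alpha> $ i)) has_sum F y $ i) UNIV" by simp
  qed (rule r)
qed

lemma real_analytic_at_vec:
  fixes F :: "real^'n \<Rightarrow> real^'m"
  assumes "0 < \<rho>" "\<And>i. bounded_pseries (\<lambda>y. F (x + y) $ i) \<rho> R"
  shows "real_analytic_at F x"
proof -
  have "\<forall>i. \<exists>b. \<forall>y. norm y < \<rho> \<longrightarrow> ((\<lambda>\<alpha>. mpow y \<alpha> * b \<alpha>) has_sum F (x + y) $ i) UNIV"
    using assms(2) unfolding bounded_pseries_def by blast
  then obtain b where b: "\<And>i y. norm y < \<rho> \<Longrightarrow> ((\<lambda>\<alpha>. mpow y \<alpha> * b i \<alpha>) has_sum F (x + y) $ i) UNIV"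
    by metis
  show ?thesis unfolding real_analytic_at_def
  proof (intro exI[of _ \<rho>] conjI exI[of _ "\<lambda>\<alpha>. \<chi> i. b i \<alpha>"] ballI)
    fix y assume "y \<in> ball x \<rho>"
    then have y: "norm (y - x) < \<rho>" by (simp add: dist_norm norm_minus_commute)
    show "((\<lambda>\<alpha>. (\<Prod>i\<in>UNIV. (y$i - x$i) ^ (\<alpha>$i)) *\<^sub>R (\<chi> i. b i \<alpha>)) has_sum F y) UNIV"
      unfolding has_sum_def
    proof (rule vec_tendstoI)
      fix i
      show "((\<lambda>A. (\<Sum>\<alpha>\<in>A. (\<Prod>i\<in>UNIV. (y$i - x$i) ^ (\<alpha>$i)) *\<^sub>R (\<chi> i. b i \<alpha>)) $ i) \<longlongrightarrow> F y $ i)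
          (finite_subsets_at_top UNIV)"
        using b[OF y, of i] by (simp add: has_sum_def mpow_def)
    qed
  qed (rule assms(1))
qed

section \<open>Termwise differentiation and blow-up along rays\<close>

lemma abs_part_dcoef_summable:
  assumes "0 < r" "summable (\<lambda>k. abs_part a k * r ^ k)"
  shows "summable (\<lambda>k. abs_part (dcoef i a) k * (r/2) ^ k)"
proof (rule summable_comparison_test)
  show "summable (\<lambda>k. (2 / r) * (abs_part a (Suc k) * r ^ Suc k))"
    using assms(2) by (intro summable_mult) (subst summable_Suc_iff)
  have "norm (abs_part (dcoef i a) k * (r/2) ^ k) \<le> (2 / r) * (abs_part a (Suc k) * r ^ Suc k)" for k
  proof -
    \<comment> \<open>The factor k + 1 produced by differentiation is absorbed by halving the
      radius.\<close>
    have "real (Suc k) \<le> 2 ^ k"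
      using less_exp[of k] by (metis Suc_leI of_nat_le_iff of_nat_numeral of_nat_power)
    then have "real (Suc k) * (r/2)^k \<le> 2 ^ k * (r/2)^k"
      using assms(1) by (intro mult_right_mono) auto
    also have "\<dots> \<le> 2 * r ^ k" using assms(1) by (simp add: power_divide)
    finally have k: "real (Suc k) * (r/2)^k \<le> 2 * r ^ k" .
    have "norm (abs_part (dcoef i a) k * (r/2) ^ k) \<le> (real (Suc k) * abs_part a (Suc k)) * (r/2)^k"
      using assms(1) by (simp add: abs_mult abs_part_nonneg abs_part_dcoef_le mult_right_mono del: of_nat_Suc)
    also have "\<dots> = abs_part a (Suc k) * (real (Suc k) * (r/2)^k)" by simp
    also have "\<dots> \<le> abs_part a (Suc k) * (2 * r ^ k)"
      by (intro mult_left_mono k abs_part_nonneg)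
    also have "\<dots> = (2 / r) * (abs_part a (Suc k) * r ^ Suc k)"
      using assms(1) by simp
    finally show ?thesis .
  qed
  then show "\<exists>N. \<forall>k\<ge>N. norm (abs_part (dcoef i a) k * (r/2) ^ k) \<le> (2 / r) * (abs_part a (Suc k) * r ^ Suc k)"
    by blast
qed

text \<open>On the ball of radius r/2 the series of each partial derivative converges uniformly by
  the Weierstrass test, and finitely many such limits make up the derivative of the sum.\<close>

lemma pseries_has_derivative:
  fixes F :: "real^'n \<Rightarrow> real"
  assumes "pseries a F x r"
  obtains D where "\<And>i. pseries (dcoef i a) (D i) x (r/2)"
    and "\<And>z. dist x z < r/2 \<Longrightarrow> (F has_derivative (\<lambda>h. \<Sum>i\<in>UNIV. h$i * D i z)) (at z)"
proof -
  have r: "0 < r" and sa: "summable (\<lambda>k. abs_part a k * r ^ k)"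
    and F: "\<And>y. norm y < r \<Longrightarrow> (\<lambda>k. hom_part a k y) sums F (x + y)"
    using assms by (auto simp: pseries_def)
  define M where "M i k = abs_part (dcoef i a) k * (r/2) ^ k" for i :: 'n and k
  have sM: "summable (M i)" for i
    unfolding M_def[abs_def] by (rule abs_part_dcoef_summable[OF r sa])
  have bound: "norm (hom_part (dcoef i a) k y) \<le> M i k" if "norm y < r/2" for i k y
  proof -
    have "\<bar>hom_part (dcoef i a) k y\<bar> \<le> abs_part (dcoef i a) k * norm y ^ k" by (rule abs_hom_part_le)
    also have "\<dots> \<le> M i k" unfolding M_def using that
      by (intro mult_left_mono power_mono abs_part_nonneg) auto
    finally show ?thesis by simp
  qed
  define D0 where "D0 i y = (\<Sum>k. hom_part (dcoef i a) k y)" for i y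
  have D0: "(\<lambda>k. hom_part (dcoef i a) k y) sums D0 i y" if "norm y < r/2" for i y
    unfolding D0_def by (rule summable_sums, rule summable_comparison_test'[OF sM[of i], of 0]) (rule bound[OF that])
  let ?S = "ball 0 (r/2) :: (real^'n) set"
  let ?f' = "\<lambda>k y h. case k of 0 \<Rightarrow> 0 | Suc k \<Rightarrow> hom_part (dir_coef h a) k y"
  have unif: "uniform_limit ?S (\<lambda>n y. \<Sum>k<n. hom_part (dcoef i a) k y) (D0 i) sequentially" for i
    unfolding D0_def by (rule Weierstrass_m_test[OF _ sM[of i]]) (use bound in auto)
  have "\<exists>g. \<forall>y\<in>?S. (\<lambda>k. hom_part a k y) sums g y \<and>
      (g has_derivative (\<lambda>h. \<Sum>i\<in>UNIV. h$i * D0 i y)) (at y within ?S)"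
  proof (rule has_derivative_series[where f'="?f'" and x=0])
    show "(hom_part a k has_derivative ?f' k y) (at y within ?S)" if "y \<in> ?S" for k y
    proof (cases k)
      case 0
      have "hom_part a 0 = (\<lambda>y. a 0)" by auto
      then show ?thesis using 0 by simp
    next
      case (Suc k) then show ?thesis
        using hom_part_has_derivative has_derivative_at_withinI by fastforce
    qed
    fix e :: real assume e: "e > 0"
    \<comment> \<open>The admissible error is shared equally among the partial derivatives.\<close>
    define e' where "e' = e / CARD('n)"
    have e': "e' > 0" using e by (simp add: e'_def)
    have "\<forall>\<^sub>F n in sequentially. \<forall>i. \<forall>y\<in>?S. dist (\<Sum>k<n. hom_part (dcoef i a) k y) (D0 i y) < e'"
      using unif e' unfolding uniform_limit_iff by (intro eventually_all_finite) auto
    then obtain N where N: "\<And>n i y. n \<ge> N \<Longrightarrow> y \<in> ?S \<Longrightarrow> dist (\<Sum>k<n. hom_part (dcoef i a) k y) (D0 i y) < e'"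
      unfolding eventually_sequentially by blast
    show "\<forall>\<^sub>F n in sequentially. \<forall>y\<in>?S. \<forall>h. norm ((\<Sum>k<n. ?f' k y h) - (\<Sum>i\<in>UNIV. h$i * D0 i y)) \<le> e * norm h"
      unfolding eventually_sequentially
    \<comment> \<open>The constant term has derivative zero, so \<open>n\<close> terms of the series
      leave \<open>n - 1\<close> terms of each derived series.\<close>
    proof (intro exI[of _ "Suc N"] allI impI ballI)
      fix n y and h :: "real^'n" assume n: "Suc N \<le> n" and y: "y \<in> ?S"
      then obtain m where m: "n = Suc m" "m \<ge> N" by (metis Suc_le_D Suc_le_mono)
      have "(\<Sum>k<n. ?f' k y h) = (\<Sum>k<m. hom_part (dir_coef h a) k y)"
        unfolding m(1) by (subst sum.lessThan_Suc_shift) simp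
      also have "\<dots> = (\<Sum>i\<in>UNIV. h$i * (\<Sum>k<m. hom_part (dcoef i a) k y))"
        by (simp add: hom_part_dir_coef sum_distrib_left sum.swap[of _ _ "{..<m}"])
      finally have "(\<Sum>k<n. ?f' k y h) - (\<Sum>i\<in>UNIV. h$i * D0 i y)
          = (\<Sum>i\<in>UNIV. h$i * ((\<Sum>k<m. hom_part (dcoef i a) k y) - D0 i y))"
        by (simp add: sum_subtractf algebra_simps)
      also have "norm \<dots> \<le> (\<Sum>i\<in>(UNIV::'n set). norm h * e')"
      proof (rule order_trans[OF norm_sum sum_mono])
        fix i :: 'n
        show "norm (h$i * ((\<Sum>k<m. hom_part (dcoef i a) k y) - D0 i y)) \<le> norm h * e'"
          unfolding norm_mult using N[OF m(2) y, of i]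
          by (intro mult_mono) (auto simp: dist_norm component_le_norm_cart)
      qed
      also have "\<dots> = e * norm h" by (simp add: e'_def)
      finally show "norm ((\<Sum>k<n. ?f' k y h) - (\<Sum>i\<in>UNIV. h$i * D0 i y)) \<le> e * norm h" .
    qed
  next
    show "(\<lambda>k. hom_part a k 0) sums F (x + 0)" using F[of 0] r by simp
    show "convex ?S" by simp
    show "0 \<in> ?S" using r by simp
  qed
  then obtain g where g0: "\<forall>y\<in>?S. (\<lambda>k. hom_part a k y) sums g y \<and>
      (g has_derivative (\<lambda>h. \<Sum>i\<in>UNIV. h$i * D0 i y)) (at y within ?S)"
    by (rule exE)
  note g = bspec[OF g0, THEN conjunct1] bspec[OF g0, THEN conjunct2]
  show thesis
  proof (rule that[of "\<lambda>i z. D0 i (z - x)"])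
    show "pseries (dcoef i a) (\<lambda>z. D0 i (z - x)) x (r/2)" for i
      using r abs_part_dcoef_summable[OF r sa] D0 by (simp add: pseries_def)
    fix z assume "dist x z < r/2"
    then have zS: "z - x \<in> ?S" by (simp add: dist_norm norm_minus_commute)
    note gz = g(2)[OF zS, unfolded at_within_open[OF zS open_ball]]
    have "((\<lambda>z. z - x) has_derivative (\<lambda>h. h)) (at z)"
      by (auto intro!: derivative_eq_intros)
    from has_derivative_compose[OF this gz]
    have "((\<lambda>z. g (z - x)) has_derivative (\<lambda>h. \<Sum>i\<in>UNIV. h$i * D0 i (z - x))) (at z)" .
    then show "(F has_derivative (\<lambda>h. \<Sum>i\<in>UNIV. h$i * D0 i (z - x))) (at z)"
    proof (rule has_derivative_transform_within_open)
      show "open (ball x (r/2))" "z \<in> ball x (r/2)" using \<open>dist x z < r/2\<close> by auto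
      fix w assume "w \<in> ball x (r/2)"
      then have w: "w - x \<in> ?S" by (simp add: dist_norm norm_minus_commute)
      then have "norm (w - x) < r" using r by simp
      from sums_unique2[OF g(1)[OF w] F[OF this]] show "g (w - x) = F w" by simp
    qed
  qed
qed

text \<open>Uniqueness of the derivative identifies the termwise limits with
  \<open>partial_deriv\<close>. The result is again a \<open>pseries\<close>, so the lemma can be
  iterated, each time applying \<open>dcoef\<close> and halving the radius.\<close>

lemma pseries_partial_deriv:
  assumes "pseries a F x r"
  shows "pseries (dcoef i a) (partial_deriv i F) x (r/2)"
    and "\<And>z. dist x z < r/2 \<Longrightarrow> (F has_derivative (\<lambda>h. \<Sum>i\<in>UNIV. h$i * partial_deriv i F z)) (at z)"
proof -
  obtain D where D: "\<And>i. pseries (dcoef i a) (D i) x (r/2)"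
    and F: "\<And>z. dist x z < r/2 \<Longrightarrow> (F has_derivative (\<lambda>h. \<Sum>i\<in>UNIV. h$i * D i z)) (at z)"
    using pseries_has_derivative[OF assms] by blast
  have eq: "partial_deriv j F z = D j z" if z: "dist x z < r/2" for j z
  proof -
    have "partial_deriv j F z = (\<Sum>i\<in>UNIV. (axis j 1 :: real^'a) $ i * D i z)"
      unfolding partial_deriv_def using frechet_derivative_at[OF F[OF z]] by metis
    also have "\<dots> = (\<Sum>i\<in>UNIV. if i = j then D i z else 0)"
      by (rule sum.cong) (auto simp: axis_def)
    finally show ?thesis by simp
  qed
  show "pseries (dcoef i a) (partial_deriv i F) x (r/2)"
    using D[of i] eq[of "x + _" i] by (auto simp: pseries_def dist_norm)
  show "\<And>z. dist x z < r/2 \<Longrightarrow> (F has_derivative (\<lambda>h. \<Sum>i\<in>UNIV. h$i * partial_deriv i F z)) (at z)"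
    using F eq by simp
qed

lemma pseries_isCont:
  assumes "pseries a F x r"
  shows "isCont F x"
  by (rule has_derivative_continuous[OF pseries_partial_deriv(2)[OF assms]])
    (use assms in \<open>simp add: pseries_def\<close>)

text \<open>Along the ray the function is a power series in t. If its first j coefficients vanish,
  division by t^j leaves a power series with constant term \<open>hom_part a j y\<close>.\<close>

lemma pseries_blowup:
  assumes "pseries a F x r" "\<And>k. k < j \<Longrightarrow> hom_part a k y = 0"
  shows "((\<lambda>t. F (x + t *\<^sub>R y) / t ^ j) \<longlongrightarrow> hom_part a j y) (at_right 0)"
proof -
  have r: "0 < r" and F: "\<And>y. norm y < r \<Longrightarrow> (\<lambda>k. hom_part a k y) sums F (x + y)"
    using assms by (auto simp: pseries_def)
  \<comment> \<open>Adding 1 to the norm covers the case \<open>y = 0\<close>.\<close>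
  define s where "s = r / (norm y + 1)"
  have s: "0 < s" using r by (simp add: s_def add_nonneg_pos)
  have "((\<lambda>t. F (x + t *\<^sub>R y) / t ^ j) \<longlongrightarrow> hom_part a (0 + j) y) (at 0)"
  proof (rule powser_limit_0_strong[OF s])
    fix t :: real assume t: "t \<noteq> 0" "norm t < s"
    have "norm (t *\<^sub>R y) \<le> \<bar>t\<bar> * (norm y + 1)" by (simp add: mult_left_mono)
    also have "\<dots> < r" using t(2) by (simp add: s_def pos_less_divide_eq add_nonneg_pos)
    finally have "(\<lambda>k. t ^ k * hom_part a k y) sums F (x + t *\<^sub>R y)"
      using F by (simp add: hom_part_scale[symmetric])
    then have "(\<lambda>k. t ^ (k + j) * hom_part a (k + j) y) sums F (x + t *\<^sub>R y)"
      using sums_iff_shift[of "\<lambda>k. t ^ k * hom_part a k y" j] by (simp add: assms(2))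
    from sums_divide[OF this, of "t ^ j"]
    show "(\<lambda>k. hom_part a (k + j) y * t ^ k) sums (F (x + t *\<^sub>R y) / t ^ j)"
      using t by (simp add: power_add mult.commute)
  qed
  then show ?thesis by (simp add: filterlim_at_split)
qed

section \<open>Algebra and limits of power series with bounded weighted norm\<close>

lemma abs_coeff_le:
  assumes "\<And>A. finite A \<Longrightarrow> (\<Sum>\<alpha>\<in>A. \<bar>b \<alpha>\<bar> * \<rho> ^ mdeg \<alpha>) \<le> R"
  shows "\<bar>b \<alpha>\<bar> * \<rho> ^ mdeg \<alpha> \<le> R"
  using assms[of "{\<alpha>}"] by simp

lemma bounded_coeffs_summable_on:
  assumes "\<And>A. finite A \<Longrightarrow> (\<Sum>\<alpha>\<in>A. \<bar>b \<alpha>\<bar> * \<rho> ^ mdeg \<alpha>) \<le> R" "norm y < \<rho>"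
  shows "(\<lambda>\<alpha>. mpow y \<alpha> * b \<alpha>) summable_on UNIV"
proof (rule abs_summable_summable, rule nonneg_bdd_above_summable_on)
  have "(\<Sum>\<alpha>\<in>A. norm (mpow y \<alpha> * b \<alpha>)) \<le> R" if "finite A" for A
  proof -
    have "(\<Sum>\<alpha>\<in>A. norm (mpow y \<alpha> * b \<alpha>)) \<le> (\<Sum>\<alpha>\<in>A. \<bar>b \<alpha>\<bar> * \<rho> ^ mdeg \<alpha>)"
    proof (rule sum_mono)
      fix \<alpha>
      have "\<bar>mpow y \<alpha>\<bar> \<le> \<rho> ^ mdeg \<alpha>"
        by (rule order_trans[OF abs_mpow_le power_mono]) (use assms(2) in auto)
      then show "norm (mpow y \<alpha> * b \<alpha>) \<le> \<bar>b \<alpha>\<bar> * \<rho> ^ mdeg \<alpha>"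
        by (simp add: abs_mult mult.commute mult_left_mono)
    qed
    then show ?thesis using assms(1)[OF that] by linarith
  qed
  then show "bdd_above (sum (\<lambda>\<alpha>. norm (mpow y \<alpha> * b \<alpha>)) ` {F. F \<subseteq> UNIV \<and> finite F})"
    by (intro bdd_aboveI[of _ R]) auto
qed auto

text \<open>The weighted bound restores unconditional summability inside the radius, and the
  unconditional sum must agree with the sum by degree. Limits can therefore be taken degree by
  degree.\<close>

lemma bounded_pseriesI:
  fixes \<phi> :: "real^'n \<Rightarrow> real"
  assumes "\<And>A. finite A \<Longrightarrow> (\<Sum>\<alpha>\<in>A. \<bar>b \<alpha>\<bar> * \<rho> ^ mdeg \<alpha>) \<le> R"
    and "\<And>y. norm y < \<rho> \<Longrightarrow> (\<lambda>k. hom_part b k y) sums \<phi> y"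
  shows "bounded_pseries \<phi> \<rho> R"
  unfolding bounded_pseries_def
proof (intro exI[of _ b] conjI allI impI)
  fix y :: "real^'n" assume y: "norm y < \<rho>"
  have "((\<lambda>\<alpha>. mpow y \<alpha> * b \<alpha>) has_sum infsum (\<lambda>\<alpha>. mpow y \<alpha> * b \<alpha>) UNIV) UNIV"
    by (rule has_sum_infsum[OF bounded_coeffs_summable_on[OF assms(1) y]])
  moreover from has_sum_imp_hom_part_sums[OF this] assms(2)[OF y]
  have "infsum (\<lambda>\<alpha>. mpow y \<alpha> * b \<alpha>) UNIV = \<phi> y" by (rule sums_unique2)
  ultimately show "((\<lambda>\<alpha>. mpow y \<alpha> * b \<alpha>) has_sum \<phi> y) UNIV" by simp
qed (rule assms(1))

lemma bounded_pseries_mono: "bounded_pseries \<phi> \<rho> R \<Longrightarrow> R \<le> R' \<Longrightarrow> bounded_pseries \<phi> \<rho> R'"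
  unfolding bounded_pseries_def by (meson order_trans)

lemma bounded_pseries_cong:
  assumes "bounded_pseries \<phi> \<rho> R" "\<And>y. norm y < \<rho> \<Longrightarrow> \<phi> y = \<psi> y"
  shows "bounded_pseries \<psi> \<rho> R"
  using assms unfolding bounded_pseries_def by simp

lemma bounded_pseries_nonneg: "bounded_pseries \<phi> \<rho> R \<Longrightarrow> 0 \<le> R"
  unfolding bounded_pseries_def using sum.empty by (metis finite.emptyI)

lemma bounded_pseries_abs_le:
  assumes "bounded_pseries \<phi> \<rho> R" "norm y < \<rho>"
  shows "\<bar>\<phi> y\<bar> \<le> R"
proof -
  obtain b where b: "\<And>A. finite A \<Longrightarrow> (\<Sum>\<alpha>\<in>A. \<bar>b \<alpha>\<bar> * \<rho> ^ mdeg \<alpha>) \<le> R"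
    and s: "\<And>y. norm y < \<rho> \<Longrightarrow> ((\<lambda>\<alpha>. mpow y \<alpha> * b \<alpha>) has_sum \<phi> y) UNIV"
    using assms(1) unfolding bounded_pseries_def by blast
  have "((\<lambda>A. \<bar>\<Sum>\<alpha>\<in>A. mpow y \<alpha> * b \<alpha>\<bar>) \<longlongrightarrow> \<bar>\<phi> y\<bar>) (finite_subsets_at_top UNIV)"
    using s[OF assms(2)] unfolding has_sum_def by (rule tendsto_rabs)
  then show ?thesis
  proof (rule tendsto_upperbound)
    show "\<forall>\<^sub>F A in finite_subsets_at_top UNIV. \<bar>\<Sum>\<alpha>\<in>A. mpow y \<alpha> * b \<alpha>\<bar> \<le> R"
    proof (rule eventually_finite_subsets_at_top_weakI)
      fix A :: "(nat^'a) set" assume A: "finite A"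
      have "\<bar>\<Sum>\<alpha>\<in>A. mpow y \<alpha> * b \<alpha>\<bar> \<le> (\<Sum>\<alpha>\<in>A. \<bar>b \<alpha>\<bar> * \<rho> ^ mdeg \<alpha>)"
      proof (rule order_trans[OF sum_abs sum_mono])
        fix \<alpha>
        have "\<bar>mpow y \<alpha>\<bar> \<le> \<rho> ^ mdeg \<alpha>"
          by (rule order_trans[OF abs_mpow_le power_mono]) (use assms(2) in auto)
        then show "\<bar>mpow y \<alpha> * b \<alpha>\<bar> \<le> \<bar>b \<alpha>\<bar> * \<rho> ^ mdeg \<alpha>"
          by (simp add: abs_mult mult.commute mult_left_mono)
      qed
      then show "\<bar>\<Sum>\<alpha>\<in>A. mpow y \<alpha> * b \<alpha>\<bar> \<le> R" using b[OF A] by linarith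
    qed
  qed simp
qed

lemma bounded_pseries_monomial:
  fixes \<gamma> :: "nat^'n"
  assumes "0 \<le> \<rho>"
  shows "bounded_pseries (\<lambda>y. mpow y \<gamma> * c) \<rho> (\<bar>c\<bar> * \<rho> ^ mdeg \<gamma>)"
  unfolding bounded_pseries_def
proof (intro exI[of _ "\<lambda>\<alpha>. if \<alpha> = \<gamma> then c else 0"] conjI allI impI)
  fix A :: "(nat^'n) set" assume "finite A"
  then show "(\<Sum>\<alpha>\<in>A. \<bar>if \<alpha> = \<gamma> then c else 0\<bar> * \<rho> ^ mdeg \<alpha>) \<le> \<bar>c\<bar> * \<rho> ^ mdeg \<gamma>"
    using assms by (simp add: if_distrib[where f=abs] if_distrib[where f="\<lambda>x. x * _"] sum.delta' cong: if_cong)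
next
  fix y :: "real^'n"
  have "((\<lambda>\<alpha>. mpow y \<alpha> * (if \<alpha> = \<gamma> then c else 0)) has_sum (mpow y \<gamma> * c)) {\<gamma>}"
    using has_sum_finite[of "{\<gamma>}" "\<lambda>\<alpha>. mpow y \<alpha> * (if \<alpha> = \<gamma> then c else 0)"] by simp
  then show "((\<lambda>\<alpha>. mpow y \<alpha> * (if \<alpha> = \<gamma> then c else 0)) has_sum (mpow y \<gamma> * c)) UNIV"
    by (subst has_sum_cong_neutral[of "{\<gamma>}" UNIV]) auto
qed

lemma bounded_pseries_const: "0 \<le> \<rho> \<Longrightarrow> bounded_pseries (\<lambda>y. c) \<rho> \<bar>c\<bar>"
  using bounded_pseries_monomial[of \<rho> 0 c] by (simp add: mpow_def mdeg_def)

lemma bounded_pseries_coord: "0 \<le> \<rho> \<Longrightarrow> bounded_pseries (\<lambda>y. y $ i) \<rho> \<rho>"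
  using bounded_pseries_monomial[of \<rho> "axis i 1" 1] by (simp add: mpow_axis)

lemma bounded_pseries_add:
  assumes "0 \<le> \<rho>" "bounded_pseries \<phi> \<rho> R" "bounded_pseries \<psi> \<rho> S"
  shows "bounded_pseries (\<lambda>y. \<phi> y + \<psi> y) \<rho> (R + S)"
proof -
  obtain b where b: "\<And>A. finite A \<Longrightarrow> (\<Sum>\<alpha>\<in>A. \<bar>b \<alpha>\<bar> * \<rho> ^ mdeg \<alpha>) \<le> R"
    and sb: "\<And>y. norm y < \<rho> \<Longrightarrow> ((\<lambda>\<alpha>. mpow y \<alpha> * b \<alpha>) has_sum \<phi> y) UNIV"
    using assms(2) unfolding bounded_pseries_def by blast
  obtain c where c: "\<And>A. finite A \<Longrightarrow> (\<Sum>\<alpha>\<in>A. \<bar>c \<alpha>\<bar> * \<rho> ^ mdeg \<alpha>) \<le> S"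
    and sc: "\<And>y. norm y < \<rho> \<Longrightarrow> ((\<lambda>\<alpha>. mpow y \<alpha> * c \<alpha>) has_sum \<psi> y) UNIV"
    using assms(3) unfolding bounded_pseries_def by blast
  show ?thesis unfolding bounded_pseries_def
  proof (intro exI[of _ "\<lambda>\<alpha>. b \<alpha> + c \<alpha>"] conjI allI impI)
    fix A :: "(nat^'a) set" assume A: "finite A"
    have "(\<Sum>\<alpha>\<in>A. \<bar>b \<alpha> + c \<alpha>\<bar> * \<rho> ^ mdeg \<alpha>) \<le> (\<Sum>\<alpha>\<in>A. \<bar>b \<alpha>\<bar> * \<rho> ^ mdeg \<alpha> + \<bar>c \<alpha>\<bar> * \<rho> ^ mdeg \<alpha>)"
      using assms(1) by (intro sum_mono) (simp add: distrib_right[symmetric] mult_right_mono)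
    then show "(\<Sum>\<alpha>\<in>A. \<bar>b \<alpha> + c \<alpha>\<bar> * \<rho> ^ mdeg \<alpha>) \<le> R + S"
      using b[OF A] c[OF A] by (simp add: sum.distrib)
  next
    fix y :: "real^'a" assume "norm y < \<rho>"
    from has_sum_add[OF sb[OF this] sc[OF this]]
    show "((\<lambda>\<alpha>. mpow y \<alpha> * (b \<alpha> + c \<alpha>)) has_sum (\<phi> y + \<psi> y)) UNIV"
      by (simp add: distrib_left)
  qed
qed

text \<open>The weight is multiplicative because the degree is additive, so the Cauchy product obeys
  the Banach algebra inequality. Its sum is the double series rearranged along the fibres of
  addition of multi-indices.\<close>

lemma bounded_pseries_mult:
  assumes "0 \<le> \<rho>" "bounded_pseries \<phi> \<rho> R" "bounded_pseries \<psi> \<rho> S"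
  shows "bounded_pseries (\<lambda>y. \<phi> y * \<psi> y) \<rho> (R * S)"
proof -
  obtain b where b: "\<And>A. finite A \<Longrightarrow> (\<Sum>\<alpha>\<in>A. \<bar>b \<alpha>\<bar> * \<rho> ^ mdeg \<alpha>) \<le> R"
    and sb: "\<And>y. norm y < \<rho> \<Longrightarrow> ((\<lambda>\<alpha>. mpow y \<alpha> * b \<alpha>) has_sum \<phi> y) UNIV"
    using assms(2) unfolding bounded_pseries_def by blast
  obtain c where c: "\<And>A. finite A \<Longrightarrow> (\<Sum>\<alpha>\<in>A. \<bar>c \<alpha>\<bar> * \<rho> ^ mdeg \<alpha>) \<le> S"
    and sc: "\<And>y. norm y < \<rho> \<Longrightarrow> ((\<lambda>\<alpha>. mpow y \<alpha> * c \<alpha>) has_sum \<psi> y) UNIV"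
    using assms(3) unfolding bounded_pseries_def by blast
  let ?u = "\<lambda>\<alpha>. \<bar>b \<alpha>\<bar> * \<rho> ^ mdeg \<alpha>" and ?v = "\<lambda>\<alpha>. \<bar>c \<alpha>\<bar> * \<rho> ^ mdeg \<alpha>"
  have R: "0 \<le> R" and S: "0 \<le> S" using assms(2,3) by (auto dest: bounded_pseries_nonneg)
  have uv: "(\<Sum>(\<alpha>,\<beta>)\<in>P. ?u \<alpha> * ?v \<beta>) \<le> R * S" if "finite P" for P
  proof -
    \<comment> \<open>A finite set of pairs is enclosed in a finite rectangle, on which the double
      sum factors.\<close>
    have "(\<Sum>(\<alpha>,\<beta>)\<in>P. ?u \<alpha> * ?v \<beta>) \<le> (\<Sum>(\<alpha>,\<beta>)\<in>fst ` P \<times> snd ` P. ?u \<alpha> * ?v \<beta>)"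
      by (rule sum_mono2) (use that assms(1) in \<open>auto intro: rev_image_eqI\<close>)
    also have "\<dots> = sum ?u (fst ` P) * sum ?v (snd ` P)"
      by (simp add: sum_product sum.cartesian_product)
    also have "\<dots> \<le> R * S"
      using that assms(1) R by (intro mult_mono b c sum_nonneg) auto
    finally show ?thesis .
  qed
  let ?T = "\<lambda>\<gamma>::nat^'a. {(\<alpha>,\<beta>). \<alpha> + \<beta> = \<gamma>}"
  have finT: "finite (?T \<gamma>)" for \<gamma>
    by (rule finite_subset[of _ "{\<alpha>. mdeg \<alpha> \<le> mdeg \<gamma>} \<times> {\<alpha>. mdeg \<alpha> \<le> mdeg \<gamma>}"])
      (auto simp: mdeg_add)
  define d where "d \<gamma> = (\<Sum>(\<alpha>,\<beta>)\<in>?T \<gamma>. b \<alpha> * c \<beta>)" for \<gamma>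
  show ?thesis unfolding bounded_pseries_def
  proof (intro exI[of _ d] conjI allI impI)
    fix A :: "(nat^'a) set" assume A: "finite A"
    have "(\<Sum>\<gamma>\<in>A. \<bar>d \<gamma>\<bar> * \<rho> ^ mdeg \<gamma>) \<le> (\<Sum>\<gamma>\<in>A. \<Sum>(\<alpha>,\<beta>)\<in>?T \<gamma>. ?u \<alpha> * ?v \<beta>)"
    proof (rule sum_mono)
      fix \<gamma>
      have "\<bar>d \<gamma>\<bar> * \<rho> ^ mdeg \<gamma> \<le> (\<Sum>p\<in>?T \<gamma>. \<bar>case p of (\<alpha>,\<beta>) \<Rightarrow> b \<alpha> * c \<beta>\<bar>) * \<rho> ^ mdeg \<gamma>"
        unfolding d_def using assms(1) by (intro mult_right_mono sum_abs) auto
      also have "\<dots> = (\<Sum>(\<alpha>,\<beta>)\<in>?T \<gamma>. ?u \<alpha> * ?v \<beta>)"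
        unfolding sum_distrib_right by (rule sum.cong) (auto simp: abs_mult mdeg_add power_add)
      finally show "\<bar>d \<gamma>\<bar> * \<rho> ^ mdeg \<gamma> \<le> (\<Sum>(\<alpha>,\<beta>)\<in>?T \<gamma>. ?u \<alpha> * ?v \<beta>)" .
    qed
    also have "\<dots> = (\<Sum>(\<alpha>,\<beta>)\<in>(\<Union>\<gamma>\<in>A. ?T \<gamma>). ?u \<alpha> * ?v \<beta>)"
      by (rule sum.UNION_disjoint[symmetric]) (use A finT in auto)
    also have "\<dots> \<le> R * S" by (rule uv) (use A finT in auto)
    finally show "(\<Sum>\<gamma>\<in>A. \<bar>d \<gamma>\<bar> * \<rho> ^ mdeg \<gamma>) \<le> R * S" .
  next
    fix y :: "real^'a" assume y: "norm y < \<rho>"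
    let ?f = "\<lambda>(\<alpha>,\<beta>). (mpow y \<alpha> * b \<alpha>) * (mpow y \<beta> * c \<beta>)"
    have m: "\<bar>mpow y \<alpha>\<bar> \<le> \<rho> ^ mdeg \<alpha>" for \<alpha>
      by (rule order_trans[OF abs_mpow_le power_mono]) (use y in auto)
    have "?f summable_on Sigma UNIV (\<lambda>_. UNIV)"
    proof (rule abs_summable_summable, rule nonneg_bdd_above_summable_on)
      have "(\<Sum>p\<in>P. norm (?f p)) \<le> R * S" if "finite P" for P
      proof -
        have "(\<Sum>p\<in>P. norm (?f p)) \<le> (\<Sum>(\<alpha>,\<beta>)\<in>P. ?u \<alpha> * ?v \<beta>)"
          using m assms(1) by (intro sum_mono) (auto simp: abs_mult mult.commute intro!: mult_mono)
        with uv[OF that] show ?thesis by linarith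
      qed
      then show "bdd_above (sum (\<lambda>p. norm (?f p)) ` {F. F \<subseteq> Sigma UNIV (\<lambda>_. UNIV) \<and> finite F})"
        by (intro bdd_aboveI[of _ "R * S"]) auto
    qed auto
    then have "(?f has_sum \<phi> y * \<psi> y) (Sigma UNIV (\<lambda>_. UNIV))"
      by (rule has_sum_SigmaI[rotated 2])
        (use has_sum_cmult_right[OF sc[OF y]] has_sum_cmult_left[OF sb[OF y]] in auto)
    moreover have "((\<lambda>(\<gamma>,p). ?f p) has_sum \<phi> y * \<psi> y) (Sigma UNIV ?T)
        = (?f has_sum \<phi> y * \<psi> y) (Sigma UNIV (\<lambda>_. UNIV))"
      by (rule has_sum_reindex_bij_witness[where i="\<lambda>p. (fst p + snd p, p)" and j=snd]) auto
    ultimately have "((\<lambda>(\<gamma>,p). ?f p) has_sum \<phi> y * \<psi> y) (Sigma UNIV ?T)" by simp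
    then show "((\<lambda>\<gamma>. mpow y \<gamma> * d \<gamma>) has_sum \<phi> y * \<psi> y) UNIV"
    proof (rule has_sum_SigmaD)
      fix \<gamma>
      have "mpow y \<gamma> * d \<gamma> = sum ?f (?T \<gamma>)"
        unfolding d_def sum_distrib_left by (rule sum.cong) (auto simp: mpow_add)
      then show "((\<lambda>p. case (\<gamma>, p) of (\<gamma>, p) \<Rightarrow> ?f p) has_sum mpow y \<gamma> * d \<gamma>) (?T \<gamma>)"
        using has_sum_finite[OF finT, of ?f] by simp
    qed
  qed
qed

lemma bounded_pseries_cmult:
  "0 \<le> \<rho> \<Longrightarrow> bounded_pseries \<phi> \<rho> R \<Longrightarrow> bounded_pseries (\<lambda>y. c * \<phi> y) \<rho> (\<bar>c\<bar> * R)"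
  by (intro bounded_pseries_mult bounded_pseries_const)

lemma bounded_pseries_sum:
  assumes "0 \<le> \<rho>" "finite I" "\<And>i. i \<in> I \<Longrightarrow> bounded_pseries (\<phi> i) \<rho> (R i)"
  shows "bounded_pseries (\<lambda>y. \<Sum>i\<in>I. \<phi> i y) \<rho> (\<Sum>i\<in>I. R i)"
  using assms(2,3)
proof (induction rule: finite_induct)
  case empty
  then show ?case using bounded_pseries_const[OF assms(1), of 0] by simp
next
  case (insert i I)
  then show ?case using bounded_pseries_add[OF assms(1), of "\<phi> i" "R i"] by simp
qed

lemma bounded_pseries_power:
  assumes "0 \<le> \<rho>" "bounded_pseries \<phi> \<rho> R"
  shows "bounded_pseries (\<lambda>y. \<phi> y ^ n) \<rho> (R ^ n)"
proof (induction n)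
  case 0
  then show ?case using bounded_pseries_const[OF assms(1), of 1] by simp
next
  case (Suc n)
  then show ?case using bounded_pseries_mult[OF assms(1,2)] by simp
qed

lemma bounded_pseries_prod:
  assumes "0 \<le> \<rho>" "finite I" "\<And>i. i \<in> I \<Longrightarrow> bounded_pseries (\<phi> i) \<rho> (R i)"
  shows "bounded_pseries (\<lambda>y. \<Prod>i\<in>I. \<phi> i y) \<rho> (\<Prod>i\<in>I. R i)"
  using assms(2,3)
proof (induction rule: finite_induct)
  case empty
  then show ?case using bounded_pseries_const[OF assms(1), of 1] by simp
next
  case (insert i I)
  then show ?case using bounded_pseries_mult[OF assms(1), of "\<phi> i" "R i"] by simp
qed

text \<open>By submultiplicativity, substitution into a homogeneous polynomial costs no more than
  putting the common bound \<open>S\<close> for every variable. This controls the composition of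
  power series.\<close>

lemma bounded_pseries_hom_part:
  fixes \<phi> :: "real^'m \<Rightarrow> real^'n"
  assumes "0 \<le> \<rho>" "\<And>i. bounded_pseries (\<lambda>y. \<phi> y $ i) \<rho> S"
  shows "bounded_pseries (\<lambda>y. hom_part a k (\<phi> y)) \<rho> (abs_part a k * S ^ k)"
proof -
  have "bounded_pseries (\<lambda>y. \<Sum>\<alpha> | mdeg \<alpha> = k. a \<alpha> * mpow (\<phi> y) \<alpha>) \<rho>
      (\<Sum>\<alpha> | mdeg \<alpha> = k. \<bar>a \<alpha>\<bar> * (\<Prod>i\<in>UNIV. S ^ (\<alpha>$i)))"
    unfolding mpow_def
    by (intro bounded_pseries_sum bounded_pseries_cmult bounded_pseries_prod bounded_pseries_power assms) auto
  moreover have "(\<Sum>\<alpha> | mdeg \<alpha> = k. \<bar>a \<alpha>\<bar> * (\<Prod>i\<in>UNIV. S ^ (\<alpha>$i))) = abs_part a k * S ^ k"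
    unfolding abs_part_def sum_distrib_right
    by (rule sum.cong) (auto simp: power_sum[symmetric] mdeg_def)
  ultimately show ?thesis by (simp add: hom_part_def mult.commute)
qed

text \<open>A polynomial is re-expanded at \<open>q\<close> by substituting q + y, whose coordinates
  have bounded weighted norm. The radius 1 is a convenient choice.\<close>

lemma pseries_hom_part:
  fixes a :: "nat^'n \<Rightarrow> real"
  obtains b where "pseries b (hom_part a k) q 1"
proof -
  have "bounded_pseries (\<lambda>y. (q + y) $ i) 1 (norm q + 1)" for i
  proof -
    have "bounded_pseries (\<lambda>y. q $ i + y $ i) 1 (\<bar>q $ i\<bar> + 1)"
      by (intro bounded_pseries_add bounded_pseries_const bounded_pseries_coord) auto
    then show ?thesis
      by (rule bounded_pseries_mono[OF bounded_pseries_cong]) (auto simp: component_le_norm_cart)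
  qed
  from bounded_pseries_hom_part[of 1 "\<lambda>y. q + y", OF _ this, of a k]
  show thesis using bounded_pseries_imp_pseries[of "hom_part a k" q 1] that by auto
qed

text \<open>A diagonal subsequence makes all coefficients converge. The bounds on finite sums pass
  to the limit, Tannery's theorem exchanges the limit with summation by degree, and pointwise
  convergence identifies the resulting sum.\<close>

lemma bounded_pseries_limit:
  fixes \<phi> :: "nat \<Rightarrow> real^'n \<Rightarrow> real"
  assumes \<rho>: "0 < \<rho>" and \<phi>: "\<And>n. bounded_pseries (\<phi> n) \<rho> R"
    and lim: "\<And>y. norm y < \<rho> \<Longrightarrow> (\<lambda>n. \<phi> n y) \<longlonglongrightarrow> \<psi> y"
  shows "bounded_pseries \<psi> \<rho> R"
proof -
  have "\<forall>n. \<exists>b. (\<forall>A. finite A \<longrightarrow> (\<Sum>\<alpha>\<in>A. \<bar>b \<alpha>\<bar> * \<rho> ^ mdeg \<alpha>) \<le> R) \<and>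
       (\<forall>y. norm y < \<rho> \<longrightarrow> ((\<lambda>\<alpha>. mpow y \<alpha> * b \<alpha>) has_sum \<phi> n y) UNIV)"
    using \<phi> unfolding bounded_pseries_def by blast
  from choice[OF this] obtain b where
    b: "\<And>n A. finite A \<Longrightarrow> (\<Sum>\<alpha>\<in>A. \<bar>b n \<alpha>\<bar> * \<rho> ^ mdeg \<alpha>) \<le> R"
    and sb: "\<And>n y. norm y < \<rho> \<Longrightarrow> ((\<lambda>\<alpha>. mpow y \<alpha> * b n \<alpha>) has_sum \<phi> n y) UNIV"
    by blast
  \<comment> \<open>Scaled by the weight, all coefficients are bounded by the same \<open>R\<close>,
    as the diagonal argument over the countably many multi-indices requires.\<close>
  let ?f = "\<lambda>n \<alpha>. b n \<alpha> * \<rho> ^ mdeg \<alpha>"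
  have "norm (?f n \<alpha>) \<le> R" for n \<alpha>
    using abs_coeff_le[OF b[of _ n], of \<alpha>] \<rho> by (simp add: abs_mult)
  moreover have "countable (UNIV :: (nat^'n) set)"
  proof -
    have "(UNIV :: (nat^'n) set) = (\<Union>k. {\<alpha>. mdeg \<alpha> = k})" by auto
    then show ?thesis by (metis countable_UN countable_finite finite_mdeg uncountable_def countableI_type)
  qed
  ultimately obtain \<sigma> where \<sigma>: "strict_mono \<sigma>" and "\<And>\<alpha>. \<exists>l. (\<lambda>n. ?f (\<sigma> n) \<alpha>) \<longlonglongrightarrow> l"
    using function_convergent_subsequence[of UNIV ?f R] by (metis UNIV_I)
  then obtain l where l: "\<And>\<alpha>. (\<lambda>n. ?f (\<sigma> n) \<alpha>) \<longlonglongrightarrow> l \<alpha>" by metis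
  define c where "c \<alpha> = l \<alpha> / \<rho> ^ mdeg \<alpha>" for \<alpha>
  have c: "(\<lambda>n. b (\<sigma> n) \<alpha>) \<longlonglongrightarrow> c \<alpha>" for \<alpha>
    using tendsto_divide[OF l[of \<alpha>] tendsto_const, of "\<rho> ^ mdeg \<alpha>"] \<rho> by (simp add: c_def)
  show ?thesis
  proof (rule bounded_pseriesI)
    fix A :: "(nat^'n) set" assume A: "finite A"
    have "(\<lambda>n. \<Sum>\<alpha>\<in>A. \<bar>b (\<sigma> n) \<alpha>\<bar> * \<rho> ^ mdeg \<alpha>) \<longlonglongrightarrow> (\<Sum>\<alpha>\<in>A. \<bar>c \<alpha>\<bar> * \<rho> ^ mdeg \<alpha>)"
      by (intro tendsto_intros c)
    then show "(\<Sum>\<alpha>\<in>A. \<bar>c \<alpha>\<bar> * \<rho> ^ mdeg \<alpha>) \<le> R"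
      by (rule LIMSEQ_le_const2) (use b[OF A] in auto)
  next
    fix y :: "real^'n" assume y: "norm y < \<rho>"
    define q where "q = norm y / \<rho>"
    have q: "0 \<le> q" "q < 1" using y \<rho> by (auto simp: q_def)
    have bd: "norm (hom_part (b (\<sigma> n)) k y) \<le> R * q ^ k" for k n
    proof -
      have "abs_part (b (\<sigma> n)) k * \<rho> ^ k = (\<Sum>\<alpha> | mdeg \<alpha> = k. \<bar>b (\<sigma> n) \<alpha>\<bar> * \<rho> ^ mdeg \<alpha>)"
        unfolding abs_part_def sum_distrib_right by (rule sum.cong) auto
      also have "\<dots> \<le> R" by (rule b) simp
      finally have "abs_part (b (\<sigma> n)) k * \<rho> ^ k * q ^ k \<le> R * q ^ k"
        using q by (intro mult_right_mono) auto
      moreover have "\<rho> ^ k * q ^ k = norm y ^ k"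
        using \<rho> by (simp add: q_def power_mult_distrib[symmetric])
      ultimately show ?thesis
        using abs_hom_part_le[of "b (\<sigma> n)" k y] by (simp add: mult.assoc)
    qed
    have "eventually (\<lambda>n. summable (\<lambda>k. norm (hom_part (b (\<sigma> n)) k y))) sequentially \<and>
        summable (\<lambda>k. norm (hom_part c k y)) \<and>
        (\<lambda>n. suminf (\<lambda>k. hom_part (b (\<sigma> n)) k y)) \<longlonglongrightarrow> suminf (\<lambda>k. hom_part c k y)"
    \<comment> \<open>The majorant is geometric because \<open>y\<close> lies strictly inside the
      radius, and it does not depend on the position in the sequence.\<close>
    proof (rule tannerys_theorem[where M="\<lambda>k. R * q ^ k"])
      show "(\<lambda>n. hom_part (b (\<sigma> n)) k y) \<longlonglongrightarrow> hom_part c k y" for k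
        unfolding hom_part_def by (intro tendsto_intros c)
      show "\<forall>\<^sub>F (k, n) in at_top \<times>\<^sub>F sequentially. norm (hom_part (b (\<sigma> n)) k y) \<le> R * q ^ k"
        using bd by (intro always_eventually) auto
      show "summable (\<lambda>k. R * q ^ k)" using q by (intro summable_mult summable_geometric) auto
    qed simp
    then have sc: "summable (\<lambda>k. hom_part c k y)"
      and lc: "(\<lambda>n. suminf (\<lambda>k. hom_part (b (\<sigma> n)) k y)) \<longlonglongrightarrow> suminf (\<lambda>k. hom_part c k y)"
      by (auto intro: summable_norm_cancel)
    have "suminf (\<lambda>k. hom_part (b (\<sigma> n)) k y) = \<phi> (\<sigma> n) y" for n
      using has_sum_imp_hom_part_sums[OF sb[OF y]] by (rule sums_unique[symmetric])
    with lc have "(\<lambda>n. \<phi> (\<sigma> n) y) \<longlonglongrightarrow> suminf (\<lambda>k. hom_part c k y)" by simp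
    moreover have "(\<lambda>n. \<phi> (\<sigma> n) y) \<longlonglongrightarrow> \<psi> y"
      using LIMSEQ_subseq_LIMSEQ[OF lim[OF y] \<sigma>] by (simp add: o_def)
    ultimately have "suminf (\<lambda>k. hom_part c k y) = \<psi> y" by (rule LIMSEQ_unique)
    with sc show "(\<lambda>k. hom_part c k y) sums \<psi> y" using summable_sums by metis
  qed
qed

lemma bounded_pseries_suminf:
  assumes \<rho>: "0 < \<rho>" and \<phi>: "\<And>k. bounded_pseries (\<phi> k) \<rho> (R k)" and R: "summable R"
    and sums: "\<And>y. norm y < \<rho> \<Longrightarrow> (\<lambda>k. \<phi> k y) sums \<psi> y"
  shows "bounded_pseries \<psi> \<rho> (suminf R)"
proof (rule bounded_pseries_limit[OF \<rho>])
  show "bounded_pseries (\<lambda>y. \<Sum>k<n. \<phi> k y) \<rho> (suminf R)" for n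
    by (rule bounded_pseries_mono[OF bounded_pseries_sum])
      (use \<rho> \<phi> R bounded_pseries_nonneg[OF \<phi>] in \<open>auto intro: sum_le_suminf\<close>)
qed (use sums in \<open>simp add: sums_def\<close>)

text \<open>On the segment from \<open>x1\<close> to \<open>z\<close> the parameters near which
  \<open>F\<close> equals \<open>c\<close> form an open set. It is also closed: a one-variable power
  series that is not identically \<open>c\<close> avoids the value \<open>c\<close> on a small
  punctured interval.\<close>

lemma analytic_locally_constant_imp_constant:
  fixes F :: "real^'n \<Rightarrow> real"
  assumes an: "\<And>z. z \<in> S \<Longrightarrow> \<exists>a r. pseries a F z r" and S: "convex S"
    and x1: "x1 \<in> S" and e: "e > 0" "\<And>z. z \<in> ball x1 e \<Longrightarrow> F z = c" and z: "z \<in> S"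
  shows "F z = c"
proof -
  define g where "g t = x1 + t *\<^sub>R (z - x1)" for t :: real
  have gS: "g t \<in> S" if "t \<in> {0..1}" for t
  proof -
    have "g t = (1 - t) *\<^sub>R x1 + t *\<^sub>R z" by (simp add: g_def algebra_simps)
    then show ?thesis using that S x1 z by (simp add: convex_alt)
  qed
  define T' where "T' = {t. \<exists>d>0. \<forall>u. \<bar>u - t\<bar> < d \<longrightarrow> F (g u) = c}"
  have "open T'" unfolding open_dist
  proof
    fix t assume "t \<in> T'"
    then obtain d where d: "d > 0" "\<And>u. \<bar>u - t\<bar> < d \<Longrightarrow> F (g u) = c" by (auto simp: T'_def)
    have "s \<in> T'" if "dist s t < d" for s
    proof -
      have "\<forall>u. \<bar>u - s\<bar> < d - dist s t \<longrightarrow> F (g u) = c"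
        using d(2) by (auto simp: dist_real_def)
      then show ?thesis unfolding T'_def using that by (intro CollectI exI[of _ "d - dist s t"]) auto
    qed
    then show "\<exists>e>0. \<forall>s. dist s t < e \<longrightarrow> s \<in> T'" using d(1) by blast
  qed
  then have o: "openin (top_of_set {0..1}) ({0..1} \<inter> T')" by (simp add: openin_open_Int)
  have nT: "\<exists>d>0. \<forall>u. \<bar>u - t\<bar> < d \<longrightarrow> u \<notin> T'" if t: "t \<in> {0..1}" "t \<notin> T'" for t
  proof -
    obtain a r where ps: "pseries a F (g t) r"
      using an[OF gS[OF t(1)]] by blast
    define s where "s = r / (norm (z - x1) + 1)"
    have r: "r > 0" using ps by (simp add: pseries_def)
    have s: "s > 0" using r by (simp add: s_def add_nonneg_pos)
    \<comment> \<open>Coefficients of \<open>F (g u) - c\<close> as a power series in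
      \<open>u - t\<close>.\<close>
    define k where "k m = (if m = 0 then a 0 - c else hom_part a m (z - x1))" for m
    have F: "(\<lambda>m. k m * (u - t) ^ m) sums (F (g u) - c)" if u: "norm (u - t) < s" for u
    proof -
      have "norm ((u - t) *\<^sub>R (z - x1)) \<le> \<bar>u - t\<bar> * (norm (z - x1) + 1)" by (simp add: mult_left_mono)
      also have "\<dots> < r" using u by (simp add: s_def pos_less_divide_eq add_nonneg_pos)
      finally have "(\<lambda>m. hom_part a m ((u - t) *\<^sub>R (z - x1))) sums F (g t + (u - t) *\<^sub>R (z - x1))"
        using ps by (simp add: pseries_def)
      moreover have "g t + (u - t) *\<^sub>R (z - x1) = g u" by (simp add: g_def algebra_simps)
      ultimately have s1: "(\<lambda>m. (u - t) ^ m * hom_part a m (z - x1)) sums F (g u)"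
        by (simp add: hom_part_scale)
      have "(\<lambda>m. if m = 0 then c else 0) sums c" using sums_single[of 0 "\<lambda>_. c"] by simp
      from sums_diff[OF s1 this]
      show ?thesis by (rule sums_cong[THEN iffD1, rotated]) (auto simp: k_def)
    qed
    show ?thesis
    proof (cases "\<forall>m. k m = 0")
      case True
      have "F (g u) = c" if "\<bar>u - t\<bar> < s" for u
      proof -
        have "(\<lambda>m. 0) sums (F (g u) - c)" using F[of u] that True by simp
        from sums_unique2[OF this sums_zero] show ?thesis by simp
      qed
      then show ?thesis using t(2) s by (auto simp: T'_def)
    next
      case False
      have "\<exists>d>0. \<forall>u. 0 < \<bar>u - t\<bar> \<and> \<bar>u - t\<bar> < d \<longrightarrow> F (g u) - c \<noteq> 0"
      \<comment> \<open>If the constant coefficient vanishes, some other one does not and the zero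
        is isolated. If it does not vanish, the limit at \<open>t\<close> already keeps
        \<open>F\<close> away from \<open>c\<close>.\<close>
      proof (cases "k 0 = 0")
        case True
        with False obtain m where m: "k m \<noteq> 0" "m > 0" by (metis gr0I)
        have F0: "F (g t) - c = 0"
        proof -
          have "(\<lambda>m. k m * 0 ^ m) sums (F (g t) - c)" using F[of t] s by simp
          from sums_unique2[OF this powser_sums_zero] True show ?thesis by simp
        qed
        obtain d where d: "d > 0" "\<And>u. u \<in> cball t d - {t} \<Longrightarrow> F (g u) - c \<noteq> 0"
          using powser_0_nonzero[of s t k "\<lambda>u. F (g u) - c" m, OF s F F0 m] by blast
        have "F (g u) - c \<noteq> 0" if "0 < \<bar>u - t\<bar>" "\<bar>u - t\<bar> < d" for u
          using d(2)[of u] that by (auto simp: dist_real_def abs_minus_commute)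
        with d(1) show ?thesis by blast
      next
        case k0: False
        have "((\<lambda>v. F (g (t + v)) - c) \<longlongrightarrow> k 0) (at 0)"
        proof (rule powser_limit_0[OF s])
          fix v :: real assume "norm v < s"
          with F[of "t + v"] show "(\<lambda>m. k m * v ^ m) sums (F (g (t + v)) - c)" by simp
        qed
        from tendsto_imp_eventually_ne[OF this k0]
        obtain d where d: "d > 0" "\<And>v. v \<noteq> 0 \<Longrightarrow> \<bar>v\<bar> < d \<Longrightarrow> F (g (t + v)) - c \<noteq> 0"
          by (auto simp: eventually_at dist_real_def)
        have "F (g u) - c \<noteq> 0" if "0 < \<bar>u - t\<bar>" "\<bar>u - t\<bar> < d" for u
          using d(2)[of "u - t"] that by simp
        with d(1) show ?thesis by blast
      qed
      then obtain d where d: "d > 0" "\<And>u. 0 < \<bar>u - t\<bar> \<Longrightarrow> \<bar>u - t\<bar> < d \<Longrightarrow> F (g u) \<noteq> c" by auto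
      have "u \<notin> T'" if u: "\<bar>u - t\<bar> < d" for u
      proof
        assume "u \<in> T'"
        with t(2) have "u \<noteq> t" by auto
        then have "F (g u) \<noteq> c" using d u by simp
        moreover have "F (g u) = c" using \<open>u \<in> T'\<close> by (auto simp: T'_def)
        ultimately show False by simp
      qed
      then show ?thesis using d(1) by blast
    qed
  qed
  have cl: "closedin (top_of_set {0..1}) ({0..1} \<inter> T')"
    unfolding closedin_def
  proof (intro conjI)
    show "openin (top_of_set {0..1}) (topspace (top_of_set {0..1}) - {0..1} \<inter> T')"
      unfolding openin_euclidean_subtopology_iff
    proof (intro conjI ballI)
      fix t assume "t \<in> topspace (top_of_set {0..1}) - {0..1} \<inter> T'"
      then obtain d where "d > 0" "\<And>u. \<bar>u - t\<bar> < d \<Longrightarrow> u \<notin> T'"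
        using nT[of t] by auto
      then show "\<exists>e>0. \<forall>u\<in>{0..1}. dist u t < e \<longrightarrow> u \<in> topspace (top_of_set {0..1}) - {0..1} \<inter> T'"
        by (intro exI[of _ d]) (auto simp: dist_real_def)
    qed auto
  qed auto
  have "0 \<in> T'"
  proof -
    have n: "0 < norm (z - x1) + 1" by (simp add: add_nonneg_pos)
    have "F (g u) = c" if "\<bar>u\<bar> < e / (norm (z - x1) + 1)" for u
    proof -
      have "\<bar>u\<bar> * norm (z - x1) \<le> \<bar>u\<bar> * (norm (z - x1) + 1)" by (simp add: mult_left_mono)
      also have "\<dots> < e" using that n by (simp add: pos_less_divide_eq)
      finally show ?thesis by (intro e(2)) (simp add: g_def dist_norm)
    qed
    then show ?thesis using e(1) n unfolding T'_def
      by (intro CollectI exI[of _ "e / (norm (z - x1) + 1)"]) simp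
  qed
  then have "{0..1} \<inter> T' \<noteq> {}" by force
  moreover have "connected {0..1::real}" by simp
  ultimately have "{0..1} \<inter> T' = {0..1}" using o cl unfolding connected_clopen by blast
  then have "1 \<in> T'" by force
  then have "F (g 1) = c" by (auto simp: T'_def)
  then show ?thesis by (simp add: g_def)
qed

section \<open>The inverse of an analytic map\<close>

lemma pseries_mono:
  assumes "pseries a F x r" "0 < s" "s \<le> r"
  shows "pseries a F x s"
proof -
  have "summable (\<lambda>k. abs_part a k * s ^ k)"
  proof (rule summable_comparison_test')
    show "summable (\<lambda>k. abs_part a k * r ^ k)" using assms(1) by (simp add: pseries_def)
    show "norm (abs_part a k * s ^ k) \<le> abs_part a k * r ^ k" if "k \<ge> 0" for k
      using assms(2,3) by (simp add: abs_mult abs_part_nonneg mult_left_mono power_mono)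
  qed
  then show ?thesis using assms by (simp add: pseries_def)
qed

lemma pseries_center:
  assumes "pseries a F x r"
  shows "F x = a 0"
proof -
  have "(\<lambda>k. hom_part a k 0) sums F (x + 0)" using assms unfolding pseries_def by (metis norm_zero)
  moreover have "(\<lambda>k. hom_part a k 0 * 0 ^ k) = (\<lambda>k. hom_part a k 0)"
  proof
    show "hom_part a k 0 * 0 ^ k = hom_part a k 0" for k
      using hom_part_scale[of a k 0 0] by (cases k) auto
  qed
  with powser_sums_zero[of "\<lambda>k. hom_part a k 0"] have "(\<lambda>k. hom_part a k 0) sums hom_part a 0 0"
    by simp
  ultimately have "F (x + 0) = hom_part a 0 0" by (rule sums_unique2)
  then show ?thesis by simp
qed

lemma pseries_common_radius:
  fixes F :: "real^'n \<Rightarrow> real^'m"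
  assumes "real_analytic_at F x"
  obtains a r where "\<And>j. pseries (a j) (\<lambda>z. F z $ j) x r"
proof -
  have "\<forall>j. \<exists>a r. pseries a (\<lambda>z. F z $ j) x r"
    using real_analytic_at_imp_pseries[OF real_analytic_at_component[OF assms]] by blast
  then obtain a r where ar: "\<And>j. pseries (a j) (\<lambda>z. F z $ j) x (r j)" by metis
  have "0 < Min (range r)" using ar by (subst Min_gr_iff) (auto simp: pseries_def)
  then have "pseries (a j) (\<lambda>z. F z $ j) x (Min (range r))" for j
    by (rule pseries_mono[OF ar]) simp
  then show thesis by (rule that)
qed

lemma hom_part_1: "hom_part a (Suc 0) u = (\<Sum>l\<in>UNIV. u$l * dcoef l a 0)"
  using Euler_hom_part[of u a 0] by (simp add: dir_coef_def)

text \<open>Writing \<open>F (x + u) = F x + A u + N u\<close>, the inverse solves \<open>u = B (w - N u)\<close>. The Picard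
  iterates of this equation are power series in \<open>w\<close> with uniformly bounded weighted
  \<open>\<ell>\<^sup>1\<close>-norms of coefficients, and such families are closed under pointwise limits.\<close>

theorem real_analytic_at_local_inverse:
  fixes F :: "real^'n \<Rightarrow> real^'n"
  assumes F: "real_analytic_at F x"
    and B: "B ** (\<chi> j l. partial_deriv l (\<lambda>z. F z $ j) x) = mat 1"
    and cont: "isCont \<Phi> (F x)" and \<Phi>: "\<Phi> (F x) = x" "\<forall>\<^sub>F w in nhds (F x). F (\<Phi> w) = w"
  shows "real_analytic_at \<Phi> (F x)"
proof -
  obtain a r where ps: "\<And>j. pseries (a j) (\<lambda>z. F z $ j) x r"
    using pseries_common_radius[OF F] by blast
  have r: "0 < r" using ps by (simp add: pseries_def)
  define D where "D j l z = partial_deriv l (\<lambda>z. F z $ j) z" for j l z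
  have psD: "pseries (dcoef l (a j)) (D j l) x (r/2)" for j l
    unfolding D_def by (rule pseries_partial_deriv(1)[OF ps])
  have derF: "((\<lambda>z. F z $ j) has_derivative (\<lambda>h. \<Sum>l\<in>UNIV. h$l * D j l z)) (at z)" if "dist x z < r/2" for j z
    unfolding D_def by (rule pseries_partial_deriv(2)[OF ps that])
  have Dx: "D j l x = dcoef l (a j) 0" for j l by (rule pseries_center[OF psD])
  \<comment> \<open>The part of \<open>F\<close> of degree at least two, which explains the shift by
    2 in its series.\<close>
  define N where "N j u = F (x + u) $ j - F x $ j - (\<Sum>l\<in>UNIV. u$l * D j l x)" for j u
  have N_sums: "(\<lambda>k. hom_part (a j) (k + 2) u) sums N j u" if "norm u < r" for j u
  proof -
    have "(\<lambda>k. hom_part (a j) k u) sums F (x + u) $ j" using ps[of j] that by (simp add: pseries_def)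
    moreover have "N j u + (\<Sum>i<2. hom_part (a j) i u) = F (x + u) $ j"
      using pseries_center[OF ps[of j]] by (simp add: N_def numeral_2_eq_2 hom_part_1 Dx)
    ultimately show ?thesis by (subst sums_iff_shift) simp
  qed
  define n where "n = real CARD('n)"
  have n: "n \<ge> 1" by (simp add: n_def Suc_leI)
  \<comment> \<open>\<open>\<beta>\<close> dominates every row sum of \<open>B\<close> and also the
    sum of all entries. The summand 1 makes divisions by it safe.\<close>
  define \<beta> where "\<beta> = 1 + (\<Sum>i\<in>UNIV. \<Sum>j\<in>UNIV. \<bar>B$i$j\<bar>)"
  have \<beta>: "\<beta> \<ge> 1" by (simp add: \<beta>_def sum_nonneg)
  have row: "(\<Sum>j\<in>UNIV. \<bar>B$i$j\<bar>) \<le> \<beta>" for i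
  proof -
    have "(\<Sum>j\<in>UNIV. \<bar>B$i$j\<bar>) \<le> (\<Sum>i\<in>UNIV. \<Sum>j\<in>UNIV. \<bar>B$i$j\<bar>)"
      by (rule member_le_sum) (auto intro: sum_nonneg)
    then show ?thesis by (simp add: \<beta>_def)
  qed
  \<comment> \<open>Weighted norm of \<open>N j\<close> with two powers of the radius split off:
    substituting series of norm S \<le> r yields norm at most S^2 times
    \<open>\<kappa> j\<close>.\<close>
  define \<kappa> where "\<kappa> j = (\<Sum>k. abs_part (a j) (k + 2) * r ^ k)" for j
  have sk: "summable (\<lambda>k. abs_part (a j) (k + 2) * r ^ k)" for j
  proof -
    have "summable (\<lambda>k. abs_part (a j) (k + 2) * r ^ (k + 2))"
      using ps[of j] unfolding pseries_def by (subst summable_iff_shift) simp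
    from summable_divide[OF this, of "r^2"]
    have "summable (\<lambda>k. abs_part (a j) (k + 2) * r ^ (k + 2) / r^2)" .
    moreover have "abs_part (a j) (k + 2) * r ^ (k + 2) / r^2 = abs_part (a j) (k + 2) * r ^ k" for k
      using r by (simp add: power2_eq_square)
    ultimately show ?thesis by (simp only:)
  qed
  have \<kappa>: "\<kappa> j \<ge> 0" for j
    unfolding \<kappa>_def using r by (intro suminf_nonneg sk) (auto simp: abs_part_nonneg)
  define \<kappa>s where "\<kappa>s = 1 + (\<Sum>j\<in>UNIV. \<kappa> j)"
  have \<kappa>s: "\<kappa>s \<ge> 1" "\<kappa> j \<le> \<kappa>s" for j
    using \<kappa> member_le_sum[of j UNIV \<kappa>] by (auto simp: \<kappa>s_def sum_nonneg)
  \<comment> \<open>Chosen so that \<open>\<beta> * n * \<epsilon>\<close> is 1/2, the contraction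
    factor of the iteration.\<close>
  define \<epsilon> where "\<epsilon> = 1 / (2 * \<beta> * n)"
  have \<epsilon>: "\<epsilon> > 0" using \<beta> n by (simp add: \<epsilon>_def)
  have Dt: "(D j l \<longlongrightarrow> D j l x) (nhds x)" for j l
    using pseries_isCont[OF psD] by (simp add: isCont_def tendsto_at_iff_tendsto_nhds)
  have "\<forall>\<^sub>F z in nhds x. \<forall>j l. dist (D j l z) (D j l x) < \<epsilon>"
    by (intro eventually_all_finite tendstoD[OF Dt \<epsilon>])
  then obtain \<delta>0 where "\<delta>0 > 0" and \<delta>0: "\<And>z j l. dist z x < \<delta>0 \<Longrightarrow> dist (D j l z) (D j l x) < \<epsilon>"
    unfolding eventually_nhds_metric by blast
  define \<delta> where "\<delta> = min \<delta>0 (r/2)"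
  have \<delta>: "\<delta> > 0" using \<open>\<delta>0 > 0\<close> r by (simp add: \<delta>_def)
  have lip: "\<bar>N j u - N j u'\<bar> \<le> n * \<epsilon> * norm (u - u')" if u: "norm u < \<delta>" "norm u' < \<delta>" for j u u'
  proof -
    have "norm (N j u - N j u') \<le> (n * \<epsilon>) * norm (u - u')"
    proof (rule differentiable_bound[of "ball 0 \<delta>"])
      fix u :: "real^'n" assume "u \<in> ball 0 \<delta>"
      then have u: "norm u < \<delta>" by simp
      have d1: "((\<lambda>u. F (x + u) $ j) has_derivative (\<lambda>h. \<Sum>l\<in>UNIV. h$l * D j l (x + u))) (at u)"
      proof (rule has_derivative_compose[where f="\<lambda>u. x + u" and g="\<lambda>z. F z $ j" and f'="\<lambda>h. h"])
        show "((\<lambda>u. x + u) has_derivative (\<lambda>h. h)) (at u)" by (auto intro!: derivative_eq_intros)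
        show "((\<lambda>z. F z $ j) has_derivative (\<lambda>h. \<Sum>l\<in>UNIV. h$l * D j l (x + u))) (at (x + u))"
          by (rule derF) (use u in \<open>simp add: \<delta>_def dist_norm\<close>)
      qed
      have d2: "((\<lambda>u. \<Sum>l\<in>UNIV. u$l * D j l x) has_derivative (\<lambda>h. \<Sum>l\<in>UNIV. h$l * D j l x)) (at u)"
        by (intro has_derivative_sum has_derivative_mult_left bounded_linear_imp_has_derivative bounded_linear_vec_nth)
      note d = has_derivative_diff[OF has_derivative_diff[OF d1 has_derivative_const] d2]
      have eq: "(\<lambda>h. (\<Sum>l\<in>UNIV. h$l * D j l (x + u)) - 0 - (\<Sum>l\<in>UNIV. h$l * D j l x))
          = (\<lambda>h. \<Sum>l\<in>UNIV. h$l * (D j l (x + u) - D j l x))"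
        by (simp add: right_diff_distrib sum_subtractf)
      from has_derivative_at_withinI[OF d[of "F x $ j"], of "ball 0 \<delta>"]
      show "(N j has_derivative (\<lambda>h. \<Sum>l\<in>UNIV. h$l * (D j l (x + u) - D j l x))) (at u within ball 0 \<delta>)"
        by (simp only: eq N_def[abs_def])
      show "onorm (\<lambda>h. \<Sum>l\<in>UNIV. h$l * (D j l (x + u) - D j l x)) \<le> n * \<epsilon>"
      proof (rule onorm_le)
        fix h :: "real^'n"
        have "norm (\<Sum>l\<in>UNIV. h$l * (D j l (x + u) - D j l x)) \<le> (\<Sum>l\<in>(UNIV::'n set). norm h * \<epsilon>)"
        proof (rule order_trans[OF norm_sum sum_mono])
          fix l
          have "dist (D j l (x + u)) (D j l x) < \<epsilon>"
            by (rule \<delta>0) (use u in \<open>simp add: \<delta>_def dist_norm\<close>)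
          then show "norm (h$l * (D j l (x + u) - D j l x)) \<le> norm h * \<epsilon>"
            unfolding norm_mult by (intro mult_mono) (auto simp: dist_norm component_le_norm_cart)
        qed
        then show "norm (\<Sum>l\<in>UNIV. h$l * (D j l (x + u) - D j l x)) \<le> n * \<epsilon> * norm h"
          by (simp add: n_def mult_ac)
      qed
    qed (use u in auto)
    then show ?thesis by simp
  qed
  \<comment> \<open>Common norm bound for the coordinates of all iterates. The first two terms keep
    vectors with such coordinates inside the domain of convergence and the domain of the Lipschitz
    estimate; the third makes the nonlinear part contribute at most S/2.\<close>
  define S where "S = min (min (r / (2 * n)) (\<delta> / (2 * n))) (1 / (2 * \<beta> * \<kappa>s))"
  have S: "0 < S" using r \<delta> n \<beta> \<kappa>s(1) by (simp add: S_def)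
  have "S \<le> r / (2 * n)" "S \<le> \<delta> / (2 * n)" "S \<le> 1 / (2 * \<beta> * \<kappa>s)" by (auto simp: S_def)
  then have nS: "n * S < r" "n * S < \<delta>" and SK: "\<beta> * S * \<kappa>s \<le> 1 / 2"
    using r \<delta> n \<beta> \<kappa>s(1) by (auto simp: field_simps)
  have Sr: "S \<le> r" using nS(1) n S by (smt (verit) mult_le_cancel_right1)
  have "(\<Phi> \<longlongrightarrow> \<Phi> (F x)) (nhds (F x))"
    using cont unfolding isCont_def by (subst (asm) tendsto_at_iff_tendsto_nhds)
  from tendstoD[OF this \<delta>] have "\<forall>\<^sub>F w in nhds (F x). dist (\<Phi> w) x < \<delta>" by (simp add: \<Phi>(1))
  with \<Phi>(2) have "\<forall>\<^sub>F w in nhds (F x). F (\<Phi> w) = w \<and> dist (\<Phi> w) x < \<delta>"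
    by (rule eventually_conj)
  then obtain \<rho>0 where "\<rho>0 > 0" and \<rho>0: "\<And>w. dist w (F x) < \<rho>0 \<Longrightarrow> F (\<Phi> w) = w \<and> dist (\<Phi> w) x < \<delta>"
    unfolding eventually_nhds_metric by blast
  \<comment> \<open>The linear part of the iteration then contributes at most S/2, the other half of
    the bound \<open>S\<close>.\<close>
  define \<rho> where "\<rho> = min \<rho>0 (S / (2 * \<beta>))"
  have \<rho>: "\<rho> > 0" using \<open>\<rho>0 > 0\<close> S \<beta> by (simp add: \<rho>_def)
  have "\<rho> \<le> S / (2 * \<beta>)" by (simp add: \<rho>_def)
  then have \<rho>S: "\<beta> * \<rho> \<le> S / 2" using \<beta> by (simp add: field_simps)
  have nle: "norm v \<le> n * S" if "\<And>i. \<bar>v$i\<bar> \<le> S" for v :: "real^'n"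
  proof -
    have "norm v \<le> (\<Sum>i\<in>UNIV. \<bar>v$i\<bar>)" by (rule norm_le_l1_cart)
    also have "\<dots> \<le> (\<Sum>i\<in>(UNIV::'n set). S)" by (intro sum_mono that)
    finally show ?thesis by (simp add: n_def)
  qed
  define T where "T v w = (\<chi> i. \<Sum>j\<in>UNIV. B$i$j * (w$j + (-1) * N j v))" for v w :: "real^'n"
  define v where "v m w = ((\<lambda>u. T u w) ^^ m) 0" for m w
  have bv: "bounded_pseries (\<lambda>w. v m w $ i) \<rho> S" for m i
  proof (induction m arbitrary: i)
    case 0
    show ?case unfolding v_def using bounded_pseries_const[of \<rho> 0] \<rho> S
      by (auto intro: bounded_pseries_mono)
  next
    case (Suc m)
    have bN: "bounded_pseries (\<lambda>w. N j (v m w)) \<rho> (S^2 * \<kappa>s)" for j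
    proof (rule bounded_pseries_mono)
      show "bounded_pseries (\<lambda>w. N j (v m w)) \<rho> (\<Sum>k. S^2 * (abs_part (a j) (k + 2) * r ^ k))"
      proof (rule bounded_pseries_suminf[OF \<rho>])
        show "bounded_pseries (\<lambda>w. hom_part (a j) (k + 2) (v m w)) \<rho> (S^2 * (abs_part (a j) (k + 2) * r ^ k))" for k
        proof (rule bounded_pseries_mono[OF bounded_pseries_hom_part])
          show "abs_part (a j) (k + 2) * S ^ (k + 2) \<le> S^2 * (abs_part (a j) (k + 2) * r ^ k)"
          proof -
            have "abs_part (a j) (k + 2) * S ^ (k + 2) = (S^2 * abs_part (a j) (k + 2)) * S ^ k"
              by (simp add: power2_eq_square)
            also have "\<dots> \<le> (S^2 * abs_part (a j) (k + 2)) * r ^ k"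
              using S Sr by (intro mult_left_mono power_mono mult_nonneg_nonneg abs_part_nonneg) auto
            finally show ?thesis by (simp only: mult.assoc)
          qed
        qed (use \<rho> Suc.IH in auto)
        show "summable (\<lambda>k. S^2 * (abs_part (a j) (k + 2) * r ^ k))" by (intro summable_mult sk)
        fix w :: "real^'n" assume w: "norm w < \<rho>"
        have "norm (v m w) \<le> n * S" by (intro nle bounded_pseries_abs_le[OF Suc.IH w])
        then show "(\<lambda>k. hom_part (a j) (k + 2) (v m w)) sums N j (v m w)"
          using nS by (intro N_sums) linarith
      qed
      have "(\<Sum>k. S^2 * (abs_part (a j) (k + 2) * r ^ k)) = S^2 * \<kappa> j"
        unfolding \<kappa>_def by (rule suminf_mult[OF sk])
      also have "\<dots> \<le> S^2 * \<kappa>s" by (intro mult_left_mono \<kappa>s) auto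
      finally show "(\<Sum>k. S^2 * (abs_part (a j) (k + 2) * r ^ k)) \<le> S^2 * \<kappa>s" .
    qed
    have "bounded_pseries (\<lambda>w. \<Sum>j\<in>UNIV. B$i$j * (w$j + (-1) * N j (v m w))) \<rho>
        (\<Sum>j\<in>UNIV. \<bar>B$i$j\<bar> * (\<rho> + \<bar>-1\<bar> * (S^2 * \<kappa>s)))"
      using \<rho> by (intro bounded_pseries_sum bounded_pseries_cmult bounded_pseries_add bounded_pseries_coord bN) auto
    moreover have "(\<Sum>j\<in>UNIV. \<bar>B$i$j\<bar> * (\<rho> + \<bar>-1\<bar> * (S^2 * \<kappa>s))) \<le> S"
    proof -
      have "(\<Sum>j\<in>UNIV. \<bar>B$i$j\<bar> * (\<rho> + \<bar>-1\<bar> * (S^2 * \<kappa>s))) = (\<Sum>j\<in>UNIV. \<bar>B$i$j\<bar>) * (\<rho> + S^2 * \<kappa>s)"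
        by (simp add: sum_distrib_right)
      also have "\<dots> \<le> \<beta> * (\<rho> + S^2 * \<kappa>s)"
        using \<rho> \<kappa>s(1) by (intro mult_right_mono row) auto
      also have "\<dots> = \<beta> * \<rho> + S * (\<beta> * S * \<kappa>s)" by (simp add: algebra_simps power2_eq_square)
      also have "\<dots> \<le> S / 2 + S * (1 / 2)" using S by (intro add_mono \<rho>S mult_left_mono SK) auto
      finally show ?thesis by simp
    qed
    ultimately show ?case unfolding v_def T_def by (auto intro: bounded_pseries_mono)
  qed
  define u where "u w = \<Phi> (F x + w) - x" for w
  \<comment> \<open>The fixed point is already given by \<open>\<Phi>\<close>, so it is enough that
    each iteration halves the distance to it.\<close>
  have lim: "(\<lambda>m. v m w $ i) \<longlonglongrightarrow> u w $ i" if w: "norm w < \<rho>" for w i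
  proof -
    have F\<Phi>: "F (\<Phi> (F x + w)) = F x + w" and ud: "norm (u w) < \<delta>"
      using \<rho>0[of "F x + w"] w by (auto simp: \<rho>_def dist_norm u_def)
    have fixp: "T (u w) w = u w"
    proof -
      have "w$j + (-1) * N j (u w) = ((\<chi> j l. partial_deriv l (\<lambda>z. F z $ j) x) *v u w) $ j" for j
        using F\<Phi> by (simp add: N_def u_def matrix_vector_mult_def D_def mult.commute)
      then have "T (u w) w = B *v ((\<chi> j l. partial_deriv l (\<lambda>z. F z $ j) x) *v u w)"
        by (simp add: T_def vec_eq_iff matrix_vector_mult_def[of B])
      also have "\<dots> = u w" unfolding matrix_vector_mul_assoc B by simp
      finally show ?thesis .
    qed
    have vd: "norm (v m w) < \<delta>" for m
      using nle[of "v m w"] bounded_pseries_abs_le[OF bv w] nS by (meson le_less_trans)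
    have half: "norm (v (Suc m) w - u w) \<le> 1/2 * norm (v m w - u w)" for m
    proof -
      let ?e = "norm (v m w - u w)"
      have "v (Suc m) w = T (v m w) w" by (simp add: v_def)
      then have "v (Suc m) w - u w = T (v m w) w - T (u w) w" using fixp by simp
      moreover have "(T (v m w) w - T (u w) w) $ i = (\<Sum>j\<in>UNIV. B$i$j * (N j (u w) - N j (v m w)))" for i
        by (simp add: T_def sum_subtractf[symmetric] right_diff_distrib[symmetric])
      ultimately have c: "(v (Suc m) w - u w) $ i = (\<Sum>j\<in>UNIV. B$i$j * (N j (u w) - N j (v m w)))" for i
        by simp
      have "norm (v (Suc m) w - u w) \<le> (\<Sum>i\<in>UNIV. \<bar>(v (Suc m) w - u w) $ i\<bar>)" by (rule norm_le_l1_cart)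
      also have "\<dots> \<le> (\<Sum>i\<in>UNIV. \<Sum>j\<in>UNIV. \<bar>B$i$j\<bar> * (n * \<epsilon> * ?e))"
      proof (rule sum_mono)
        fix i
        show "\<bar>(v (Suc m) w - u w) $ i\<bar> \<le> (\<Sum>j\<in>UNIV. \<bar>B$i$j\<bar> * (n * \<epsilon> * ?e))"
          unfolding c
        proof (rule order_trans[OF sum_abs sum_mono])
          fix j
          show "\<bar>B$i$j * (N j (u w) - N j (v m w))\<bar> \<le> \<bar>B$i$j\<bar> * (n * \<epsilon> * ?e)"
            unfolding abs_mult using lip[OF ud vd, of j m] by (intro mult_left_mono) (auto simp: norm_minus_commute)
        qed
      qed
      also have "\<dots> = (\<Sum>i\<in>UNIV. \<Sum>j\<in>UNIV. \<bar>B$i$j\<bar>) * (n * \<epsilon> * ?e)"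
        by (simp add: sum_distrib_right)
      also have "\<dots> \<le> \<beta> * (n * \<epsilon> * ?e)"
        using n \<epsilon> by (intro mult_right_mono) (auto simp: \<beta>_def)
      also have "\<dots> = 1/2 * ?e" using n \<beta> by (simp add: \<epsilon>_def)
      finally show ?thesis .
    qed
    have geo: "norm (v m w - u w) \<le> (1/2) ^ m * norm (v 0 w - u w)" for m
    proof (induction m)
      case (Suc m)
      have "norm (v (Suc m) w - u w) \<le> 1/2 * norm (v m w - u w)" by (rule half)
      also have "\<dots> \<le> 1/2 * ((1/2) ^ m * norm (v 0 w - u w))" by (intro mult_left_mono Suc.IH) auto
      finally show ?case by simp
    qed simp
    have "(\<lambda>m. v m w - u w) \<longlonglongrightarrow> 0"
    proof (rule Lim_null_comparison)
      show "(\<lambda>m. (1/2) ^ m * norm (v 0 w - u w)) \<longlonglongrightarrow> 0"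
        by (rule tendsto_mult_left_zero) (rule LIMSEQ_realpow_zero, auto)
    qed (rule always_eventually, use geo in blast)
    then have "(\<lambda>m. v m w) \<longlonglongrightarrow> u w" by (simp add: LIM_zero_iff)
    then show ?thesis by (rule tendsto_vec_nth)
  qed
  have bu: "bounded_pseries (\<lambda>w. u w $ i) \<rho> S" for i
    by (rule bounded_pseries_limit[OF \<rho> bv lim])
  show ?thesis
  proof (rule real_analytic_at_vec[OF \<rho>])
    fix i
    have "bounded_pseries (\<lambda>w. u w $ i + x $ i) \<rho> (S + \<bar>x $ i\<bar>)"
      using \<rho> by (intro bounded_pseries_add bu bounded_pseries_const) auto
    then show "bounded_pseries (\<lambda>w. \<Phi> (F x + w) $ i) \<rho> (S + norm x)"
      by (rule bounded_pseries_mono[OF bounded_pseries_cong]) (auto simp: u_def component_le_norm_cart)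
  qed
qed

section \<open>Homogeneous harmonic immersions of space\<close>

text \<open>After subtraction of \<open>s * t^2\<close> this is the second derivative test at a
  global minimum: were \<open>c - 2 * s\<close> negative, the derivative would be negative just to
  the right of 0, and the mean value theorem would give a value below the minimum.\<close>

lemma second_order_min:
  fixes f :: "real \<Rightarrow> real"
  assumes f: "\<And>t. (f has_real_derivative f' t) (at t)" and f': "(f' has_real_derivative c) (at 0)"
    and min: "\<And>t. f 0 + s * t^2 \<le> f t"
  shows "f' 0 = 0" "2 * s \<le> c"
proof -
  define g where "g t = f t - s * t^2" for t
  define g' where "g' t = f' t - 2 * s * t" for t
  have g: "(g has_real_derivative g' t) (at t)" for t
    unfolding g_def g'_def by (auto intro!: derivative_eq_intros f)
  have gmin: "g 0 \<le> g t" for t using min[of t] by (simp add: g_def)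
  have "g' 0 = 0" by (rule DERIV_local_min[OF g, of 1]) (use gmin in auto)
  then show "f' 0 = 0" by (simp add: g'_def)
  show "2 * s \<le> c"
  proof (rule ccontr)
    assume "\<not> 2 * s \<le> c"
    then have neg: "c - 2 * s < 0" by simp
    have "(g' has_real_derivative (c - 2 * s)) (at 0)"
      unfolding g'_def by (auto intro!: derivative_eq_intros f')
    from DERIV_neg_dec_right[OF this neg]
    obtain d where d: "d > 0" "\<And>h. h > 0 \<Longrightarrow> h < d \<Longrightarrow> g' h < 0"
      using \<open>g' 0 = 0\<close> by auto
    obtain z where z: "0 < z" "z < d/2" "g (d/2) - g 0 = (d/2 - 0) * g' z"
      using MVT2[of 0 "d/2" g g'] g d(1) by auto
    have "g' z < 0" using d z by simp
    then have "g (d/2) - g 0 < 0" unfolding z(3) using d(1) by (simp add: mult_pos_neg)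
    then show False using gmin[of "d/2"] by simp
  qed
qed

text \<open>Jacobi's formula at the identity and its derivative: with X = \<open>d1\<close> and Y =
  \<open>d2\<close> at 0, the first derivative of the determinant is tr X and the second is tr Y +
  (tr X)^2 - tr (X^2).\<close>

lemma det3_curve:
  fixes d d1 :: "3 \<Rightarrow> 3 \<Rightarrow> real \<Rightarrow> real"
  assumes d: "\<And>j b t. (d j b has_real_derivative d1 j b t) (at t)"
    and d1: "\<And>j b. (d1 j b has_real_derivative d2 j b) (at 0)"
    and d0: "\<And>j b. d j b 0 = (if j = b then 1 else 0)"
  obtains \<phi>' where
    "\<And>t. ((\<lambda>t. det (\<chi> j b. d j b t)) has_real_derivative \<phi>' t) (at t)"
    "\<phi>' 0 = (\<Sum>j\<in>UNIV. d1 j j 0)"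
    "(\<phi>' has_real_derivative ((\<Sum>j\<in>UNIV. d2 j j) + (\<Sum>j\<in>UNIV. d1 j j 0)^2
        - (\<Sum>j\<in>UNIV. \<Sum>b\<in>UNIV. d1 j b 0 * d1 b j 0))) (at 0)"
proof -
  define T where "T a b c a' b' c' t = a' t * b t * c t + a t * b' t * c t + a t * b t * c' t"
    for a b c a' b' c' :: "real \<Rightarrow> real" and t
  have T1: "((\<lambda>t. a t * b t * c t) has_real_derivative T a b c a' b' c' t) (at t)"
    if "(a has_real_derivative a' t) (at t)" "(b has_real_derivative b' t) (at t)"
      "(c has_real_derivative c' t) (at t)" for a b c a' b' c' t
    unfolding T_def by (auto intro!: derivative_eq_intros that simp: algebra_simps)
  have T2: "(T (d i1 j1) (d i2 j2) (d i3 j3) (d1 i1 j1) (d1 i2 j2) (d1 i3 j3) has_real_derivative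
      (d2 i1 j1 * d i2 j2 0 * d i3 j3 0 + d i1 j1 0 * d2 i2 j2 * d i3 j3 0 + d i1 j1 0 * d i2 j2 0 * d2 i3 j3
       + 2 * (d1 i1 j1 0 * d1 i2 j2 0 * d i3 j3 0 + d1 i1 j1 0 * d i2 j2 0 * d1 i3 j3 0
       + d i1 j1 0 * d1 i2 j2 0 * d1 i3 j3 0))) (at 0)" for i1 j1 i2 j2 i3 j3
    unfolding T_def by (rule derivative_eq_intros d d1 refl)+ (simp add: algebra_simps)
  let ?T = "\<lambda>j1 j2 j3. T (d 1 j1) (d 2 j2) (d 3 j3) (d1 1 j1) (d1 2 j2) (d1 3 j3)"
  define \<phi>' where "\<phi>' t = ?T 1 2 3 t + ?T 2 3 1 t + ?T 3 1 2 t - ?T 1 3 2 t - ?T 2 1 3 t - ?T 3 2 1 t" for t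
  show thesis
  proof (rule that[of \<phi>'])
    fix t
    show "((\<lambda>t. det (\<chi> j b. d j b t)) has_real_derivative \<phi>' t) (at t)"
      unfolding det_3 \<phi>'_def vec_lambda_beta by (intro DERIV_add DERIV_diff T1 d)
  next
    show "\<phi>' 0 = (\<Sum>j\<in>UNIV. d1 j j 0)"
      unfolding \<phi>'_def T_def d0 sum_3 by simp
    show "(\<phi>' has_real_derivative ((\<Sum>j\<in>UNIV. d2 j j) + (\<Sum>j\<in>UNIV. d1 j j 0)^2
        - (\<Sum>j\<in>UNIV. \<Sum>b\<in>UNIV. d1 j b 0 * d1 b j 0))) (at 0)"
      unfolding \<phi>'_def
      by (rule DERIV_cong[OF DERIV_diff[OF DERIV_diff[OF DERIV_diff[OF DERIV_add[OF DERIV_add[OF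
          T2[of 1 1 2 2 3 3] T2[of 1 2 2 3 3 1]] T2[of 1 3 2 1 3 2]] T2[of 1 1 2 3 3 2]]
          T2[of 1 2 2 1 3 3]] T2[of 1 3 2 2 3 1]]])
        (simp add: d0 sum_3 power2_eq_square algebra_simps)
  qed
qed

text \<open>Differential of the polynomial map with components
  \<open>hom_part (a j) (Suc s)\<close>. The index \<open>s\<close> is the degree of the entries,
  one below that of the map.\<close>

definition hom_jac :: "(3 \<Rightarrow> nat^3 \<Rightarrow> real) \<Rightarrow> nat \<Rightarrow> real^3 \<Rightarrow> real^3^3" where
  "hom_jac a s y = (\<chi> j l. hom_part (dcoef l (a j)) s y)"

lemma hom_jac_mult: "(hom_jac a s y *v u) $ j = hom_part (dir_coef u (a j)) s y"
  by (simp add: hom_jac_def matrix_vector_mult_def hom_part_dir_coef mult.commute)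

lemma hom_jac_scale: "hom_jac a s (t *\<^sub>R y) = t ^ s *\<^sub>R hom_jac a s y"
  by (simp add: hom_jac_def vec_eq_iff hom_part_scale)

lemma det_scaleR_3: "det (c *\<^sub>R (A::real^3^3)) = c ^ 3 * det A"
  by (simp add: det_3 algebra_simps power3_eq_cube)

lemma continuous_on_hom_part [continuous_intros]:
  "continuous_on S f \<Longrightarrow> continuous_on S (\<lambda>x. hom_part a k (f x))"
  unfolding hom_part_def mpow_def by (intro continuous_intros)

text \<open>Vanishing is assumed of the polynomial function, not of its coefficients.
  Differentiating the zero function avoids recovering the latter.\<close>

lemma hom_part_eq_0_imp_derivative:
  assumes "\<And>y. hom_part a (Suc k) y = 0"
  shows "hom_part (dir_coef h a) k y = 0"
proof -
  have "hom_part a (Suc k) = (\<lambda>y. 0)" using assms by auto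
  then have "((\<lambda>y. 0::real) has_derivative (\<lambda>h. hom_part (dir_coef h a) k y)) (at y)"
    using hom_part_has_derivative[of a k y] by simp
  from has_derivative_unique[OF this has_derivative_const] show ?thesis by (rule fun_cong)
qed

lemma hom_part_line:
  "((\<lambda>t. hom_part a (Suc k) (q + t *\<^sub>R e)) has_real_derivative hom_part (dir_coef e a) k (q + t *\<^sub>R e)) (at t)"
proof -
  have "((\<lambda>t. hom_part a (Suc k) (q + t *\<^sub>R e)) has_derivative
      (\<lambda>s. hom_part (dir_coef (s *\<^sub>R e) a) k (q + t *\<^sub>R e))) (at t)"
    by (rule has_derivative_compose[OF _ hom_part_has_derivative]) (auto intro!: derivative_eq_intros)
  moreover have "hom_part (dir_coef (s *\<^sub>R e) a) k y = hom_part (dir_coef e a) k y * s" for s y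
    by (simp add: hom_part_dir_coef sum_distrib_left sum_distrib_right algebra_simps)
  ultimately show ?thesis by (simp add: has_field_derivative_def)
qed

section \<open>Positive definite forms and adapted frames\<close>

lemma inner_matrix_symmetric:
  fixes G :: "real^'n^'n"
  assumes "transpose G = G"
  shows "x \<bullet> (G *v y) = y \<bullet> (G *v x)"
  using dot_lmul_matrix[of x G y] transpose_matrix_vector[of G x] assms by (simp add: inner_commute)

lemma positive_definite_lower_bound:
  assumes "positive_definite G"
  obtains \<mu> where "\<mu> > 0" "\<And>y. \<mu> * norm y ^ 2 \<le> y \<bullet> (G *v y)"
proof -
  have "continuous_on (sphere 0 1) (\<lambda>y::real^3. y \<bullet> (G *v y))"
    by (intro continuous_intros linear_continuous_on matrix_vector_mul_bounded_linear)
  moreover have "sphere 0 1 \<noteq> ({} :: (real^3) set)" by simp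
  ultimately obtain z where z: "z \<in> sphere 0 1" "\<And>y. y \<in> sphere 0 1 \<Longrightarrow> z \<bullet> (G *v z) \<le> y \<bullet> (G *v y)"
    using continuous_attains_inf[OF compact_sphere, of 0 1 "\<lambda>y. y \<bullet> (G *v y)"] by blast
  have "z \<noteq> 0" using z(1) by auto
  then have pos: "z \<bullet> (G *v z) > 0" using assms by (simp add: positive_definite_def)
  show thesis
  proof (rule that[OF pos])
    fix y :: "real^3"
    show "z \<bullet> (G *v z) * norm y ^ 2 \<le> y \<bullet> (G *v y)"
    proof (cases "y = 0")
      case False
      then have "z \<bullet> (G *v z) \<le> (y /\<^sub>R norm y) \<bullet> (G *v (y /\<^sub>R norm y))"
        by (intro z(2)) simp
      also have "\<dots> = (y \<bullet> (G *v y)) / norm y ^ 2"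
        by (simp add: matrix_vector_mult_scaleR power2_eq_square field_simps)
      finally show ?thesis using False by (simp add: field_simps)
    qed simp
  qed
qed

text \<open>Gram-Schmidt in disguise: a new vector is taken orthogonal, in the Euclidean sense, to
  the images under \<open>G\<close> of those already chosen, and fewer than three images cannot
  span. Index 3 is reserved for the prescribed vector, later the radial direction.\<close>

lemma positive_definite_frame:
  assumes G: "positive_definite G" and q: "q \<bullet> (G *v q) = 1"
  shows "\<exists>e :: 3 \<Rightarrow> real^3. e 3 = q \<and> (\<forall>i j. e i \<bullet> (G *v e j) = (if i = j then 1 else 0))"
proof -
  have sym: "x \<bullet> (G *v y) = y \<bullet> (G *v x)" for x y
    using G by (intro inner_matrix_symmetric) (simp add: positive_definite_def)
  have pos: "v \<noteq> 0 \<Longrightarrow> v \<bullet> (G *v v) > 0" for v using G by (simp add: positive_definite_def)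
  have ex: "\<exists>u. u \<bullet> (G *v u) = 1 \<and> (\<forall>v\<in>V. u \<bullet> (G *v v) = 0)" if "finite V" "card V < 3" for V
  proof -
    have "dim ((\<lambda>v. G *v v) ` V) \<le> card ((\<lambda>v. G *v v) ` V)"
      using that by (intro dim_le_card') auto
    also have "\<dots> < DIM(real^3)" using that card_image_le[of V "\<lambda>v. G *v v"] by simp
    finally obtain x where x: "x \<noteq> 0" "\<And>y. y \<in> span ((\<lambda>v. G *v v) ` V) \<Longrightarrow> orthogonal x y"
      using orthogonal_to_subspace_exists by metis
    define u where "u = x /\<^sub>R sqrt (x \<bullet> (G *v x))"
    have "u \<bullet> (G *v u) = 1" using pos[OF x(1)]
      by (simp add: u_def matrix_vector_mult_scaleR field_simps)
    moreover have "u \<bullet> (G *v v) = 0" if "v \<in> V" for v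
      using x(2)[of "G *v v"] that by (simp add: u_def orthogonal_def span_base)
    ultimately show ?thesis by blast
  qed
  obtain e2 where e2: "e2 \<bullet> (G *v e2) = 1" "e2 \<bullet> (G *v q) = 0"
    using ex[of "{q}"] by auto
  have "card {q, e2} < 3" using card_insert_le_m1[of 2 "{e2}" q] by simp
  then obtain e1 where e1: "e1 \<bullet> (G *v e1) = 1" "e1 \<bullet> (G *v q) = 0" "e1 \<bullet> (G *v e2) = 0"
    using ex[of "{q, e2}"] by auto
  define e where "e i = (if i = 1 then e1 else if i = 2 then e2 else q)" for i :: 3
  have "\<forall>i j. e i \<bullet> (G *v e j) = (if i = j then 1 else 0)"
    unfolding forall_3 using e1 e2 q sym[of q e1] sym[of q e2] sym[of e2 e1] by (simp add: e_def)
  moreover have "e 3 = q" by (simp add: e_def)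
  ultimately show ?thesis by blast
qed

text \<open>For the matrix E with columns \<open>e i\<close>, orthonormality reads E^T G E = 1,
  hence E E^T is the inverse of G. The operator with coefficients \<open>A\<close> thus becomes the
  sum of second derivatives along the frame.\<close>

lemma frame_inverse:
  fixes G A :: "real^3^3" and e :: "3 \<Rightarrow> real^3"
  assumes A: "A ** G = mat 1" and e: "\<And>i j. e i \<bullet> (G *v e j) = (if i = j then 1 else 0)"
  shows "A $ \<alpha> $ \<beta> = (\<Sum>i\<in>UNIV. e i $ \<alpha> * e i $ \<beta>)"
    and "det (\<chi> r c. e c $ r) \<noteq> 0"
proof -
  define E where "E = (\<chi> r c. e c $ r)"
  have col: "(G ** E) $ r $ c = (G *v e c) $ r" for r c
    by (simp add: matrix_matrix_mult_def matrix_vector_mult_def E_def)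
  have "(transpose E ** (G ** E)) $ i $ j = e i \<bullet> (G *v e j)" for i j
    by (subst matrix_matrix_mult_def)
      (simp only: vec_lambda_beta col, simp add: transpose_def E_def inner_vec_def)
  then have EGE: "transpose E ** (G ** E) = mat 1"
    by (simp add: vec_eq_iff e mat_def)
  then have "(G ** E) ** transpose E = mat 1" by (simp add: matrix_left_right_inverse)
  then have "A ** (G ** (E ** transpose E)) = A" by (simp add: matrix_mul_assoc)
  then have "E ** transpose E = A" by (simp add: matrix_mul_assoc A)
  then show "A $ \<alpha> $ \<beta> = (\<Sum>i\<in>UNIV. e i $ \<alpha> * e i $ \<beta>)"
    by (auto simp: matrix_matrix_mult_def transpose_def E_def)
  have "det (transpose E) * det (G ** E) = 1"
    using EGE det_mul[of "transpose E" "G ** E"] by simp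
  then show "det (\<chi> r c. e c $ r) \<noteq> 0" unfolding E_def[symmetric] by (auto simp: det_transpose)
qed

text \<open>A directional derivative that also accepts degree 0. It is needed for third derivatives,
  which vanish when the map is quadratic.\<close>

definition dhom :: "real^'n \<Rightarrow> (nat^'n \<Rightarrow> real) \<Rightarrow> nat \<Rightarrow> real^'n \<Rightarrow> real" where
  "dhom u a k y = (case k of 0 \<Rightarrow> 0 | Suc k' \<Rightarrow> hom_part (dir_coef u a) k' y)"

lemma hom_part_line_dhom:
  "((\<lambda>t. hom_part a k (q + t *\<^sub>R e)) has_real_derivative dhom e a k (q + t *\<^sub>R e)) (at t)"
  by (cases k) (auto simp: dhom_def hom_part_line)

lemma Euler_dhom: "dhom y a k y = real k * hom_part a k y"
  by (cases k) (auto simp: dhom_def Euler_hom_part)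

text \<open>The second derivatives of \<open>J = det DP\<close> at a minimum \<open>q\<close> of \<open>J\<close> on the unit sphere, in the
  directions \<open>e\<^sub>1, e\<^sub>2\<close> tangent to it and after the normalisation \<open>DP(q) = 1\<close>, contradict the bound
  \<open>J(q + t e\<^sub>a) \<ge> 1 + s t\<^sup>2\<close> that homogeneity gives. Here \<open>g j b a\<close> and \<open>h a j b\<close> stand for
  \<open>\<partial>\<^sub>a\<partial>\<^sub>b p\<^sub>j\<close> and \<open>\<partial>\<^sub>a\<partial>\<^sub>a\<partial>\<^sub>b p\<^sub>j\<close>.\<close>

lemma trace_contradiction:
  fixes g h :: "3 \<Rightarrow> 3 \<Rightarrow> 3 \<Rightarrow> real" and s :: real
  assumes s: "s \<ge> 1"
    and sym: "\<And>j b a. g j b a = g j a b" and g3: "\<And>j b. g j b 3 = (if j = b then s else 0)"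
    and harm: "\<And>j. (\<Sum>i\<in>UNIV. g j i i) = 0"
    and h0: "\<And>j b. (\<Sum>i\<in>UNIV. h i j b) = 0" and h3: "\<And>j. h 3 j j = s * (s - 1)"
    and tr: "\<And>a. a \<noteq> 3 \<Longrightarrow> (\<Sum>j\<in>UNIV. g j j a) = 0"
    and snd: "\<And>a. a \<noteq> 3 \<Longrightarrow> 2 * s \<le> (\<Sum>j\<in>UNIV. h a j j) - (\<Sum>j\<in>UNIV. \<Sum>b\<in>UNIV. g j b a * g b j a)"
  shows False
proof -
  have g: "g 1 1 3 = s" "g 2 2 3 = s" "g 3 3 3 = s" "g 1 2 3 = 0" "g 1 3 3 = 0" "g 2 1 3 = 0"
    "g 2 3 3 = 0" "g 3 1 3 = 0" "g 3 2 3 = 0" "g 1 3 1 = s" "g 2 3 2 = s" "g 1 3 2 = 0"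
    "g 2 3 1 = 0" "g 3 3 1 = 0" "g 3 3 2 = 0"
    using g3 sym[of _ 3] by auto
  define a where "a = g 1 1 1"
  define b where "b = g 1 1 2"
  \<comment> \<open>The tangential blocks in the directions 1 and 2 are now (a, b; b, -a) and (b,
    -a; -a, -b).\<close>
  have g2: "g 2 2 1 = - a" "g 1 2 2 = - a" "g 2 2 2 = - b" "g 2 1 1 = b" "g 1 2 1 = b" "g 2 1 2 = - a"
    using tr[of 1] tr[of 2] harm[of 1] harm[of 2] sym[of 1 1 2] sym[of 2 1 2]
    by (auto simp: sum_3 g a_def b_def)
  \<comment> \<open>In the sum over both tangential directions these two unknowns occur only through
    their sum, which harmonicity of the third component determines.\<close>
  have "g 3 1 1 + g 3 2 2 = - s" using harm[of 3] by (simp add: sum_3 g)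
  then have sg: "s * g 3 1 1 + s * g 3 2 2 = - (s * s)" by (metis distrib_left mult_minus_right)
  have "(\<Sum>j\<in>UNIV. \<Sum>b\<in>UNIV. g j b 1 * g b j 1) + (\<Sum>j\<in>UNIV. \<Sum>b\<in>UNIV. g j b 2 * g b j 2)
      = 4 * a^2 + 4 * b^2 + 2 * (s * g 3 1 1 + s * g 3 2 2)"
    by (simp add: sum_3 g g2 a_def[symmetric] b_def[symmetric] power2_eq_square algebra_simps)
  moreover have "(\<Sum>j\<in>UNIV. h 1 j j) + (\<Sum>j\<in>UNIV. h 2 j j) = - 3 * (s * (s - 1))"
    using h0[of 1 1] h0[of 2 2] h0[of 3 3] by (simp add: sum_3 h3)
  moreover have "0 \<le> a^2" "0 \<le> b^2" by auto
  moreover have "2 * s \<le> (\<Sum>j\<in>UNIV. h 1 j j) - (\<Sum>j\<in>UNIV. \<Sum>b\<in>UNIV. g j b 1 * g b j 1)"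
    "2 * s \<le> (\<Sum>j\<in>UNIV. h 2 j j) - (\<Sum>j\<in>UNIV. \<Sum>b\<in>UNIV. g j b 2 * g b j 2)"
    by (rule snd, simp)+
  moreover have "4 * s \<le> - 3 * p + 2 * m" if "x + y = 4 * a' + 4 * b' + 2 * w" "u + v = - 3 * p"
    "0 \<le> a'" "0 \<le> b'" "2 * s \<le> u - x" "2 * s \<le> v - y" "w = - m" for x y a' b' w u v p m :: real
    using that by linarith
  ultimately have "4 * s \<le> - 3 * (s * (s - 1)) + 2 * (s * s)"
    using sg by blast
  then have "s * s + s \<le> 0" by (simp add: algebra_simps)
  then show False using s by (smt (verit) mult_nonneg_nonneg)
qed

text \<open>At the minimum \<open>q\<close> of the Jacobian, the frame matrix E and M = (DP(q)
  E)^(-1) normalise the differential to the identity. The constant matrix M only mixes components,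
  so harmonicity and Euler's relation persist and the Jacobian changes by a constant factor. The map
  has degree k + 2; in degree one linear isomorphisms would be counterexamples.\<close>

theorem no_homogeneous_harmonic_immersion:
  fixes a :: "3 \<Rightarrow> nat^3 \<Rightarrow> real" and G A :: "real^3^3"
  assumes G: "positive_definite G" and A: "A ** G = mat 1"
    and harm: "\<And>j y. (\<Sum>\<alpha>\<in>UNIV. \<Sum>\<beta>\<in>UNIV. A$\<alpha>$\<beta> * hom_part (dcoef \<alpha> (dcoef \<beta> (a j))) k y) = 0"
    and imm: "\<And>y. y \<noteq> 0 \<Longrightarrow> det (hom_jac a (Suc k) y) > 0"
  shows False
proof -
  define s where "s = Suc k"
  define J where "J y = det (hom_jac a s y)" for y
  have Jscale: "J (t *\<^sub>R y) = t ^ (3 * s) * J y" for t y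
    by (simp add: J_def hom_jac_scale det_scaleR_3 power_mult[symmetric] mult.commute)
  have Jpos: "y \<noteq> 0 \<Longrightarrow> J y > 0" for y using imm by (simp add: J_def s_def)
  define N where "N y = y \<bullet> (G *v y)" for y
  have Npos: "y \<noteq> 0 \<Longrightarrow> N y > 0" for y using G by (simp add: N_def positive_definite_def)
  have Nscale: "N (t *\<^sub>R y) = t^2 * N y" for t y
    by (simp add: N_def matrix_vector_mult_scaleR power2_eq_square)
  have contN: "continuous_on UNIV N"
    unfolding N_def by (intro continuous_intros linear_continuous_on matrix_vector_mul_bounded_linear)
  obtain \<mu> where \<mu>: "\<mu> > 0" "\<And>y. \<mu> * norm y ^ 2 \<le> N y"
    using positive_definite_lower_bound[OF G] unfolding N_def by blast
  have "compact {y. N y = 1}"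
    unfolding compact_eq_bounded_closed
  proof
    have "norm y \<le> sqrt (1 / \<mu>)" if "N y = 1" for y
      using \<mu>(1) \<mu>(2)[of y] that by (intro real_le_rsqrt) (simp add: field_simps)
    then show "bounded {y. N y = 1}" by (intro boundedI[of _ "sqrt (1/\<mu>)"]) auto
    show "closed {y. N y = 1}" by (intro closed_Collect_eq contN continuous_on_const)
  qed
  moreover have norm1: "N (y /\<^sub>R sqrt (N y)) = 1" if "y \<noteq> 0" for y
  proof -
    have "N (y /\<^sub>R sqrt (N y)) = (inverse (sqrt (N y)))^2 * N y" by (rule Nscale)
    also have "\<dots> = inverse (N y) * N y" using Npos[OF that] by (simp add: power_inverse)
    finally show ?thesis using Npos[OF that] by simp
  qed
  have "{y. N y = 1} \<noteq> {}" using norm1[of "axis 1 1"] by (auto simp: axis_eq_0_iff)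
  moreover have "continuous_on {y. N y = 1} J"
    unfolding J_def det_3 hom_jac_def vec_lambda_beta by (intro continuous_intros)
  ultimately obtain q where q: "N q = 1" and qmin: "\<And>y. N y = 1 \<Longrightarrow> J q \<le> J y"
    using continuous_attains_inf by (metis (mono_tags, lifting) mem_Collect_eq)
  have "q \<noteq> 0" using q by (auto simp: N_def)
  then have Jq: "J q > 0" by (rule Jpos)
  obtain e :: "3 \<Rightarrow> real^3" where e3: "e 3 = q" and e': "\<forall>i j. e i \<bullet> (G *v e j) = (if i = j then 1 else 0)"
    using positive_definite_frame[OF G q[unfolded N_def]] by auto
  note e = e'[rule_format]
  define E where "E = (\<chi> r c. e c $ r)"
  have E: "A $ \<alpha> $ \<beta> = (\<Sum>i\<in>UNIV. e i $ \<alpha> * e i $ \<beta>)" for \<alpha> \<beta>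
    by (rule frame_inverse(1)[OF A e])
  have detE: "det E \<noteq> 0" unfolding E_def by (rule frame_inverse(2)[OF A e])
  define Q where "Q = hom_jac a s q ** E"
  have "det Q \<noteq> 0" using Jq detE by (simp add: Q_def det_mul J_def)
  then obtain M where M: "M ** Q = mat 1"
    using invertible_det_nz[of Q] by (auto simp: invertible_def)
  have entry: "(M ** (hom_jac a s y ** E)) $ j $ b = (\<Sum>l\<in>UNIV. M$j$l * hom_part (dir_coef (e b) (a l)) s y)" for j b y
  proof -
    have "(hom_jac a s y ** E) $ l $ b = hom_part (dir_coef (e b) (a l)) s y" for l
    proof -
      have "(hom_jac a s y ** E) $ l $ b = (hom_jac a s y *v e b) $ l"
        by (simp add: matrix_matrix_mult_def matrix_vector_mult_def E_def)
      then show ?thesis by (simp add: hom_jac_mult)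
    qed
    then show ?thesis by (simp add: matrix_matrix_mult_def[of M])
  qed
  have norm_q: "(\<Sum>l\<in>UNIV. M$j$l * hom_part (dir_coef (e b) (a l)) s q) = (if j = b then 1 else 0)" for j b
    using entry[of q j b] M by (simp add: Q_def mat_def)
  define g where "g j b i = (\<Sum>l\<in>UNIV. M$j$l * hom_part (dir_coef (e i) (dir_coef (e b) (a l))) k q)" for j b i
  define h where "h i j b = (\<Sum>l\<in>UNIV. M$j$l * dhom (e i) (dir_coef (e i) (dir_coef (e b) (a l))) k q)" for i j b
  have lap: "(\<Sum>i\<in>UNIV. hom_part (dir_coef (e i) (dir_coef (e i) (a j))) k y) = 0" for j y
  proof -
    have "hom_part (dir_coef u (dir_coef u (a j))) k y
        = (\<Sum>\<alpha>\<in>UNIV. \<Sum>\<beta>\<in>UNIV. u$\<alpha> * u$\<beta> * hom_part (dcoef \<alpha> (dcoef \<beta> (a j))) k y)" for u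
    proof -
      have "dcoef \<alpha> (dir_coef u (a j)) = dir_coef u (dcoef \<alpha> (a j))" for \<alpha>
        using dir_coef_commute[of "axis \<alpha> 1" u "a j"] by (simp add: dir_coef_axis)
      then show ?thesis
        by (simp add: hom_part_dir_coef[of u "dir_coef u (a j)"] hom_part_dir_coef[of u "dcoef _ (a j)"]
            sum_distrib_left mult.assoc dcoef_commute[of _ _ "a j"])
    qed
    then have "(\<Sum>i\<in>UNIV. hom_part (dir_coef (e i) (dir_coef (e i) (a j))) k y)
        = (\<Sum>i\<in>UNIV. \<Sum>\<alpha>\<in>UNIV. \<Sum>\<beta>\<in>UNIV. e i$\<alpha> * e i$\<beta> * hom_part (dcoef \<alpha> (dcoef \<beta> (a j))) k y)"
      by simp
    also have "\<dots> = (\<Sum>\<alpha>\<in>UNIV. \<Sum>\<beta>\<in>UNIV. A$\<alpha>$\<beta> * hom_part (dcoef \<alpha> (dcoef \<beta> (a j))) k y)"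
      unfolding E sum_3 by (simp add: algebra_simps)
    finally show ?thesis using harm by simp
  qed
  \<comment> \<open>The Laplacian vanishes identically, so it may be differentiated in the direction
    \<open>u\<close>; for \<open>k = 0\<close> all third derivatives are zero.\<close>
  have d3: "(\<Sum>i\<in>UNIV. dhom (e i) (dir_coef (e i) (dir_coef u (a l))) k q) = 0" for u l
  proof (cases k)
    case 0 then show ?thesis by (simp add: dhom_def)
  next
    case (Suc k')
    have "hom_part (dir_coef (e i) (dir_coef (e i) (dir_coef u (a l)))) k' q
        = hom_part (dir_coef u (dir_coef (e i) (dir_coef (e i) (a l)))) k' q" for i
      by (simp add: dir_coef_commute[of _ u])
    moreover have "(\<Sum>i\<in>UNIV. hom_part (dir_coef u (dir_coef (e i) (dir_coef (e i) (a l)))) k' q) = 0"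
    proof -
      have "((\<lambda>t. \<Sum>i\<in>UNIV. hom_part (dir_coef (e i) (dir_coef (e i) (a l))) (Suc k') (q + t *\<^sub>R u))
          has_real_derivative (\<Sum>i\<in>UNIV. hom_part (dir_coef u (dir_coef (e i) (dir_coef (e i) (a l)))) k' (q + 0 *\<^sub>R u))) (at 0)"
        by (intro DERIV_sum hom_part_line)
      then have "((\<lambda>t. 0) has_real_derivative (\<Sum>i\<in>UNIV. hom_part (dir_coef u (dir_coef (e i) (dir_coef (e i) (a l)))) k' q)) (at 0)"
        using lap[of l] Suc by simp
      from DERIV_unique[OF this DERIV_const] show ?thesis .
    qed
    ultimately show ?thesis using Suc by (simp add: dhom_def)
  qed
  show False
  proof (rule trace_contradiction[of "real s" g h])
    show "1 \<le> real s" by (simp add: s_def)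
    show "g j b i = g j i b" for j b i
      unfolding g_def by (simp add: dir_coef_commute[of "e i"])
    show "g j b 3 = (if j = b then real s else 0)" for j b
    proof -
      have "g j b 3 = real s * (\<Sum>l\<in>UNIV. M$j$l * hom_part (dir_coef (e b) (a l)) s q)"
        by (simp add: g_def e3 Euler_hom_part s_def sum_distrib_left algebra_simps)
      then show ?thesis by (simp add: norm_q)
    qed
    show "(\<Sum>i\<in>UNIV. g j i i) = 0" for j
    proof -
      have "(\<Sum>i\<in>UNIV. g j i i) = (\<Sum>l\<in>UNIV. M$j$l * (\<Sum>i\<in>UNIV. hom_part (dir_coef (e i) (dir_coef (e i) (a l))) k q))"
        unfolding g_def sum_3 by (simp add: algebra_simps)
      then show ?thesis by (simp add: lap)
    qed
    show "(\<Sum>i\<in>UNIV. h i j b) = 0" for j b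
    proof -
      have "(\<Sum>i\<in>UNIV. h i j b) = (\<Sum>l\<in>UNIV. M$j$l * (\<Sum>i\<in>UNIV. dhom (e i) (dir_coef (e i) (dir_coef (e b) (a l))) k q))"
        unfolding h_def sum_3 by (simp add: algebra_simps)
      then show ?thesis by (simp add: d3)
    qed
    show "h 3 j j = real s * (real s - 1)" for j
    proof -
      have "h 3 j j = real k * real s * (\<Sum>l\<in>UNIV. M$j$l * hom_part (dir_coef (e j) (a l)) s q)"
        by (simp add: h_def e3 Euler_dhom Euler_hom_part s_def sum_distrib_left algebra_simps)
      then have "h 3 j j = real k * real s * 1" unfolding norm_q by simp
      then show ?thesis by (simp add: s_def algebra_simps)
    qed
    fix i :: 3 assume i: "i \<noteq> 3"
    define d where "d j b t = (\<Sum>l\<in>UNIV. M$j$l * hom_part (dir_coef (e b) (a l)) s (q + t *\<^sub>R e i))" for j b t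
    define d1 where "d1 j b t = (\<Sum>l\<in>UNIV. M$j$l * hom_part (dir_coef (e i) (dir_coef (e b) (a l))) k (q + t *\<^sub>R e i))" for j b t
    have dd: "(d j b has_real_derivative d1 j b t) (at t)" for j b t
      unfolding d_def d1_def s_def by (intro DERIV_sum DERIV_cmult hom_part_line)
    have dd1: "(d1 j b has_real_derivative h i j b) (at 0)" for j b
    proof -
      have "(d1 j b has_real_derivative (\<Sum>l\<in>UNIV. M$j$l * dhom (e i) (dir_coef (e i) (dir_coef (e b) (a l))) k (q + 0 *\<^sub>R e i))) (at 0)"
        unfolding d1_def by (intro DERIV_sum DERIV_cmult hom_part_line_dhom)
      then show ?thesis by (simp add: h_def)
    qed
    have d0: "d j b 0 = (if j = b then 1 else 0)" for j b by (simp add: d_def norm_q)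
    have d10: "d1 j b 0 = g j b i" for j b by (simp add: d1_def g_def)
    define \<phi> where "\<phi> t = det (\<chi> j b. d j b t)" for t
    have \<phi>: "\<phi> t = J (q + t *\<^sub>R e i) / J q" for t
    proof -
      have "(\<chi> j b. d j b t) = M ** (hom_jac a s (q + t *\<^sub>R e i) ** E)"
        by (simp add: vec_eq_iff entry d_def)
      then have "\<phi> t = J (q + t *\<^sub>R e i) * (det M * det E)"
        by (simp add: \<phi>_def det_mul J_def)
      moreover have "J q * (det M * det E) = 1"
        using arg_cong[OF M, of det] by (simp add: Q_def det_mul J_def algebra_simps)
      ultimately show ?thesis using Jq by (simp add: field_simps)
    qed
    \<comment> \<open>By orthogonality \<open>q + t e\<close> has squared metric norm 1 + t^2, so
      minimality and homogeneity bound the Jacobian quotient below by (1 + t^2)^(3s/2). Lowering the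
      exponent to s makes Bernoulli's inequality applicable and still leaves a
      contradiction.\<close>
    have low: "\<phi> 0 + real s * t^2 \<le> \<phi> t" for t
    proof -
      have N1: "N (q + t *\<^sub>R e i) = 1 + t^2"
        using e[of 3 3] e[of i i] e[of 3 i] e[of i 3] i
        by (simp add: N_def e3 matrix_vector_right_distrib matrix_vector_mult_scaleR inner_add_left inner_add_right power2_eq_square)
      define y where "y = q + t *\<^sub>R e i"
      define r where "r = sqrt (N y)"
      have r2: "r^2 = 1 + t^2" using N1 by (simp add: r_def y_def)
      have r1: "r \<ge> 1" using N1 by (simp add: r_def y_def)
      have "y \<noteq> 0" using N1 by (auto simp: y_def[symmetric] N_def add_nonneg_eq_0_iff)
      then have "N (y /\<^sub>R r) = 1" unfolding r_def by (rule norm1)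
      then have "J q \<le> J (y /\<^sub>R r)" by (rule qmin)
      also have "\<dots> = J y / r ^ (3 * s)" unfolding Jscale by (simp add: field_simps power_inverse)
      finally have "r ^ (3 * s) * J q \<le> J y" using r1 by (simp add: field_simps)
      moreover have "1 + real s * t^2 \<le> r ^ (3 * s)"
      proof -
        have "1 + real s * t^2 \<le> (1 + t^2) ^ s" by (rule Bernoulli_inequality) (rule order_trans[of _ 0], auto)
        also have "\<dots> = r ^ (2 * s)" by (simp add: r2[symmetric] power_mult)
        also have "\<dots> \<le> r ^ (3 * s)" using r1 by (intro power_increasing) auto
        finally show ?thesis .
      qed
      ultimately have "(1 + real s * t^2) * J q \<le> J y"
        using Jq by (meson mult_right_mono less_imp_le order_trans)
      then show ?thesis using Jq by (simp add: \<phi> y_def field_simps)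
    qed
    obtain \<phi>' where \<phi>': "\<And>t. (\<phi> has_real_derivative \<phi>' t) (at t)"
      "\<phi>' 0 = (\<Sum>j\<in>UNIV. d1 j j 0)"
      "(\<phi>' has_real_derivative ((\<Sum>j\<in>UNIV. h i j j) + (\<Sum>j\<in>UNIV. d1 j j 0)^2
        - (\<Sum>j\<in>UNIV. \<Sum>b\<in>UNIV. d1 j b 0 * d1 b j 0))) (at 0)"
      using det3_curve[of d d1 "h i", OF dd dd1 d0] unfolding \<phi>_def by blast
    have tr0: "\<phi>' 0 = 0" by (rule second_order_min(1)[OF \<phi>'(1,3) low])
    then show "(\<Sum>j\<in>UNIV. g j j i) = 0" by (simp add: \<phi>'(2) d10)
    have "2 * real s \<le> (\<Sum>j\<in>UNIV. h i j j) + (\<Sum>j\<in>UNIV. d1 j j 0)^2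
        - (\<Sum>j\<in>UNIV. \<Sum>b\<in>UNIV. d1 j b 0 * d1 b j 0)"
      by (rule second_order_min(2)[OF \<phi>'(1,3) low])
    then show "2 * real s \<le> (\<Sum>j\<in>UNIV. h i j j) - (\<Sum>j\<in>UNIV. \<Sum>b\<in>UNIV. g j b i * g b j i)"
      using tr0 \<phi>'(2) by (simp add: d10)
  qed
qed

section \<open>Blow-ups of quasiregular harmonic maps\<close>

text \<open>Built from partial derivatives of the components, to which the results on real-valued
  series apply entry by entry. It is the Jacobian matrix wherever the map is differentiable.\<close>

definition partial_jac :: "(real^3 \<Rightarrow> real^3) \<Rightarrow> real^3 \<Rightarrow> real^3^3" where
  "partial_jac F x = (\<chi> j l. partial_deriv l (\<lambda>z. F z $ j) x)"

lemma partial_jac_eq_jacobian: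
  assumes "F differentiable at x"
  shows "partial_jac F x = jacobian F (at x)"
proof -
  have F: "(F has_derivative frechet_derivative F (at x)) (at x)"
    using assms by (simp add: frechet_derivative_works)
  have "((\<lambda>z. F z $ j) has_derivative (\<lambda>h. frechet_derivative F (at x) h $ j)) (at x)" for j
    by (rule bounded_linear.has_derivative[OF bounded_linear_vec_nth F])
  from frechet_derivative_at[OF this]
  have "frechet_derivative (\<lambda>z. F z $ j) (at x) = (\<lambda>h. frechet_derivative F (at x) h $ j)" for j
    by simp
  then show ?thesis by (simp add: partial_jac_def partial_deriv_def jacobian_def matrix_def)
qed

lemma hom_part_eq_0_imp_dcoef:
  "(\<And>y. hom_part a (Suc k) y = 0) \<Longrightarrow> hom_part (dcoef l a) k y = 0"
  using hom_part_eq_0_imp_derivative[of a k "axis l 1"] by (simp add: dir_coef_axis)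

lemma ray_tendsto:
  fixes x y :: "'b::real_normed_vector"
  shows "((\<lambda>t. x + t *\<^sub>R y) \<longlongrightarrow> x) (at_right (0::real))"
proof -
  have "((\<lambda>t. x + t *\<^sub>R y) \<longlongrightarrow> x + 0 *\<^sub>R y) (at_right (0::real))"
    by (intro tendsto_intros)
  then show ?thesis by simp
qed

lemma eventually_ray:
  fixes x y :: "'b::real_normed_vector"
  shows "\<forall>\<^sub>F z in nhds x. P z \<Longrightarrow> \<forall>\<^sub>F t in at_right (0::real). P (x + t *\<^sub>R y)"
  using ray_tendsto unfolding filterlim_def le_filter_def eventually_filtermap by blast

text \<open>The leading part of a derivative is the derivative of the leading part. Only the degrees
  1 to \<open>s\<close> must vanish; the constant term is killed by differentiation.\<close>

lemma partial_jac_blowup: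
  assumes ps: "\<And>j. pseries (a j) (\<lambda>z. F z $ j) x r"
    and zero: "\<And>j i y. i < s \<Longrightarrow> hom_part (a j) (Suc i) y = 0"
  shows "((\<lambda>t. partial_jac F (x + t *\<^sub>R y) /\<^sub>R t ^ s) \<longlongrightarrow> hom_jac a s y) (at_right 0)"
proof (intro vec_tendstoI)
  fix j l
  have "((\<lambda>t. partial_deriv l (\<lambda>z. F z $ j) (x + t *\<^sub>R y) / t ^ s) \<longlongrightarrow> hom_part (dcoef l (a j)) s y) (at_right 0)"
    by (rule pseries_blowup[OF pseries_partial_deriv(1)[OF ps]]) (rule hom_part_eq_0_imp_dcoef[OF zero])
  then show "((\<lambda>t. (partial_jac F (x + t *\<^sub>R y) /\<^sub>R t ^ s) $ j $ l) \<longlongrightarrow> hom_jac a s y $ j $ l) (at_right 0)"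
    by (simp add: partial_jac_def hom_jac_def divide_inverse mult.commute)
qed

lemma tendsto_matrix_vector_mult:
  fixes X :: "'b \<Rightarrow> real^'n^'m"
  assumes "(X \<longlongrightarrow> A) F" "(v \<longlongrightarrow> w) F"
  shows "((\<lambda>t. X t *v v t) \<longlongrightarrow> A *v w) F"
  unfolding matrix_vector_mult_def
  by (intro tendsto_vec_lambda tendsto_sum tendsto_mult tendsto_vec_nth assms)

lemma tendsto_det_3:
  fixes X :: "'b \<Rightarrow> real^3^3"
  assumes "(X \<longlongrightarrow> A) F"
  shows "((\<lambda>t. det (X t)) \<longlongrightarrow> det A) F"
  unfolding det_3 by (intro tendsto_intros assms)

text \<open>In dimension three both sides are cubic in the matrix, so division by t^s rescales them
  equally and the constant \<open>C\<close> survives the limit.\<close>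

lemma qr_blowup:
  assumes ps: "\<And>j. pseries (a j) (\<lambda>z. F z $ j) x r"
    and zero: "\<And>j i y. i < s \<Longrightarrow> hom_part (a j) (Suc i) y = 0"
    and qr: "\<forall>\<^sub>F z in nhds x. \<forall>v. norm (partial_jac F z *v v) ^ 3 \<le> C * norm v ^ 3 * det (partial_jac F z)"
  shows "norm (hom_jac a s y *v v) ^ 3 \<le> C * norm v ^ 3 * det (hom_jac a s y)"
proof -
  define X where "X t = partial_jac F (x + t *\<^sub>R y) /\<^sub>R t ^ s" for t
  have X: "(X \<longlongrightarrow> hom_jac a s y) (at_right 0)"
    unfolding X_def by (rule partial_jac_blowup[OF ps zero])
  show ?thesis
  proof (rule tendsto_le[of "at_right (0::real)"])
    show "((\<lambda>t. norm (X t *v v) ^ 3) \<longlongrightarrow> norm (hom_jac a s y *v v) ^ 3) (at_right 0)"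
      by (intro tendsto_power tendsto_norm tendsto_matrix_vector_mult X tendsto_const)
    show "((\<lambda>t. C * norm v ^ 3 * det (X t)) \<longlongrightarrow> C * norm v ^ 3 * det (hom_jac a s y)) (at_right 0)"
      by (intro tendsto_mult tendsto_det_3 X tendsto_const)
    have "\<forall>\<^sub>F t in at_right (0::real). t > 0" by (simp add: eventually_at_right_less)
    with eventually_ray[OF qr, of y]
    show "\<forall>\<^sub>F t in at_right (0::real). norm (X t *v v) ^ 3 \<le> C * norm v ^ 3 * det (X t)"
    proof eventually_elim
      case (elim t)
      let ?D = "partial_jac F (x + t *\<^sub>R y)" and ?c = "inverse (t ^ s)"
      have c: "?c > 0" using elim by simp
      have "norm (X t *v v) ^ 3 = ?c ^ 3 * norm (?D *v v) ^ 3"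
        using c unfolding X_def scaleR_matrix_vector_assoc[symmetric] norm_scaleR power_mult_distrib by simp
      also have "\<dots> \<le> ?c ^ 3 * (C * norm v ^ 3 * det ?D)"
        using c elim by (intro mult_left_mono) auto
      also have "\<dots> = C * norm v ^ 3 * det (X t)"
        unfolding X_def det_scaleR_3 by (simp only: mult_ac)
      finally show ?case .
    qed
  qed simp
qed

lemma partial_deriv_hom_part: "partial_deriv l (hom_part a (Suc s)) z = hom_part (dcoef l a) s z"
  unfolding partial_deriv_def frechet_derivative_at[OF hom_part_has_derivative, symmetric]
  by (simp add: dir_coef_axis)

lemma norm_cube_le_0:
  fixes x :: "'b::real_normed_vector"
  assumes "norm x ^ 3 \<le> 0"
  shows "x = 0"
proof (rule ccontr)
  assume "x \<noteq> 0"
  then have "norm x ^ 3 > 0" by simp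
  with assms show False by linarith
qed

text \<open>At a zero \<open>q \<noteq> 0\<close> of \<open>DP\<close>, homogeneity makes the leading part of \<open>P\<close> invariant along \<open>q\<close>.
  Its differential is then singular everywhere, hence zero by quasiregularity.\<close>

lemma qr_hom_jac_pos:
  assumes C: "C > 0"
    and qr: "\<And>y v. norm (hom_jac a s y *v v) ^ 3 \<le> C * norm v ^ 3 * det (hom_jac a s y)"
    and nz: "hom_part (a j0) (Suc s) y0 \<noteq> 0" and q: "q \<noteq> 0"
  shows "det (hom_jac a s q) > 0"
proof (rule ccontr)
  assume "\<not> det (hom_jac a s q) > 0"
  then have "norm (hom_jac a s q *v v) ^ 3 \<le> 0" for v
    using C by (intro order_trans[OF qr[of q v]] mult_nonneg_nonpos) auto
  then have D0: "hom_jac a s q *v v = 0" for v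
    by (rule norm_cube_le_0)
  define P where "P z = (\<chi> j. hom_part (a j) (Suc s) z)" for z
  have Pj: "P z $ j = hom_part (a j) (Suc s) z" for z j by (simp add: P_def)
  have jacP: "partial_jac P z = hom_jac a s z" for z
    by (simp add: partial_jac_def hom_jac_def Pj partial_deriv_hom_part)
  have Euler: "hom_jac a s z *v z = real (Suc s) *\<^sub>R P z" for z
    by (simp add: vec_eq_iff hom_jac_mult Euler_hom_part Pj del: of_nat_Suc)
  have "\<forall>j. \<exists>b. pseries b (\<lambda>z. P z $ j) q 1"
    unfolding Pj using pseries_hom_part[of "a _" "Suc s" q] by blast
  then obtain b where b: "\<And>j. pseries (b j) (\<lambda>z. P z $ j) q 1" by metis
  \<comment> \<open>Otherwise every component of \<open>P\<close> vanishes near \<open>q\<close>,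
    and by the identity theorem everywhere, contrary to the value at \<open>y0\<close>.\<close>
  have "\<exists>k j y. hom_part (b j) k y \<noteq> 0"
  proof (rule ccontr)
    assume "\<not> ?thesis"
    then have z: "hom_part (b j) k y = 0" for j k y by blast
    have "hom_part (a j0) (Suc s) z = 0" if "z \<in> ball q 1" for z
    proof -
      have "norm (z - q) < 1" using that by (simp add: dist_norm norm_minus_commute)
      then have "(\<lambda>k. hom_part (b j0) k (z - q)) sums P (q + (z - q)) $ j0"
        using b[of j0] unfolding pseries_def by blast
      then have "(\<lambda>k. 0) sums P z $ j0" by (simp add: z)
      from sums_unique2[OF this sums_zero] show ?thesis by (simp add: Pj)
    qed
    then have "hom_part (a j0) (Suc s) y0 = 0"
    proof (rule analytic_locally_constant_imp_constant[where S=UNIV and ?x1.0=q and e=1, rotated 4])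
      show "\<exists>b r. pseries b (hom_part (a j0) (Suc s)) z r" for z
        using pseries_hom_part[of "a j0" "Suc s" z] by blast
    qed auto
    with nz show False ..
  qed
  then obtain k where k: "\<exists>j y. hom_part (b j) k y \<noteq> 0" "\<And>i. i < k \<Longrightarrow> \<not> (\<exists>j y. hom_part (b j) i y \<noteq> 0)"
    using exists_least_iff[of "\<lambda>k. \<exists>j y. hom_part (b j) k y \<noteq> 0"] by blast
  \<comment> \<open>Euler's relation turns \<open>DP(q) = 0\<close> into \<open>P(q) = 0\<close>.
    Hence the leading degree \<open>k\<close> at \<open>q\<close> is positive, and the leading part
    of \<open>DP\<close> there has degree \<open>k' = k - 1\<close>.\<close>
  have "P q = 0" using Euler[of q] D0[of q] by simp
  then have "b j 0 = 0" for j using pseries_center[OF b[of j]] by simp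
  then have "k \<noteq> 0" using k(1) by (metis hom_part_0)
  then obtain k' where k': "k = Suc k'" by (metis not0_implies_Suc)
  have zero: "hom_part (b j) (Suc i) y = 0" if "i < k'" for j i y
    using k(2)[of "Suc i"] that k' by auto
  have qrb: "norm (hom_jac b k' y *v v) ^ 3 \<le> C * norm v ^ 3 * det (hom_jac b k' y)" for y v
    by (rule qr_blowup[OF b zero]) (use qr in \<open>auto simp: jacP\<close>)
  \<comment> \<open>Euler's relation \<open>DP(x) x = (s + 1) P(x)\<close> at x = q + t z is divided
    by t^k'. The left side tends to the leading differential applied to \<open>q\<close>, while the
    right side tends to 0 because \<open>P\<close> vanishes to one order more than k'.\<close>
  have inv: "hom_jac b k' z *v q = 0" for z
  proof -
    have "((\<lambda>t. (partial_jac P (q + t *\<^sub>R z) /\<^sub>R t ^ k') *v (q + t *\<^sub>R z)) \<longlongrightarrow> hom_jac b k' z *v q) (at_right 0)"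
      by (intro tendsto_matrix_vector_mult partial_jac_blowup[OF b zero] ray_tendsto)
    moreover have "((\<lambda>t. (partial_jac P (q + t *\<^sub>R z) /\<^sub>R t ^ k') *v (q + t *\<^sub>R z)) \<longlongrightarrow> 0) (at_right 0)"
    proof (rule vec_tendstoI)
      fix j
      have "((\<lambda>t. P (q + t *\<^sub>R z) $ j / t ^ k) \<longlongrightarrow> hom_part (b j) k z) (at_right 0)"
        by (rule pseries_blowup[OF b]) (use k(2) in blast)
      then have "((\<lambda>t. real (Suc s) * (t * (P (q + t *\<^sub>R z) $ j / t ^ k))) \<longlongrightarrow> real (Suc s) * (0 * hom_part (b j) k z)) (at_right 0)"
        by (intro tendsto_mult tendsto_const tendsto_ident_at)
      then have "((\<lambda>t. real (Suc s) * (t * (P (q + t *\<^sub>R z) $ j / t ^ k))) \<longlongrightarrow> (0::real^3) $ j) (at_right 0)"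
        by simp
      moreover have "\<forall>\<^sub>F t in at_right (0::real). t > 0" by (simp add: eventually_at_right_less)
      then have "\<forall>\<^sub>F t in at_right 0. real (Suc s) * (t * (P (q + t *\<^sub>R z) $ j / t ^ k))
          = ((partial_jac P (q + t *\<^sub>R z) /\<^sub>R t ^ k') *v (q + t *\<^sub>R z)) $ j"
      proof eventually_elim
        case (elim t)
        then show ?case
          unfolding jacP scaleR_matrix_vector_assoc[symmetric] Euler k' by (simp add: field_simps)
      qed
      ultimately show "((\<lambda>t. ((partial_jac P (q + t *\<^sub>R z) /\<^sub>R t ^ k') *v (q + t *\<^sub>R z)) $ j) \<longlongrightarrow> (0::real^3) $ j) (at_right 0)"
        by (rule Lim_transform_eventually)
    qed
    ultimately show ?thesis by (intro tendsto_unique[of "at_right (0::real)"]) auto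
  qed
  have "det (hom_jac b k' z) = 0" for z
    using inv[of z] q invertible_det_nz[of "hom_jac b k' z"]
    by (metis invertible_def matrix_vector_mul_assoc matrix_vector_mul_lid matrix_vector_mult_0_right)
  then have "norm (hom_jac b k' z *v v) ^ 3 \<le> 0" for z v using qrb[of z v] by simp
  then have "hom_jac b k' z *v v = 0" for z v
    by (rule norm_cube_le_0)
  then have "real (Suc k') * hom_part (b j) k z = 0" for j z
    using hom_jac_mult[of b k' z z j] by (simp add: Euler_hom_part k' del: of_nat_Suc)
  then show False using k(1) by simp
qed

section \<open>Determinant, inverse and Christoffel symbols of a metric\<close>

lemma positive_definite_det_pos:
  assumes "positive_definite G"
  shows "det G > 0"
proof -
  have pos: "v \<noteq> 0 \<Longrightarrow> v \<bullet> (G *v v) > 0" for v using assms by (simp add: positive_definite_def)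
  define n where "n = (axis 1 1 :: real^3) \<bullet> (G *v axis 1 1)"
  have n: "n > 0" unfolding n_def by (intro pos) (simp add: axis_eq_0_iff)
  define q where "q = (axis 1 1 :: real^3) /\<^sub>R sqrt n"
  have "q \<bullet> (G *v q) = 1"
    using n by (simp add: q_def matrix_vector_mult_scaleR n_def[symmetric] field_simps)
  then obtain e :: "3 \<Rightarrow> real^3" where e: "\<forall>i j. e i \<bullet> (G *v e j) = (if i = j then 1 else 0)"
    using positive_definite_frame[OF assms] by blast
  define E where "E = (\<chi> r c. e c $ r)"
  have col: "(G ** E) $ r $ c = (G *v e c) $ r" for r c
    by (simp add: matrix_matrix_mult_def matrix_vector_mult_def E_def)
  have "(transpose E ** (G ** E)) $ i $ j = e i \<bullet> (G *v e j)" for i j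
    by (subst matrix_matrix_mult_def)
      (simp only: vec_lambda_beta col, simp add: transpose_def E_def inner_vec_def)
  then have "transpose E ** (G ** E) = mat 1"
    by (simp add: vec_eq_iff e mat_def)
  then have "det (transpose E ** (G ** E)) = 1" by simp
  then have "det E ^ 2 * det G = 1" by (simp add: det_mul det_transpose power2_eq_square mult_ac)
  moreover have "det E ^ 2 * det G \<le> 0" if "det G \<le> 0"
    using that by (intro mult_nonneg_nonpos) auto
  ultimately show ?thesis by force
qed

lemma isCont_det_3:
  fixes m :: "3 \<Rightarrow> 3 \<Rightarrow> 'b::t2_space \<Rightarrow> real"
  assumes "\<And>r c. isCont (m r c) x"
  shows "isCont (\<lambda>x. det (\<chi> r c. m r c x)) x"
  unfolding det_3 vec_lambda_beta by (intro continuous_intros assms)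

lemma matrix_inv_mult:
  assumes "invertible A"
  shows "A ** matrix_inv A = mat 1" "matrix_inv A ** A = mat 1"
proof -
  have "A ** matrix_inv A = mat 1 \<and> matrix_inv A ** A = mat 1"
    using assms unfolding invertible_def matrix_inv_def by (rule someI_ex)
  then show "A ** matrix_inv A = mat 1" "matrix_inv A ** A = mat 1" by auto
qed

text \<open>Cramer's rule applied to the j-th column of the inverse. As a quotient of determinants
  the entry is visibly continuous where the denominator is nonzero.\<close>

lemma matrix_inv_cramer:
  fixes A :: "real^'n^'n"
  assumes "det A \<noteq> 0"
  shows "matrix_inv A $ i $ j = det (\<chi> r c. if c = i then axis j 1 $ r else A $ r $ c) / det A"
proof -
  have "A ** matrix_inv A = mat 1"
    using assms by (intro matrix_inv_mult(1)) (simp add: invertible_det_nz)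
  then have "A *v (matrix_inv A *v axis j 1) = axis j 1"
    by (simp add: matrix_vector_mul_assoc)
  then have "matrix_inv A *v axis j 1 = (\<chi> k. det (\<chi> r c. if c = k then axis j 1 $ r else A $ r $ c) / det A)"
    using cramer[OF assms] by blast
  then show ?thesis by (simp add: matrix_vector_mult_basis column_def vec_eq_iff)
qed

lemma isCont_matrix_inv:
  fixes G :: "real^3 \<Rightarrow> real^3^3"
  assumes G: "\<And>r c. isCont (\<lambda>x. G x $ r $ c) x0" and "det (G x0) \<noteq> 0"
  shows "isCont (\<lambda>x. matrix_inv (G x) $ i $ j) x0"
proof -
  have d: "isCont (\<lambda>x. det (G x)) x0" using isCont_det_3[where m="\<lambda>r c x. G x $ r $ c", OF G] by simp
  let ?f = "\<lambda>x. det (\<chi> r c. if c = i then axis j 1 $ r else G x $ r $ c) / det (G x)"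
  have "isCont (\<lambda>x. det (\<chi> r c. if c = i then axis j 1 $ r else G x $ r $ c)) x0"
  proof (rule isCont_det_3)
    show "isCont (\<lambda>x. if c = i then axis j 1 $ r else G x $ r $ c) x0" for r c
      by (cases "c = i") (auto intro: G)
  qed
  then have "isCont ?f x0" using d assms(2) by (intro continuous_divide) auto
  moreover have "\<forall>\<^sub>F x in nhds x0. det (G x) \<noteq> 0"
  proof -
    have "((\<lambda>x. det (G x)) \<longlongrightarrow> det (G x0)) (nhds x0)"
      using d unfolding isCont_def by (subst (asm) tendsto_at_iff_tendsto_nhds)
    then show ?thesis by (rule tendsto_imp_eventually_ne) (rule assms(2))
  qed
  then have "\<forall>\<^sub>F x in nhds x0. ?f x = matrix_inv (G x) $ i $ j"
    by eventually_elim (simp add: matrix_inv_cramer)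
  from isCont_cong[OF this] have "isCont ?f x0 = isCont (\<lambda>x. matrix_inv (G x) $ i $ j) x0" .
  ultimately show ?thesis by simp
qed

lemma real_analytic_at_isCont_partial_deriv:
  fixes \<phi> :: "real^'n \<Rightarrow> real"
  assumes "real_analytic_at \<phi> x"
  shows "isCont \<phi> x" "isCont (partial_deriv i \<phi>) x"
proof -
  obtain a r where ps: "pseries a \<phi> x r" using real_analytic_at_imp_pseries[OF assms] by blast
  show "isCont \<phi> x" "isCont (partial_deriv i \<phi>) x"
    by (rule pseries_isCont[OF ps], rule pseries_isCont[OF pseries_partial_deriv(1)[OF ps]])
qed

text \<open>Continuity at the base point is what the blow-up of the harmonic map equation uses: the
  coefficients converge to their values there.\<close>

lemma isCont_christoffel:
  assumes "real_analytic_at G x" "positive_definite (G x)"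
  shows "isCont (christoffel G \<gamma> \<alpha> \<beta>) x" and "isCont (\<lambda>x. matrix_inv (G x) $ \<alpha> $ \<beta>) x"
proof -
  have G: "real_analytic_at (\<lambda>y. G y $ r $ c) x" for r c
    by (intro real_analytic_at_component assms(1))
  have inv: "isCont (\<lambda>x. matrix_inv (G x) $ \<alpha> $ \<beta>) x" for \<alpha> \<beta>
    using positive_definite_det_pos[OF assms(2)]
    by (intro isCont_matrix_inv real_analytic_at_isCont_partial_deriv(1) G) simp
  then show "isCont (\<lambda>x. matrix_inv (G x) $ \<alpha> $ \<beta>) x" .
  show "isCont (christoffel G \<gamma> \<alpha> \<beta>) x"
    unfolding christoffel_def[abs_def]
    by (intro continuous_intros inv real_analytic_at_isCont_partial_deriv(2) G) simp
qed

text \<open>If the leading part has degree k + 2, second derivatives are of order t^k along a ray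
  and first derivatives of order t^(k+1). Dividing the harmonic map equation by t^k therefore
  removes both Christoffel terms in the limit and leaves the constant-coefficient equation for the
  leading part.\<close>

theorem qr_harmonic_jacobian_pos:
  fixes F :: "real^3 \<Rightarrow> real^3"
  assumes F: "real_analytic_at F x0"
    and G: "real_analytic_at G x0" "positive_definite (G x0)"
    and H: "real_analytic_at H (F x0)" "positive_definite (H (F x0))"
    and harm: "\<forall>\<^sub>F x in nhds x0. harmonic_in_coords G H F x"
    and C: "C > 0"
    and qr: "\<forall>\<^sub>F x in nhds x0. \<forall>v. norm (partial_jac F x *v v) ^ 3 \<le> C * norm v ^ 3 * det (partial_jac F x)"
    and nonconst: "\<not> (\<forall>\<^sub>F x in nhds x0. F x = F x0)"
  shows "det (partial_jac F x0) > 0"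
proof (rule ccontr)
  assume neg: "\<not> det (partial_jac F x0) > 0"
  obtain a r where ps: "\<And>j. pseries (a j) (\<lambda>z. F z $ j) x0 r"
    using pseries_common_radius[OF F] by blast
  have r: "r > 0" using ps by (simp add: pseries_def)
  have "\<exists>k j y. hom_part (a j) (Suc k) y \<noteq> 0"
  proof (rule ccontr)
    assume "\<not> ?thesis"
    then have z: "hom_part (a j) (Suc k) y = 0" for j k y by blast
    have "F x = F x0" if "dist x x0 < r" for x
    proof -
      have "F x $ j = F x0 $ j" for j
      proof -
        have "(\<lambda>k. hom_part (a j) k (x - x0)) sums F (x0 + (x - x0)) $ j"
          using ps[of j, unfolded pseries_def, THEN conjunct2, THEN conjunct2, rule_format, of "x - x0"] that
          by (simp only: dist_norm)
        moreover have "(\<lambda>k. hom_part (a j) k (x - x0)) = (\<lambda>k. if k = 0 then a j 0 else 0)"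
        proof
          show "hom_part (a j) k (x - x0) = (if k = 0 then a j 0 else 0)" for k
            by (cases k) (auto simp: z)
        qed
        ultimately have "(\<lambda>k. if k = 0 then a j 0 else 0) sums F x $ j" by simp
        from sums_unique2[OF this sums_single[of 0 "\<lambda>_. a j 0"]] show ?thesis
          using pseries_center[OF ps[of j]] by simp
      qed
      then show ?thesis by (simp add: vec_eq_iff)
    qed
    then show False using nonconst r unfolding eventually_nhds_metric by blast
  qed
  then obtain s where s: "\<exists>j y. hom_part (a j) (Suc s) y \<noteq> 0"
      "\<And>i. i < s \<Longrightarrow> \<not> (\<exists>j y. hom_part (a j) (Suc i) y \<noteq> 0)"
    using exists_least_iff[of "\<lambda>k. \<exists>j y. hom_part (a j) (Suc k) y \<noteq> 0"] by blast
  then have zero: "hom_part (a j) (Suc i) y = 0" if "i < s" for j i y using that by blast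
  obtain j0 y0 where nz: "hom_part (a j0) (Suc s) y0 \<noteq> 0" using s(1) by blast
  have qra: "norm (hom_jac a s y *v v) ^ 3 \<le> C * norm v ^ 3 * det (hom_jac a s y)" for y v
    by (rule qr_blowup[OF ps zero qr])
  have imm: "det (hom_jac a s y) > 0" if "y \<noteq> 0" for y
    by (rule qr_hom_jac_pos[OF C qra nz that])
  have "partial_jac F x0 = hom_jac a 0 0"
    using pseries_center[OF pseries_partial_deriv(1)[OF ps]] by (simp add: partial_jac_def hom_jac_def)
  moreover have "hom_jac a 0 (axis 1 1) = hom_jac a 0 0" by (simp add: hom_jac_def)
  ultimately have j0: "partial_jac F x0 = hom_jac a 0 (axis 1 1)" by simp
  have "det (hom_jac a s (axis 1 1)) > 0" by (rule imm) (simp add: axis_eq_0_iff)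
  \<comment> \<open>For \<open>s = 0\<close> the blow-up would be the differential at
    \<open>x0\<close> itself, whose determinant is assumed not to be positive.\<close>
  then have "s \<noteq> 0" using neg j0 by (cases "s = 0") auto
  then obtain k where k: "s = Suc k" by (metis not0_implies_Suc)
  have "(\<Sum>\<alpha>\<in>UNIV. \<Sum>\<beta>\<in>UNIV. matrix_inv (G x0)$\<alpha>$\<beta> * hom_part (dcoef \<alpha> (dcoef \<beta> (a i))) k y) = 0" for i y
  proof -
    let ?x = "\<lambda>t. x0 + t *\<^sub>R y"
    let ?D = "\<lambda>l j. partial_deriv l (\<lambda>z. F z $ j)"
    have D1: "((\<lambda>t. ?D l j (?x t) / t ^ k) \<longlongrightarrow> 0) (at_right 0)" for l j
    proof -
      have "((\<lambda>t. ?D l j (?x t) / t ^ k) \<longlongrightarrow> hom_part (dcoef l (a j)) k y) (at_right 0)"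
        by (rule pseries_blowup[OF pseries_partial_deriv(1)[OF ps]])
          (rule hom_part_eq_0_imp_dcoef[OF zero], simp add: k)
      moreover have "hom_part (dcoef l (a j)) k y = 0"
        by (rule hom_part_eq_0_imp_dcoef[OF zero]) (simp add: k)
      ultimately show ?thesis by simp
    qed
    have D0: "((\<lambda>t. ?D l j (?x t)) \<longlongrightarrow> ?D l j x0) (at_right 0)" for l j
      by (rule isCont_tendsto_compose[OF pseries_isCont[OF pseries_partial_deriv(1)[OF ps]] ray_tendsto])
    have D2: "((\<lambda>t. partial_deriv \<alpha> (?D \<beta> j) (?x t) / t ^ k) \<longlongrightarrow> hom_part (dcoef \<alpha> (dcoef \<beta> (a j))) k y) (at_right 0)" for \<alpha> \<beta> j
    proof (rule pseries_blowup[OF pseries_partial_deriv(1)[OF pseries_partial_deriv(1)[OF ps]]])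
      fix i assume i: "i < k"
      show "hom_part (dcoef \<alpha> (dcoef \<beta> (a j))) i y = 0"
        by (intro hom_part_eq_0_imp_dcoef zero) (use i k in simp)
    qed
    have A: "((\<lambda>t. matrix_inv (G (?x t)) $ \<alpha> $ \<beta>) \<longlongrightarrow> matrix_inv (G x0) $ \<alpha> $ \<beta>) (at_right 0)" for \<alpha> \<beta>
      by (rule isCont_tendsto_compose[OF isCont_christoffel(2)[OF G] ray_tendsto])
    have \<Gamma>: "((\<lambda>t. christoffel G \<gamma> \<alpha> \<beta> (?x t)) \<longlongrightarrow> christoffel G \<gamma> \<alpha> \<beta> x0) (at_right 0)" for \<alpha> \<beta> \<gamma>
      by (rule isCont_tendsto_compose[OF isCont_christoffel(1)[OF G] ray_tendsto])
    have Fc: "((\<lambda>t. F (?x t)) \<longlongrightarrow> F x0) (at_right 0)"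
      by (rule vec_tendstoI, rule isCont_tendsto_compose[OF pseries_isCont[OF ps] ray_tendsto])
    have \<Gamma>H: "((\<lambda>t. christoffel H \<gamma> \<alpha> \<beta> (F (?x t))) \<longlongrightarrow> christoffel H \<gamma> \<alpha> \<beta> (F x0)) (at_right 0)" for \<alpha> \<beta> \<gamma>
      by (rule isCont_tendsto_compose[OF isCont_christoffel(1)[OF H] Fc])
    \<comment> \<open>In the quadratic term only one of the two first derivatives carries the
      division by t^k and tends to 0; the other converges by continuity.\<close>
    let ?h = "\<lambda>t. \<Sum>\<alpha>\<in>UNIV. \<Sum>\<beta>\<in>UNIV. matrix_inv (G (?x t)) $ \<alpha> $ \<beta> *
        (partial_deriv \<alpha> (?D \<beta> i) (?x t) / t ^ k
         - (\<Sum>\<gamma>\<in>UNIV. christoffel G \<gamma> \<alpha> \<beta> (?x t) * (?D \<gamma> i (?x t) / t ^ k))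
         + (\<Sum>j\<in>UNIV. \<Sum>l\<in>UNIV. christoffel H i j l (F (?x t)) * (?D \<alpha> j (?x t) / t ^ k) * ?D \<beta> l (?x t)))"
    have "(?h \<longlongrightarrow> (\<Sum>\<alpha>\<in>UNIV. \<Sum>\<beta>\<in>UNIV. matrix_inv (G x0) $ \<alpha> $ \<beta> *
        (hom_part (dcoef \<alpha> (dcoef \<beta> (a i))) k y
         - (\<Sum>\<gamma>\<in>UNIV. christoffel G \<gamma> \<alpha> \<beta> x0 * 0)
         + (\<Sum>j\<in>UNIV. \<Sum>l\<in>UNIV. christoffel H i j l (F x0) * 0 * ?D \<beta> l x0)))) (at_right 0)"
      by (intro tendsto_sum tendsto_mult tendsto_add tendsto_diff A D2 \<Gamma> D1 \<Gamma>H D0)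
    then have lim: "(?h \<longlongrightarrow> (\<Sum>\<alpha>\<in>UNIV. \<Sum>\<beta>\<in>UNIV. matrix_inv (G x0)$\<alpha>$\<beta> * hom_part (dcoef \<alpha> (dcoef \<beta> (a i))) k y)) (at_right 0)"
      by simp
    have "\<forall>\<^sub>F t in at_right 0. ?h t = 0"
      using eventually_ray[OF harm, of y]
    proof eventually_elim
      case (elim t)
      let ?e = "\<lambda>\<alpha> \<beta>. partial_deriv \<alpha> (?D \<beta> i) (?x t)
         - (\<Sum>\<gamma>\<in>UNIV. christoffel G \<gamma> \<alpha> \<beta> (?x t) * ?D \<gamma> i (?x t))
         + (\<Sum>j\<in>UNIV. \<Sum>l\<in>UNIV. christoffel H i j l (F (?x t)) * ?D \<alpha> j (?x t) * ?D \<beta> l (?x t))"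
      have e: "partial_deriv \<alpha> (?D \<beta> i) (?x t) / t ^ k
         - (\<Sum>\<gamma>\<in>UNIV. christoffel G \<gamma> \<alpha> \<beta> (?x t) * (?D \<gamma> i (?x t) / t ^ k))
         + (\<Sum>j\<in>UNIV. \<Sum>l\<in>UNIV. christoffel H i j l (F (?x t)) * (?D \<alpha> j (?x t) / t ^ k) * ?D \<beta> l (?x t))
         = ?e \<alpha> \<beta> / t ^ k" for \<alpha> \<beta>
        by (simp add: sum_divide_distrib diff_divide_distrib add_divide_distrib)
      have "?h t = (\<Sum>\<alpha>\<in>UNIV. \<Sum>\<beta>\<in>UNIV. matrix_inv (G (?x t)) $ \<alpha> $ \<beta> * ?e \<alpha> \<beta>) / t ^ k"
        unfolding e by (simp add: sum_divide_distrib)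
      then show ?case using elim by (simp add: harmonic_in_coords_def)
    qed
    then have "(?h \<longlongrightarrow> 0) (at_right 0)" by (rule tendsto_eventually)
    with lim show ?thesis by (intro tendsto_unique[of "at_right (0::real)"]) auto
  qed
  moreover have "matrix_inv (G x0) ** G x0 = mat 1"
    using positive_definite_det_pos[OF G(2)] by (intro matrix_inv_mult(2)) (simp add: invertible_det_nz)
  ultimately show False
    using no_homogeneous_harmonic_immersion[OF G(2), of "matrix_inv (G x0)" a k] imm k by blast
qed

section \<open>Charts and the change of coordinates\<close>

lemma is_chart_facts:
  assumes "is_chart X c"
  shows chart_dom_subset: "chart_dom c \<subseteq> topspace X"
    and inj_on_coord: "inj_on (coord c) (chart_dom c)"
    and openin_chart_preimage: "open V \<Longrightarrow> openin X {p \<in> chart_dom c. coord c p \<in> V}"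
    and open_coord_image: "openin X W \<Longrightarrow> open (coord c ` {p \<in> chart_dom c. p \<in> W})"
proof -
  have o: "openin X (chart_dom c)" and oi: "open (chart_image c)"
    and hom: "homeomorphic_map (subtopology X (chart_dom c)) (top_of_set (chart_image c)) (coord c)"
    using assms by (auto simp: is_chart_def)
  show sub: "chart_dom c \<subseteq> topspace X" using o by (rule openin_subset)
  have top: "topspace (subtopology X (chart_dom c)) = chart_dom c" using sub by auto
  show "inj_on (coord c) (chart_dom c)"
    using hom unfolding homeomorphic_eq_everything_map top by blast
  show "openin X {p \<in> chart_dom c. coord c p \<in> V}" if "open V" for V
  proof -
    have cm: "continuous_map (subtopology X (chart_dom c)) (top_of_set (chart_image c)) (coord c)"
      using hom unfolding homeomorphic_eq_everything_map by blast
    have "openin (subtopology X (chart_dom c)) {p \<in> chart_dom c. coord c p \<in> chart_image c \<inter> V}"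
      using openin_continuous_map_preimage[OF cm openin_open_Int[OF that]] unfolding top .
    moreover have "{p \<in> chart_dom c. coord c p \<in> chart_image c \<inter> V} = {p \<in> chart_dom c. coord c p \<in> V}"
      by (auto simp: chart_image_def)
    ultimately show ?thesis using openin_open_subtopology[OF o] by simp
  qed
  show "open (coord c ` {p \<in> chart_dom c. p \<in> W})" if "openin X W" for W
  proof -
    have "open_map (subtopology X (chart_dom c)) (top_of_set (chart_image c)) (coord c)"
      using hom unfolding homeomorphic_eq_everything_map by blast
    moreover have "openin (subtopology X (chart_dom c)) (chart_dom c \<inter> W)"
      using openin_open_subtopology[OF o] openin_Int[OF o that] by simp
    ultimately have "openin (top_of_set (chart_image c)) (coord c ` (chart_dom c \<inter> W))"
      unfolding open_map_def by blast
    moreover have "chart_dom c \<inter> W = {p \<in> chart_dom c. p \<in> W}" by auto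
    ultimately show ?thesis using openin_open_eq[OF oi] by simp
  qed
qed

lemma coord_inv_coord: "is_chart X c \<Longrightarrow> p \<in> chart_dom c \<Longrightarrow> coord_inv c (coord c p) = p"
  unfolding coord_inv_def by (rule inv_into_f_f[OF inj_on_coord])

lemma coord_rep_coord:
  "is_chart X c \<Longrightarrow> p \<in> chart_dom c \<Longrightarrow> coord_rep c d f (coord c p) = coord d (f p)"
  by (simp add: coord_rep_def coord_inv_coord)

lemma open_rep_dom:
  assumes "is_chart X c" "is_chart Y d" "openin X U" "continuous_map (subtopology X U) Y f"
  shows "open (rep_dom c d U f)"
proof -
  have "openin Y (chart_dom d)" using assms(2) by (simp add: is_chart_def)
  from openin_continuous_map_preimage[OF assms(4) this]
  have "openin (subtopology X U) {p \<in> topspace (subtopology X U). f p \<in> chart_dom d}" .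
  then have "openin X {p \<in> topspace (subtopology X U). f p \<in> chart_dom d}"
    using openin_open_subtopology[OF assms(3)] by blast
  from open_coord_image[OF assms(1) this]
  have "open (coord c ` {p \<in> chart_dom c. p \<in> topspace X \<and> p \<in> U \<and> f p \<in> chart_dom d})" by simp
  moreover have "{p \<in> chart_dom c. p \<in> topspace X \<and> p \<in> U \<and> f p \<in> chart_dom d}
      = {p \<in> U. p \<in> chart_dom c \<and> f p \<in> chart_dom d}"
    using openin_subset[OF assms(3)] by auto
  ultimately show ?thesis by (simp add: rep_dom_def)
qed

section \<open>The differential under changes of charts\<close>

lemma real_analytic_at_differentiable:
  fixes F :: "real^'n \<Rightarrow> real^'m"
  assumes "real_analytic_at F x"
  shows "F differentiable at x"
proof -
  have "\<exists>D. ((\<lambda>y. F y $ j) has_derivative D) (at x)" for j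
  proof -
    obtain a r where ps: "pseries a (\<lambda>y. F y $ j) x r"
      using real_analytic_at_imp_pseries[OF real_analytic_at_component[OF assms]] by blast
    then have "dist x x < r / 2" by (simp add: pseries_def)
    from pseries_partial_deriv(2)[OF ps this] show ?thesis by blast
  qed
  then obtain D where D: "\<And>j. ((\<lambda>y. F y $ j) has_derivative D j) (at x)" by metis
  have "(F has_derivative (\<lambda>h. \<chi> j. D j h)) (at x)"
    unfolding has_derivative_componentwise_within[of F]
    using D by (auto simp: Basis_vec_def inner_axis)
  then show ?thesis unfolding differentiable_def by blast
qed

lemma jacobian_has_derivative:
  fixes F :: "real^'n \<Rightarrow> real^'m"
  assumes "F differentiable at x"
  shows "(F has_derivative (\<lambda>h. jacobian F (at x) *v h)) (at x)"
  using assms by (simp add: jacobian_works)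

lemma jacobianI:
  fixes F :: "real^'n \<Rightarrow> real^'m"
  assumes "(F has_derivative (\<lambda>h. A *v h)) (at x)"
  shows "jacobian F (at x) = A"
  unfolding jacobian_def frechet_derivative_at[OF assms, symmetric] by simp

text \<open>The composite is required to agree only on an open set, since coordinate expressions
  have arbitrary values off their natural domains.\<close>

lemma jacobian_compose:
  fixes F :: "real^'n \<Rightarrow> real^'m" and G :: "real^'m \<Rightarrow> real^'k"
  assumes "F differentiable at x" "G differentiable at (F x)"
    and "open S" "x \<in> S" "\<And>y. y \<in> S \<Longrightarrow> K y = G (F y)"
  shows "jacobian K (at x) = jacobian G (at (F x)) ** jacobian F (at x)"
proof (rule jacobianI, rule has_derivative_transform_within_open)
  show "((\<lambda>y. G (F y)) has_derivative (\<lambda>h. (jacobian G (at (F x)) ** jacobian F (at x)) *v h)) (at x)"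
    using has_derivative_compose[OF jacobian_has_derivative[OF assms(1)] jacobian_has_derivative[OF assms(2)]]
    by (simp add: matrix_vector_mul_assoc)
qed (use assms in auto)

text \<open>\<open>T\<close> leads from the old to the new source chart, \<open>S\<close> from the
  new back to the old target chart. Orientation enters through the positive determinants: the square
  roots of their squares come out without absolute values.\<close>

lemma jacobian_metric_change:
  fixes T S D D' G G' H H' :: "real^3^3"
  assumes G: "G = transpose T ** G' ** T" and H: "H' = transpose S ** H ** S" and D: "D = S ** D' ** T"
    and T: "det T > 0" and S: "det S > 0" and pos: "det G' > 0" "det H > 0"
  shows "sqrt (det H') / sqrt (det G') * det D' = sqrt (det H) / sqrt (det G) * det D"
    and "(D' *v (T *v v)) \<bullet> (H' *v (D' *v (T *v v))) = (D *v v) \<bullet> (H *v (D *v v))"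
    and "(T *v v) \<bullet> (G' *v (T *v v)) = v \<bullet> (G *v v)"
proof -
  have "det G = (det T)^2 * det G'" "det H' = (det S)^2 * det H"
    by (simp_all add: G H det_mul det_transpose power2_eq_square mult_ac)
  then have e: "sqrt (det G) = det T * sqrt (det G')" "sqrt (det H') = det S * sqrt (det H)"
    using T S by (simp_all add: real_sqrt_mult)
  have "det D = det S * det D' * det T" by (simp add: D det_mul)
  then show "sqrt (det H') / sqrt (det G') * det D' = sqrt (det H) / sqrt (det G) * det D"
    unfolding e using T by simp
  have tr: "x \<bullet> ((transpose A ** B ** A) *v y) = (A *v x) \<bullet> (B *v (A *v y))" for A B :: "real^3^3" and x y
  proof -
    have "x \<bullet> ((transpose A ** B ** A) *v y) = x \<bullet> (transpose A *v (B *v (A *v y)))"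
      by (simp only: matrix_vector_mul_assoc matrix_mul_assoc)
    also have "\<dots> = (x v* transpose A) \<bullet> (B *v (A *v y))" by (rule dot_lmul_matrix[symmetric])
    also have "x v* transpose A = A *v x" by (rule vector_transpose_matrix)
    finally show ?thesis .
  qed
  show "(T *v v) \<bullet> (G' *v (T *v v)) = v \<bullet> (G *v v)" unfolding G tr ..
  show "(D' *v (T *v v)) \<bullet> (H' *v (D' *v (T *v v))) = (D *v v) \<bullet> (H *v (D *v v))"
    by (simp only: H tr) (simp only: D matrix_vector_mul_assoc matrix_mul_assoc)
qed

lemma matrix_vector_norm_le:
  fixes A :: "real^'n^'m"
  shows "norm (A *v v) \<le> (\<Sum>i\<in>UNIV. \<Sum>j\<in>UNIV. \<bar>A $ i $ j\<bar>) * norm v"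
  by (rule order_trans[OF onorm[OF matrix_vector_mul_bounded_linear]])
    (intro mult_right_mono onorm_le_matrix_component_sum norm_ge_zero)

lemma quadratic_form_le:
  fixes A :: "real^'n^'n"
  shows "\<bar>v \<bullet> (A *v v)\<bar> \<le> (\<Sum>i\<in>UNIV. \<Sum>j\<in>UNIV. \<bar>A $ i $ j\<bar>) * norm v ^ 2"
proof -
  have "\<bar>v \<bullet> (A *v v)\<bar> \<le> norm v * norm (A *v v)" by (rule Cauchy_Schwarz_ineq2)
  also have "\<dots> \<le> norm v * ((\<Sum>i\<in>UNIV. \<Sum>j\<in>UNIV. \<bar>A $ i $ j\<bar>) * norm v)"
    by (intro mult_left_mono matrix_vector_norm_le norm_ge_zero)
  finally show ?thesis by (simp add: power2_eq_square mult_ac)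
qed

lemma metric_facts:
  assumes "oriented_analytic_riemannian3 M" "c \<in> atlas M" "p \<in> chart_dom c"
  shows "real_analytic_at (metric_mat M c) (coord c p)"
    and "positive_definite (metric_mat M c (coord c p))"
proof -
  have "real_analytic_on (metric_mat M c) (chart_image c) \<and>
      (\<forall>x\<in>chart_image c. positive_definite (metric_mat M c x))"
    using assms(1,2) unfolding oriented_analytic_riemannian3_def analytic_metric_def by blast
  moreover have "coord c p \<in> chart_image c" using assms(3) by (simp add: chart_image_def)
  ultimately show "real_analytic_at (metric_mat M c) (coord c p)"
    and "positive_definite (metric_mat M c (coord c p))"
    by (auto simp: real_analytic_on_def)
qed

locale analytic_riemannian_map =
  fixes M :: "'a riem3" and N :: "'b riem3" and f :: "'a \<Rightarrow> 'b"
  assumes M: "oriented_analytic_riemannian3 M" and N: "oriented_analytic_riemannian3 N"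
    and f: "analytic_map M N f"
begin

lemma atlas_is_chart: "c \<in> atlas M \<Longrightarrow> is_chart (man_top M) c" "d \<in> atlas N \<Longrightarrow> is_chart (man_top N) d"
  using M N by (auto simp: oriented_analytic_riemannian3_def oriented_analytic_atlas_def)

lemma map_continuous: "continuous_map (man_top M) (man_top N) f"
  using f by (simp add: analytic_map_def analytic_map_on_def)

lemma map_topspace: "p \<in> topspace (man_top M) \<Longrightarrow> f p \<in> topspace (man_top N)"
  using map_continuous by (auto simp: continuous_map_def)

lemma chart_at_facts:
  assumes "p \<in> topspace (man_top M)"
  shows "chart_at M p \<in> atlas M" "p \<in> chart_dom (chart_at M p)"
    "chart_at N (f p) \<in> atlas N" "f p \<in> chart_dom (chart_at N (f p))"
proof -
  have "\<exists>c. c \<in> atlas M \<and> p \<in> chart_dom c"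
    using M assms unfolding oriented_analytic_riemannian3_def oriented_analytic_atlas_def by blast
  from someI_ex[OF this] show "chart_at M p \<in> atlas M" "p \<in> chart_dom (chart_at M p)"
    by (auto simp: chart_at_def)
  have "\<exists>c. c \<in> atlas N \<and> f p \<in> chart_dom c"
    using N map_topspace[OF assms] unfolding oriented_analytic_riemannian3_def oriented_analytic_atlas_def by blast
  from someI_ex[OF this] show "chart_at N (f p) \<in> atlas N" "f p \<in> chart_dom (chart_at N (f p))"
    by (auto simp: chart_at_def)
qed

lemma coord_in_rep_dom:
  "c \<in> atlas M \<Longrightarrow> p \<in> chart_dom c \<Longrightarrow> f p \<in> chart_dom d \<Longrightarrow> coord c p \<in> rep_dom c d (topspace (man_top M)) f"
  using chart_dom_subset[OF atlas_is_chart(1)] by (auto simp: rep_dom_def)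

lemma open_map_rep_dom:
  assumes "c \<in> atlas M" "d \<in> atlas N"
  shows "open (rep_dom c d (topspace (man_top M)) f)"
  by (rule open_rep_dom[OF atlas_is_chart(1) atlas_is_chart(2)]) (use assms map_continuous in simp_all)

lemma rep_analytic:
  assumes "c \<in> atlas M" "d \<in> atlas N" "x \<in> rep_dom c d (topspace (man_top M)) f"
  shows "real_analytic_at (coord_rep c d f) x"
  using f assms by (auto simp: analytic_map_def analytic_map_on_def real_analytic_on_def)

text \<open>The Riemannian quantities are defined at each point through charts selected by choice,
  which may jump from point to point. Rewritten in fixed charts, they can be compared with
  continuous functions of the coordinates.\<close>

lemma coordinate_change:
  assumes p: "p \<in> topspace (man_top M)"
    and c: "c \<in> atlas M" "p \<in> chart_dom c" and d: "d \<in> atlas N" "f p \<in> chart_dom d"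
  defines "D \<equiv> jacobian (coord_rep c d f) (at (coord c p))"
    and "G \<equiv> metric_mat M c (coord c p)" and "H \<equiv> metric_mat N d (coord d (f p))"
  shows "riem_jacobian M N f p = sqrt (det H) / sqrt (det G) * det D"
    and "sqrt ((D *v v) \<bullet> (H *v (D *v v))) \<le> riem_opnorm M N f p * sqrt (v \<bullet> (G *v v))"
proof -
  define c' where "c' = chart_at M p"
  define d' where "d' = chart_at N (f p)"
  have c': "c' \<in> atlas M" "p \<in> chart_dom c'" and d': "d' \<in> atlas N" "f p \<in> chart_dom d'"
    using chart_at_facts[OF p] by (auto simp: c'_def d'_def)
  have fp: "f p \<in> topspace (man_top N)" using map_topspace[OF p] .
  define T where "T = jacobian (coord_rep c c' id) (at (coord c p))"
  define S where "S = jacobian (coord_rep d' d id) (at (coord d' (f p)))"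
  have rc: "coord c p \<in> rep_dom c c' (topspace (man_top M)) id"
    using p c c' by (auto simp: rep_dom_def)
  have rd: "coord d' (f p) \<in> rep_dom d' d (topspace (man_top N)) id"
    using fp d d' by (auto simp: rep_dom_def)
  have T: "det T > 0" and anT: "real_analytic_at (coord_rep c c' id) (coord c p)"
    using M c c' rc unfolding oriented_analytic_riemannian3_def oriented_analytic_atlas_def real_analytic_on_def T_def
    by blast+
  have S: "det S > 0" and anS: "real_analytic_at (coord_rep d' d id) (coord d' (f p))"
    using N d d' rd unfolding oriented_analytic_riemannian3_def oriented_analytic_atlas_def real_analytic_on_def S_def
    by blast+
  have crT: "coord_rep c c' id (coord c p) = coord c' p"
    using coord_rep_coord[OF atlas_is_chart(1)[OF c(1)] c(2), where d=c' and f=id] by simp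
  have crS: "coord_rep d' d id (coord d' (f p)) = coord d (f p)"
    using coord_rep_coord[OF atlas_is_chart(2)[OF d'(1)] d'(2), where d=d and f=id] by simp
  have crf: "coord_rep c' d' f (coord c' p) = coord d' (f p)"
    by (rule coord_rep_coord[OF atlas_is_chart(1)[OF c'(1)] c'(2)])
  define G' where "G' = metric_at M p"
  define H' where "H' = metric_at N (f p)"
  have G'eq: "G' = metric_mat M c' (coord c' p)" and H'eq: "H' = metric_mat N d' (coord d' (f p))"
    by (simp_all add: G'_def H'_def metric_at_def c'_def d'_def)
  have "let T = jacobian (coord_rep c c' id) (at (coord c p)) in
        metric_mat M c (coord c p) = transpose T ** metric_mat M c' (coord_rep c c' id (coord c p)) ** T"
    using M c c' rc unfolding oriented_analytic_riemannian3_def analytic_metric_def by blast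
  then have GT: "G = transpose T ** G' ** T" by (simp add: Let_def T_def G_def G'eq crT)
  have "let T = jacobian (coord_rep d' d id) (at (coord d' (f p))) in
        metric_mat N d' (coord d' (f p)) = transpose T ** metric_mat N d (coord_rep d' d id (coord d' (f p))) ** T"
    using N d d' rd unfolding oriented_analytic_riemannian3_def analytic_metric_def by blast
  then have HS: "H' = transpose S ** H ** S" by (simp add: Let_def S_def H_def H'eq crS)
  define D' where "D' = differential_at M N f p"
  have D'eq: "D' = jacobian (coord_rep c' d' f) (at (coord c' p))"
    by (simp add: D'_def differential_at_def c'_def d'_def)
  have anf: "real_analytic_at (coord_rep c' d' f) (coord c' p)"
    by (rule rep_analytic[OF c'(1) d'(1) coord_in_rep_dom[OF c' d'(2)]])
  \<comment> \<open>The set on which all coordinate expressions of the chain rule are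
    meaningful.\<close>
  define W where "W = {q \<in> topspace (man_top M). q \<in> chart_dom c' \<and> f q \<in> chart_dom d \<and> f q \<in> chart_dom d'}"
  have oW: "openin (man_top M) W"
  proof -
    have "openin (man_top N) (chart_dom d \<inter> chart_dom d')"
      using atlas_is_chart(2)[OF d(1)] atlas_is_chart(2)[OF d'(1)] by (auto simp: is_chart_def)
    from openin_continuous_map_preimage[OF map_continuous this]
    have "openin (man_top M) ({q \<in> topspace (man_top M). f q \<in> chart_dom d \<inter> chart_dom d'} \<inter> chart_dom c')"
      using atlas_is_chart(1)[OF c'(1)] by (intro openin_Int) (auto simp: is_chart_def)
    moreover have "{q \<in> topspace (man_top M). f q \<in> chart_dom d \<inter> chart_dom d'} \<inter> chart_dom c' = W"
      by (auto simp: W_def)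
    ultimately show ?thesis by simp
  qed
  have oV: "open (coord c ` {q \<in> chart_dom c. q \<in> W})"
    by (rule open_coord_image[OF atlas_is_chart(1)[OF c(1)] oW])
  have xV: "coord c p \<in> coord c ` {q \<in> chart_dom c. q \<in> W}"
    using p c(2) c'(2) d(2) d'(2) by (auto simp: W_def)
  have step1: "jacobian (\<lambda>x. coord_rep c' d' f (coord_rep c c' id x)) (at (coord c p)) = D' ** T"
    unfolding D'eq T_def crT[symmetric]
    by (rule jacobian_compose[OF real_analytic_at_differentiable[OF anT], of _ UNIV])
      (use real_analytic_at_differentiable[OF anf] crT in auto)
  have diff1: "(\<lambda>x. coord_rep c' d' f (coord_rep c c' id x)) differentiable at (coord c p)"
    using differentiable_chain_at[OF real_analytic_at_differentiable[OF anT], of "coord_rep c' d' f"]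
      real_analytic_at_differentiable[OF anf] crT by (simp add: o_def)
  have "D = S ** (D' ** T)"
  proof -
    have "D = jacobian (coord_rep d' d id) (at (coord_rep c' d' f (coord_rep c c' id (coord c p))))
        ** jacobian (\<lambda>x. coord_rep c' d' f (coord_rep c c' id x)) (at (coord c p))"
      unfolding D_def
    proof (rule jacobian_compose[OF diff1 _ oV xV])
      show "coord_rep d' d id differentiable at (coord_rep c' d' f (coord_rep c c' id (coord c p)))"
        using real_analytic_at_differentiable[OF anS] by (simp add: crT crf)
      fix y assume "y \<in> coord c ` {q \<in> chart_dom c. q \<in> W}"
      then obtain q where q: "q \<in> chart_dom c" "q \<in> W" "y = coord c q" by blast
      then have q': "q \<in> chart_dom c'" "f q \<in> chart_dom d'" by (auto simp: W_def)
      show "coord_rep c d f y = coord_rep d' d id (coord_rep c' d' f (coord_rep c c' id y))"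
        using q q' c d c' d' by (simp add: coord_rep_coord[OF atlas_is_chart(1)] coord_rep_coord[OF atlas_is_chart(2)])
    qed
    then show ?thesis by (simp add: step1 crT crf S_def)
  qed
  then have D: "D = S ** D' ** T" by (simp add: matrix_mul_assoc)
  have G'pos: "positive_definite G'" unfolding G'eq by (rule metric_facts(2)[OF M c'])
  have Hpos: "positive_definite H" unfolding H_def by (rule metric_facts(2)[OF N d])
  have Gpos: "positive_definite G" unfolding G_def by (rule metric_facts(2)[OF M c])
  note change = jacobian_metric_change[OF GT HS D T S positive_definite_det_pos[OF G'pos] positive_definite_det_pos[OF Hpos]]
  show "riem_jacobian M N f p = sqrt (det H) / sqrt (det G) * det D"
    using change(1) by (simp add: riem_jacobian_def G'_def H'_def D'_def)
  let ?A = "{metric_norm N (f p) (D' *v u) | u. metric_norm M p u = 1}"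
  \<comment> \<open>Boundedness gives the supremum its meaning as an upper bound: the metric unit
    sphere lies in the Euclidean ball of radius \<open>sqrt (1 / \<mu>)\<close>.\<close>
  have bdd: "bdd_above ?A"
  proof -
    obtain \<mu> where \<mu>: "\<mu> > 0" "\<And>y. \<mu> * norm y ^ 2 \<le> y \<bullet> (G' *v y)"
      using positive_definite_lower_bound[OF G'pos] by blast
    let ?s = "\<lambda>A::real^3^3. \<Sum>i\<in>UNIV. \<Sum>j\<in>UNIV. \<bar>A $ i $ j\<bar>"
    have s: "?s A \<ge> 0" for A by (intro sum_nonneg) auto
    have "metric_norm N (f p) (D' *v u) \<le> sqrt (?s H' * (?s D' * sqrt (1 / \<mu>)) ^ 2)" if u: "metric_norm M p u = 1" for u
    proof -
      have "u \<bullet> (G' *v u) = 1" using u by (simp add: metric_norm_def G'_def)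
      with \<mu>(2)[of u] have "norm u \<le> sqrt (1 / \<mu>)"
        using \<mu>(1) by (intro real_le_rsqrt) (simp add: field_simps)
      then have "norm (D' *v u) \<le> ?s D' * sqrt (1 / \<mu>)"
        using s by (intro order_trans[OF matrix_vector_norm_le] mult_left_mono) auto
      then have "?s H' * norm (D' *v u) ^ 2 \<le> ?s H' * (?s D' * sqrt (1 / \<mu>)) ^ 2"
        using s by (intro mult_left_mono power_mono) auto
      moreover have "(D' *v u) \<bullet> (H' *v (D' *v u)) \<le> ?s H' * norm (D' *v u) ^ 2"
        using quadratic_form_le[of "D' *v u" H'] by linarith
      ultimately show ?thesis unfolding metric_norm_def H'_def[symmetric]
        by (intro real_sqrt_le_mono) linarith
    qed
    then show ?thesis by (intro bdd_aboveI[of _ "sqrt (?s H' * (?s D' * sqrt (1 / \<mu>)) ^ 2)"]) auto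
  qed
  show "sqrt ((D *v v) \<bullet> (H *v (D *v v))) \<le> riem_opnorm M N f p * sqrt (v \<bullet> (G *v v))"
  proof (cases "v = 0")
    case False
    then have v: "v \<bullet> (G *v v) > 0" using Gpos by (simp add: positive_definite_def)
    define n where "n = sqrt (v \<bullet> (G *v v))"
    have n: "n > 0" using v by (simp add: n_def)
    define u where "u = (T *v v) /\<^sub>R n"
    have "u \<bullet> (G' *v u) = (inverse n)^2 * (v \<bullet> (G *v v))"
      unfolding u_def using change(3)[of v] by (simp add: matrix_vector_mult_scaleR power2_eq_square)
    moreover have "v \<bullet> (G *v v) = n^2" using v by (simp add: n_def)
    ultimately have "metric_norm M p u = 1"
      unfolding metric_norm_def G'_def[symmetric] using n by (simp add: power_inverse)
    then have "metric_norm N (f p) (D' *v u) \<in> ?A" by blast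
    then have "metric_norm N (f p) (D' *v u) \<le> Sup ?A" using bdd by (rule cSup_upper)
    then have le: "metric_norm N (f p) (D' *v u) \<le> riem_opnorm M N f p"
      by (simp add: riem_opnorm_def D'_def)
    have "(D' *v u) \<bullet> (H' *v (D' *v u)) = (inverse n)^2 * ((D *v v) \<bullet> (H *v (D *v v)))"
      unfolding u_def using change(2)[of v] by (simp add: matrix_vector_mult_scaleR power2_eq_square)
    then have "metric_norm N (f p) (D' *v u) = sqrt ((D *v v) \<bullet> (H *v (D *v v))) / n"
      unfolding metric_norm_def H'_def[symmetric]
      using n by (simp add: real_sqrt_mult divide_inverse mult.commute)
    with le show ?thesis using n by (simp add: n_def[symmetric] field_simps)
  qed simp
qed

end

section \<open>The quasiregularity inequality at every point of a chart\<close>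

lemma isCont_matrix_vector_mult:
  fixes A :: "'b::t2_space \<Rightarrow> real^'n^'m"
  shows "isCont A x \<Longrightarrow> isCont v x \<Longrightarrow> isCont (\<lambda>x. A x *v v x) x"
  unfolding isCont_def by (rule tendsto_matrix_vector_mult)

lemma isCont_det:
  fixes A :: "'b::t2_space \<Rightarrow> real^3^3"
  shows "isCont A x \<Longrightarrow> isCont (\<lambda>x. det (A x)) x"
  unfolding isCont_def by (rule tendsto_det_3)

lemma isCont_vec:
  fixes F :: "'b::t2_space \<Rightarrow> 'c::topological_space^'m"
  assumes "\<And>j. isCont (\<lambda>y. F y $ j) x"
  shows "isCont F x"
  using assms unfolding isCont_def by (intro vec_tendstoI) blast

lemma isCont_partial_jac:
  assumes "real_analytic_at F x"
  shows "isCont (partial_jac F) x"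
proof (rule isCont_vec, rule isCont_vec)
  fix j l
  have "isCont (partial_deriv l (\<lambda>z. F z $ j)) x"
    by (rule real_analytic_at_isCont_partial_deriv(2)[OF real_analytic_at_component[OF assms]])
  then show "isCont (\<lambda>y. partial_jac F y $ j $ l) x" by (simp add: partial_jac_def)
qed

lemma real_analytic_at_isCont_matrix:
  fixes G :: "real^'n \<Rightarrow> real^'m^'k"
  assumes "real_analytic_at G x"
  shows "isCont G x"
  by (rule isCont_vec, rule isCont_vec,
      rule real_analytic_at_isCont_partial_deriv(1)[OF real_analytic_at_component[OF real_analytic_at_component[OF assms]]])

lemma real_analytic_at_isCont:
  fixes F :: "real^'n \<Rightarrow> real^'m"
  assumes "real_analytic_at F x"
  shows "isCont F x"
  by (rule isCont_vec, rule real_analytic_at_isCont_partial_deriv(1)[OF real_analytic_at_component[OF assms]])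

lemma isCont_eventually_less:
  fixes \<phi> :: "'b::t2_space \<Rightarrow> real"
  assumes "isCont \<phi> x" "\<phi> x < b"
  shows "\<forall>\<^sub>F y in nhds x. \<phi> y < b"
proof -
  have "(\<phi> \<longlongrightarrow> \<phi> x) (nhds x)"
    using assms(1) unfolding isCont_def by (subst (asm) tendsto_at_iff_tendsto_nhds)
  then show ?thesis using assms(2) by (rule order_tendstoD(2))
qed

text \<open>The points where the inequality fails form an open set, and a nonempty open set is not
  negligible.\<close>

lemma AE_le_imp_le:
  fixes \<phi> \<psi> :: "'n::euclidean_space \<Rightarrow> real"
  assumes S: "open S" and ae: "AE x in lebesgue. x \<in> S \<longrightarrow> \<phi> x \<le> \<psi> x"
    and c: "\<And>x. x \<in> S \<Longrightarrow> isCont \<phi> x" "\<And>x. x \<in> S \<Longrightarrow> isCont \<psi> x" and x: "x \<in> S"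
  shows "\<phi> x \<le> \<psi> x"
proof (rule ccontr)
  assume "\<not> \<phi> x \<le> \<psi> x"
  let ?T = "S \<inter> (\<lambda>x. \<phi> x - \<psi> x) -` {0<..}"
  have "continuous_on S (\<lambda>x. \<phi> x - \<psi> x)"
    by (intro continuous_at_imp_continuous_on ballI continuous_diff c)
  then have "open ?T" by (rule continuous_open_preimage[OF _ S]) simp
  moreover have "?T \<noteq> {}" using x \<open>\<not> \<phi> x \<le> \<psi> x\<close> by auto
  ultimately have neg: "\<not> negligible ?T" by (rule open_not_negligible)
  obtain Z where Z: "negligible Z" "{x. \<not> (x \<in> S \<longrightarrow> \<phi> x \<le> \<psi> x)} \<subseteq> Z"
    using ae unfolding eventually_ae_filter_negligible by blast
  have "negligible ?T" by (rule negligible_subset[OF Z(1)]) (use Z(2) in auto)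
  with neg show False by simp
qed

context analytic_riemannian_map
begin

lemma rep_domE:
  assumes "c \<in> atlas M" "x \<in> rep_dom c d (topspace (man_top M)) f"
  obtains p where "p \<in> topspace (man_top M)" "p \<in> chart_dom c" "f p \<in> chart_dom d"
    "x = coord c p" "coord_inv c x = p" "coord_rep c d f x = coord d (f p)"
proof -
  obtain p where p: "p \<in> topspace (man_top M)" "p \<in> chart_dom c" "f p \<in> chart_dom d" "x = coord c p"
    using assms(2) by (auto simp: rep_dom_def)
  show thesis
    by (rule that[OF p]) (simp_all add: p(4) coord_inv_coord[OF atlas_is_chart(1)[OF assms(1)] p(2)]
        coord_rep_coord[OF atlas_is_chart(1)[OF assms(1)] p(2)])
qed

text \<open>The operator norm is tested on a fixed vector, which makes both sides continuous in
  coordinates and extends the inequality from almost all points to all. Enlarging \<open>K\<close>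
  to a positive constant is legitimate because the Jacobian is nonnegative almost
  everywhere.\<close>

lemma qr_inequality:
  assumes qr: "quasiregular K M N f" and c: "c \<in> atlas M" and d: "d \<in> atlas N"
    and x: "x \<in> rep_dom c d (topspace (man_top M)) f"
  defines "F \<equiv> coord_rep c d f"
  shows "sqrt ((partial_jac F x *v v) \<bullet> (metric_mat N d (F x) *v (partial_jac F x *v v))) ^ 3
    \<le> max K 1 * (sqrt (det (metric_mat N d (F x))) / sqrt (det (metric_mat M c x)) * det (partial_jac F x))
        * sqrt (v \<bullet> (metric_mat M c x *v v)) ^ 3"
proof -
  let ?S = "rep_dom c d (topspace (man_top M)) f"
  have ae: "AE x in lebesgue. x \<in> chart_image c \<longrightarrow> riem_jacobian M N f (coord_inv c x) \<ge> 0"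
    "AE x in lebesgue. x \<in> chart_image c \<longrightarrow>
        riem_opnorm M N f (coord_inv c x) ^ 3 \<le> K * riem_jacobian M N f (coord_inv c x)"
    using qr c unfolding quasiregular_def almost_everywhere_def by blast+
  have ae': "AE x in lebesgue. x \<in> ?S \<longrightarrow>
      sqrt ((partial_jac F x *v v) \<bullet> (metric_mat N d (F x) *v (partial_jac F x *v v))) ^ 3
    \<le> max K 1 * (sqrt (det (metric_mat N d (F x))) / sqrt (det (metric_mat M c x)) * det (partial_jac F x))
        * sqrt (v \<bullet> (metric_mat M c x *v v)) ^ 3"
    using ae
  proof eventually_elim
    case (elim x)
    show ?case
    proof
      assume x: "x \<in> ?S"
      then obtain p where p: "p \<in> topspace (man_top M)" "p \<in> chart_dom c" "f p \<in> chart_dom d"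
          "x = coord c p" "coord_inv c x = p" "coord_rep c d f x = coord d (f p)"
        using rep_domE[OF c] by blast
      note cc = coordinate_change[OF p(1) c p(2) d p(3), folded p(4), folded p(6), folded F_def]
      have jac: "partial_jac F x = jacobian F (at x)"
        unfolding F_def
        by (intro partial_jac_eq_jacobian real_analytic_at_differentiable rep_analytic c d x)
      have img: "x \<in> chart_image c" using p by (auto simp: chart_image_def)
      let ?J = "riem_jacobian M N f p" and ?o = "riem_opnorm M N f p"
      let ?n = "sqrt (v \<bullet> (metric_mat M c x *v v))"
      let ?l = "sqrt ((partial_jac F x *v v) \<bullet> (metric_mat N d (F x) *v (partial_jac F x *v v)))"
      have J: "0 \<le> ?J" and o: "?o ^ 3 \<le> K * ?J" using elim img p(5) by auto
      have Jeq: "?J = sqrt (det (metric_mat N d (F x))) / sqrt (det (metric_mat M c x)) * det (partial_jac F x)"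
        using cc(1) by (simp only: jac)
      have le: "?l \<le> ?o * ?n"
        using cc(2)[of v] by (simp only: jac)
      have l0: "0 \<le> ?l"
        using metric_facts(2)[OF N d p(3)]
        by (cases "partial_jac F x *v v = 0") (auto simp: F_def p(6) positive_definite_def less_imp_le)
      have n0: "0 \<le> ?n ^ 3"
        using metric_facts(2)[OF M c p(2)]
        by (cases "v = 0") (auto simp: p(4) positive_definite_def less_imp_le)
      have "?l ^ 3 \<le> (?o * ?n) ^ 3" using le l0 by (rule power_mono)
      also have "\<dots> = ?o ^ 3 * ?n ^ 3" by (rule power_mult_distrib)
      also have "\<dots> \<le> (max K 1 * ?J) * ?n ^ 3"
      proof (rule mult_right_mono[OF _ n0])
        show "?o ^ 3 \<le> max K 1 * ?J" using o J by (smt (verit) mult_right_mono max.cobounded1)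
      qed
      finally show "?l ^ 3 \<le> max K 1 * (sqrt (det (metric_mat N d (F x))) / sqrt (det (metric_mat M c x)) * det (partial_jac F x)) * ?n ^ 3"
        unfolding Jeq .
    qed
  qed
  show ?thesis
  proof (rule AE_le_imp_le[OF open_map_rep_dom[OF c d] ae' _ _ x])
    fix x assume xS: "x \<in> ?S"
    then obtain p where p: "p \<in> topspace (man_top M)" "p \<in> chart_dom c" "f p \<in> chart_dom d"
          "x = coord c p" "coord_inv c x = p" "coord_rep c d f x = coord d (f p)"
      using rep_domE[OF c] by blast
    have an: "real_analytic_at F x" unfolding F_def by (rule rep_analytic[OF c d xS])
    have D: "isCont (partial_jac F) x" by (rule isCont_partial_jac[OF an])
    have G: "isCont (metric_mat M c) x"
      unfolding p(4) by (rule real_analytic_at_isCont_matrix[OF metric_facts(1)[OF M c p(2)]])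
    have "isCont (metric_mat N d) (F x)"
      unfolding F_def p(6) by (rule real_analytic_at_isCont_matrix[OF metric_facts(1)[OF N d p(3)]])
    then have H: "isCont (\<lambda>x. metric_mat N d (F x)) x"
      by (rule isCont_o2[OF real_analytic_at_isCont[OF an]])
    have "det (metric_mat M c x) > 0"
      unfolding p(4) by (rule positive_definite_det_pos[OF metric_facts(2)[OF M c p(2)]])
    then have g: "sqrt (det (metric_mat M c x)) \<noteq> 0" by simp
    show "isCont (\<lambda>x. sqrt ((partial_jac F x *v v) \<bullet> (metric_mat N d (F x) *v (partial_jac F x *v v))) ^ 3) x"
      by (intro continuous_intros isCont_matrix_vector_mult D H)
    show "isCont (\<lambda>x. max K 1 * (sqrt (det (metric_mat N d (F x))) / sqrt (det (metric_mat M c x)) * det (partial_jac F x))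
        * sqrt (v \<bullet> (metric_mat M c x *v v)) ^ 3) x"
      by (intro continuous_intros isCont_matrix_vector_mult isCont_det D H G g)
  qed
qed

text \<open>Near the base point the target metric is bounded below by \<mu>/2, the source metric
  above by \<open>B\<close>, and the volume ratio above by its central value plus 1. The constant
  \<open>C\<close> collects these comparisons, so the blow-ups can use Euclidean norms.\<close>

lemma qr_euclidean:
  assumes qr: "quasiregular K M N f" and c: "c \<in> atlas M" and d: "d \<in> atlas N"
    and x0: "x0 \<in> rep_dom c d (topspace (man_top M)) f"
  defines "F \<equiv> coord_rep c d f"
  obtains C where "C > 0"
    "\<forall>\<^sub>F x in nhds x0. \<forall>v. norm (partial_jac F x *v v) ^ 3 \<le> C * norm v ^ 3 * det (partial_jac F x)"
proof -
  let ?S = "rep_dom c d (topspace (man_top M)) f"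
  obtain p where p: "p \<in> topspace (man_top M)" "p \<in> chart_dom c" "f p \<in> chart_dom d"
          "x0 = coord c p" "coord_inv c x0 = p" "coord_rep c d f x0 = coord d (f p)"
    using rep_domE[OF c x0] by blast
  define G where "G = metric_mat M c"
  define H where "H x = metric_mat N d (F x)" for x
  have an: "real_analytic_at F x0" unfolding F_def by (rule rep_analytic[OF c d x0])
  have contG: "isCont G x0"
    unfolding G_def p(4) by (rule real_analytic_at_isCont_matrix[OF metric_facts(1)[OF M c p(2)]])
  have "isCont (metric_mat N d) (F x0)"
    unfolding F_def p(6) by (rule real_analytic_at_isCont_matrix[OF metric_facts(1)[OF N d p(3)]])
  then have contH: "isCont H x0"
    unfolding H_def by (rule isCont_o2[OF real_analytic_at_isCont[OF an]])
  have Gpos: "positive_definite (G x)" and Hpos: "positive_definite (H x)" if "x \<in> ?S" for x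
    using rep_domE[OF c that] metric_facts(2)[OF M c] metric_facts(2)[OF N d]
    unfolding G_def H_def F_def by metis+
  let ?s = "\<lambda>A::real^3^3. \<Sum>i\<in>UNIV. \<Sum>j\<in>UNIV. \<bar>A $ i $ j\<bar>"
  have s: "?s A \<ge> 0" for A by (intro sum_nonneg) auto
  have conts: "isCont (\<lambda>x. ?s (A x)) x0" if "isCont A x0" for A :: "real^3 \<Rightarrow> real^3^3"
    by (intro continuous_intros that)
  obtain \<mu> where \<mu>: "\<mu> > 0" "\<And>y. \<mu> * norm y ^ 2 \<le> y \<bullet> (H x0 *v y)"
    using positive_definite_lower_bound[OF Hpos[OF x0]] by blast
  define \<eta> where "\<eta> x = sqrt (det (H x)) / sqrt (det (G x))" for x
  have dG: "det (G x) > 0" and dH: "det (H x) > 0" if "x \<in> ?S" for x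
    using positive_definite_det_pos Gpos[OF that] Hpos[OF that] by auto
  have \<eta>: "\<eta> x > 0" if "x \<in> ?S" for x using dG[OF that] dH[OF that] by (simp add: \<eta>_def)
  have cont\<eta>: "isCont \<eta> x0"
    unfolding \<eta>_def[abs_def] using dG[OF x0]
    by (intro continuous_intros isCont_det contG contH) auto
  have ev1: "\<forall>\<^sub>F x in nhds x0. ?s (H x - H x0) < \<mu> / 2"
    by (rule isCont_eventually_less) (use \<mu>(1) in \<open>auto intro!: conts continuous_intros contH\<close>)
  have ev2: "\<forall>\<^sub>F x in nhds x0. ?s (G x) < ?s (G x0) + 1"
    by (rule isCont_eventually_less[OF conts[OF contG]]) simp
  have ev3: "\<forall>\<^sub>F x in nhds x0. \<eta> x < \<eta> x0 + 1"
    by (rule isCont_eventually_less[OF cont\<eta>]) simp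
  have ev4: "\<forall>\<^sub>F x in nhds x0. x \<in> ?S"
    by (rule eventually_nhds_in_open[OF open_map_rep_dom[OF c d] x0])
  define B where "B = ?s (G x0) + 1"
  define h where "h = sqrt (\<mu> / 2)"
  define k where "k = max K 1"
  define C where "C = k * (\<eta> x0 + 1) * sqrt B ^ 3 / h ^ 3"
  have B: "B > 0" using s[of "G x0"] by (simp add: B_def)
  have h: "h > 0" using \<mu>(1) by (simp add: h_def)
  have k: "k > 0" by (simp add: k_def)
  have C: "C > 0" using k \<eta>[OF x0] B h by (simp add: C_def)
  show thesis
  proof (rule that[OF C])
    show "\<forall>\<^sub>F x in nhds x0. \<forall>v. norm (partial_jac F x *v v) ^ 3 \<le> C * norm v ^ 3 * det (partial_jac F x)"
      using ev1 ev2 ev3 ev4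
    proof eventually_elim
      case (elim x)
      let ?D = "partial_jac F x"
      let ?n = "\<lambda>v. sqrt (v \<bullet> (G x *v v))"
      have main: "sqrt ((?D *v v) \<bullet> (H x *v (?D *v v))) ^ 3 \<le> k * (\<eta> x * det ?D) * ?n v ^ 3" for v
        using qr_inequality[OF qr c d elim(4), of v] unfolding F_def[symmetric] G_def[symmetric] H_def[symmetric] k_def[symmetric] \<eta>_def by simp
      have low: "h * norm w \<le> sqrt (w \<bullet> (H x *v w))" for w
      proof -
        have "w \<bullet> (H x *v w) = w \<bullet> (H x0 *v w) + w \<bullet> ((H x - H x0) *v w)"
          by (simp add: matrix_vector_mult_diff_rdistrib inner_diff_right)
        moreover have "\<bar>w \<bullet> ((H x - H x0) *v w)\<bar> \<le> \<mu> / 2 * norm w ^ 2"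
          by (rule order_trans[OF quadratic_form_le mult_right_mono]) (use elim(1) in auto)
        ultimately have "\<mu> / 2 * norm w ^ 2 \<le> w \<bullet> (H x *v w)" using \<mu>(2)[of w] by linarith
        then have "sqrt (\<mu> / 2 * norm w ^ 2) \<le> sqrt (w \<bullet> (H x *v w))" by (rule real_sqrt_le_mono)
        then show ?thesis by (simp only: h_def real_sqrt_mult real_sqrt_abs abs_norm_cancel)
      qed
      have up: "?n v \<le> sqrt B * norm v" for v
      proof -
        have "v \<bullet> (G x *v v) \<le> ?s (G x) * norm v ^ 2" using quadratic_form_le[of v "G x"] by linarith
        also have "\<dots> \<le> B * norm v ^ 2" using elim(2) by (intro mult_right_mono) (auto simp: B_def)
        finally have "?n v \<le> sqrt (B * norm v ^ 2)" by (rule real_sqrt_le_mono)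
        then show ?thesis by (simp only: real_sqrt_mult real_sqrt_abs abs_norm_cancel)
      qed
      \<comment> \<open>Nonnegativity is needed before the volume ratio may be replaced by its upper
        bound; it follows from the inequality at any nonzero vector.\<close>
      have det0: "det ?D \<ge> 0"
      proof -
        let ?e = "axis 1 1 :: real^3"
        have "?e \<noteq> 0" by (simp add: axis_eq_0_iff)
        then have n: "?n ?e > 0" using Gpos[OF elim(4)] by (simp add: positive_definite_def)
        have "0 \<le> h * norm (?D *v ?e)" using h by simp
        then have "0 \<le> sqrt ((?D *v ?e) \<bullet> (H x *v (?D *v ?e))) ^ 3" using low[of "?D *v ?e"] by (intro zero_le_power) linarith
        then have "0 \<le> k * (\<eta> x * det ?D) * ?n ?e ^ 3" using main[of ?e] by linarith
        moreover have "k * (\<eta> x * det ?D) * ?n ?e ^ 3 = (k * \<eta> x * ?n ?e ^ 3) * det ?D" by (simp only: mult_ac)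
        moreover have "k * \<eta> x * ?n ?e ^ 3 > 0" using k \<eta>[OF elim(4)] n by (intro mult_pos_pos zero_less_power)
        ultimately show ?thesis by (metis zero_le_mult_iff not_less)
      qed
      show ?case
      proof
        fix v
        have n0: "0 \<le> ?n v"
          using Gpos[OF elim(4)] by (cases "v = 0") (auto simp: positive_definite_def less_imp_le)
        have "(h * norm (?D *v v)) ^ 3 \<le> sqrt ((?D *v v) \<bullet> (H x *v (?D *v v))) ^ 3"
          using h by (intro power_mono low) auto
        also have "\<dots> \<le> k * (\<eta> x * det ?D) * ?n v ^ 3" by (rule main)
        also have "\<dots> \<le> k * ((\<eta> x0 + 1) * det ?D) * (sqrt B * norm v) ^ 3"
          using k elim(3) \<eta>[OF elim(4)] \<eta>[OF x0] det0 n0 up[of v]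
          by (intro mult_mono power_mono mult_left_mono mult_right_mono mult_nonneg_nonneg zero_le_power) auto
        also have "\<dots> = h ^ 3 * (C * norm v ^ 3 * det ?D)"
          using h by (simp add: C_def power_mult_distrib)
        finally have "h ^ 3 * norm (?D *v v) ^ 3 \<le> h ^ 3 * (C * norm v ^ 3 * det ?D)"
          by (simp add: power_mult_distrib)
        then show "norm (?D *v v) ^ 3 \<le> C * norm v ^ 3 * det ?D"
          using h by (simp add: mult_le_cancel_left)
      qed
    qed
  qed
qed

end

context analytic_riemannian_map
begin

section \<open>Local nonconstancy and positivity of the Jacobian\<close>

lemma chart_ball:
  assumes c: "c \<in> atlas M" and d: "d \<in> atlas N" and p: "p \<in> chart_dom c" "f p \<in> chart_dom d"
  obtains r where "r > 0" "ball (coord c p) r \<subseteq> rep_dom c d (topspace (man_top M)) f"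
  using openE[OF open_map_rep_dom[OF c d] coord_in_rep_dom[OF c p]] by blast

text \<open>Membership in \<open>rep_dom\<close> says that the coordinate is attained at some
  suitable point of the chart; injectivity of the chart identifies that point with
  \<open>q\<close>.\<close>

lemma coord_ball_preimage:
  assumes c: "c \<in> atlas M" and B: "B \<subseteq> rep_dom c d (topspace (man_top M)) f"
    and q: "q \<in> chart_dom c" "coord c q \<in> B"
  shows "f q \<in> chart_dom d" "q \<in> topspace (man_top M)"
proof -
  obtain p where p: "p \<in> topspace (man_top M)" "p \<in> chart_dom c" "f p \<in> chart_dom d" "coord c q = coord c p"
    by (rule rep_domE[OF c subsetD[OF B q(2)]])
  have "q = p" by (rule inj_onD[OF inj_on_coord[OF atlas_is_chart(1)[OF c]] p(4) q(1) p(2)])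
  with p show "f q \<in> chart_dom d" "q \<in> topspace (man_top M)" by auto
qed

lemma rep_eq_imp_eq:
  assumes c: "c \<in> atlas M" and d: "d \<in> atlas N" and q: "q \<in> chart_dom c" "f q \<in> chart_dom d"
    and q': "q' \<in> chart_dom c" "f q' \<in> chart_dom d"
    and eq: "coord_rep c d f (coord c q) = coord_rep c d f (coord c q')"
  shows "f q = f q'"
proof (rule inj_onD[OF inj_on_coord[OF atlas_is_chart(2)[OF d]] _ q(2) q'(2)])
  show "coord d (f q) = coord d (f q')"
    using eq coord_rep_coord[OF atlas_is_chart(1)[OF c] q(1), of d f]
      coord_rep_coord[OF atlas_is_chart(1)[OF c] q'(1), of d f] by simp
qed

text \<open>By the identity theorem the set of points near which \<open>f\<close> is constant is open and closed.\<close>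

lemma nowhere_locally_constant:
  assumes conn: "connected_space (man_top M)" and nc: "\<not> f constant_on topspace (man_top M)"
    and p: "openin (man_top M) U" "p \<in> U"
  shows "\<exists>q\<in>U. f q \<noteq> f p"
proof (rule ccontr)
  assume const: "\<not> (\<exists>q\<in>U. f q \<noteq> f p)"
  define E where "E = {p \<in> topspace (man_top M). \<exists>U. openin (man_top M) U \<and> p \<in> U \<and> (\<forall>q\<in>U. f q = f p)}"
  have "p \<in> topspace (man_top M)" using p openin_subset[OF p(1)] by auto
  moreover have "\<exists>U. openin (man_top M) U \<and> p \<in> U \<and> (\<forall>q\<in>U. f q = f p)"
    using p const by blast
  ultimately have pE: "p \<in> E" by (simp add: E_def)
  have oE: "openin (man_top M) E"
  proof (subst openin_subopen, intro ballI)
    fix p assume "p \<in> E"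
    then obtain U where U: "openin (man_top M) U" "p \<in> U" "\<forall>q\<in>U. f q = f p" unfolding E_def by blast
    have "U \<subseteq> E"
    proof
      fix q assume "q \<in> U"
      have "q \<in> topspace (man_top M)" using \<open>q \<in> U\<close> openin_subset[OF U(1)] by blast
      moreover have "\<forall>q'\<in>U. f q' = f q"
      proof
        fix q' assume "q' \<in> U"
        then have "f q' = f p" by (rule bspec[OF U(3)])
        also have "f p = f q" by (rule bspec[OF U(3) \<open>q \<in> U\<close>, symmetric])
        finally show "f q' = f q" .
      qed
      ultimately show "q \<in> E" using U(1) \<open>q \<in> U\<close> unfolding E_def by blast
    qed
    with U show "\<exists>T. openin (man_top M) T \<and> p \<in> T \<and> T \<subseteq> E" by blast
  qed
  have "openin (man_top M) (topspace (man_top M) - E)"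
  proof (subst openin_subopen, intro ballI)
    fix p assume p: "p \<in> topspace (man_top M) - E"
    define c where "c = chart_at M p"
    define d where "d = chart_at N (f p)"
    have c: "c \<in> atlas M" "p \<in> chart_dom c" and d: "d \<in> atlas N" "f p \<in> chart_dom d"
      using chart_at_facts[of p] p by (auto simp: c_def d_def)
    obtain r where r: "r > 0" and B: "ball (coord c p) r \<subseteq> rep_dom c d (topspace (man_top M)) f"
      using chart_ball[OF c(1) d(1) c(2) d(2)] by blast
    define V where "V = {q \<in> chart_dom c. coord c q \<in> ball (coord c p) r}"
    have oV: "openin (man_top M) V"
      unfolding V_def by (rule openin_chart_preimage[OF atlas_is_chart(1)[OF c(1)] open_ball])
    have pV: "p \<in> V" using c(2) r by (simp add: V_def)
    have V: "f q \<in> chart_dom d" "q \<in> topspace (man_top M)" "q \<in> chart_dom c" if "q \<in> V" for q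
      using coord_ball_preimage[OF c(1) B, of q] that by (auto simp: V_def)
    let ?F = "coord_rep c d f"
    \<comment> \<open>A point of \<open>E\<close> in \<open>V\<close> would make the coordinate
      expression constant near it, hence on the whole coordinate ball by the identity theorem, and
      would put the centre into \<open>E\<close>.\<close>
    have "V \<inter> E = {}"
    proof (rule ccontr)
      assume "V \<inter> E \<noteq> {}"
      then obtain q W where q: "q \<in> V" "openin (man_top M) W" "q \<in> W" "\<forall>q'\<in>W. f q' = f q"
        unfolding E_def by blast
      have "open (coord c ` {q' \<in> chart_dom c. q' \<in> W})"
        by (rule open_coord_image[OF atlas_is_chart(1)[OF c(1)] q(2)])
      moreover have "coord c q \<in> coord c ` {q' \<in> chart_dom c. q' \<in> W}" using q V by auto
      ultimately obtain e where e: "e > 0" "ball (coord c q) e \<subseteq> coord c ` {q' \<in> chart_dom c. q' \<in> W}"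
        by (rule openE)
      have Fe: "?F z = ?F (coord c q)" if z: "z \<in> ball (coord c q) e" for z
      proof -
        obtain q' where q': "q' \<in> chart_dom c" "q' \<in> W" "z = coord c q'" using subsetD[OF e(2) z] by auto
        have "f q' = f q" using q(4) q'(2) by blast
        then show ?thesis
          using q' V(3)[OF q(1)] by (simp add: coord_rep_coord[OF atlas_is_chart(1)[OF c(1)]])
      qed
      have FB: "?F z $ j = ?F (coord c q) $ j" if z: "z \<in> ball (coord c p) r" for z j
      proof (rule analytic_locally_constant_imp_constant[where F="\<lambda>z. ?F z $ j" and S="ball (coord c p) r"
            and ?x1.0="coord c q" and e=e])
        fix z assume "z \<in> ball (coord c p) r"
        then have "real_analytic_at ?F z" using B by (intro rep_analytic[OF c(1) d(1)]) auto
        from real_analytic_at_imp_pseries[OF real_analytic_at_component[OF this]]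
        show "\<exists>a r. pseries a (\<lambda>z. ?F z $ j) z r" by blast
      next
        show "coord c q \<in> ball (coord c p) r" using q(1) by (simp add: V_def)
        show "?F w $ j = ?F (coord c q) $ j" if "w \<in> ball (coord c q) e" for w
          by (rule arg_cong[OF Fe[OF that]])
      qed (rule convex_ball e(1) z)+
      have "f q' = f p" if q': "q' \<in> V" for q'
      proof (rule rep_eq_imp_eq[OF c(1) d(1)])
        have "coord c q' \<in> ball (coord c p) r" "coord c p \<in> ball (coord c p) r"
          using q' r by (auto simp: V_def)
        then have "?F (coord c q') $ j = ?F (coord c p) $ j" for j
          by (simp only: FB)
        then show "?F (coord c q') = ?F (coord c p)" by (simp add: vec_eq_iff)
      qed (use V[OF q'] c(2) d(2) in auto)
      then have "p \<in> E" unfolding E_def using p oV pV by blast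
      with p show False by blast
    qed
    then have "V \<subseteq> topspace (man_top M) - E" using V(2) by auto
    with oV pV show "\<exists>T. openin (man_top M) T \<and> p \<in> T \<and> T \<subseteq> topspace (man_top M) - E" by blast
  qed
  then have "closedin (man_top M) E" by (auto simp: closedin_def E_def)
  with conn oE pE have E: "E = topspace (man_top M)"
    unfolding connected_space_clopen_in by blast
  define T where "T = {q \<in> topspace (man_top M). f q = f p}"
  \<comment> \<open>Once \<open>f\<close> is locally constant every preimage is open, so the level
    set through \<open>p\<close> is clopen and connectedness makes \<open>f\<close>
    constant.\<close>
  have oT: "openin (man_top M) {q \<in> topspace (man_top M). P (f q)}" for P
  proof (subst openin_subopen, intro ballI)
    fix q assume q: "q \<in> {q \<in> topspace (man_top M). P (f q)}"
    then have "q \<in> E" using E by simp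
    then obtain U where U: "openin (man_top M) U" "q \<in> U" "\<forall>q'\<in>U. f q' = f q" unfolding E_def by blast
    have "U \<subseteq> {q \<in> topspace (man_top M). P (f q)}"
    proof
      fix q' assume q': "q' \<in> U"
      have "P (f q')" unfolding bspec[OF U(3) q'] using q by simp
      then show "q' \<in> {q \<in> topspace (man_top M). P (f q)}" using q' openin_subset[OF U(1)] by blast
    qed
    with U show "\<exists>T. openin (man_top M) T \<and> q \<in> T \<and> T \<subseteq> {q \<in> topspace (man_top M). P (f q)}" by blast
  qed
  have "topspace (man_top M) - T = {q \<in> topspace (man_top M). f q \<noteq> f p}" by (auto simp: T_def)
  then have "closedin (man_top M) T" unfolding closedin_def using oT[of "\<lambda>y. y \<noteq> f p"] by (auto simp: T_def)
  moreover have "openin (man_top M) T" unfolding T_def by (rule oT)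
  moreover have "p \<in> T" using pE by (simp add: T_def E_def)
  ultimately have "T = topspace (man_top M)" using conn unfolding connected_space_clopen_in by blast
  then have "f constant_on topspace (man_top M)" unfolding constant_on_def T_def by blast
  with nc show False ..
qed

lemma partial_jac_pos:
  assumes conn: "connected_space (man_top M)" and qr: "quasiregular K M N f" and harm: "harmonic_map M N f"
    and c: "c \<in> atlas M" "p \<in> chart_dom c" and d: "d \<in> atlas N" "f p \<in> chart_dom d"
  shows "det (partial_jac (coord_rep c d f) (coord c p)) > 0"
proof -
  let ?S = "rep_dom c d (topspace (man_top M)) f" and ?F = "coord_rep c d f" and ?x = "coord c p"
  have x: "?x \<in> ?S" by (rule coord_in_rep_dom[OF c d(2)])
  have Fx: "?F ?x = coord d (f p)" by (rule coord_rep_coord[OF atlas_is_chart(1)[OF c(1)] c(2)])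
  obtain C where C: "C > 0"
    "\<forall>\<^sub>F x in nhds ?x. \<forall>v. norm (partial_jac ?F x *v v) ^ 3 \<le> C * norm v ^ 3 * det (partial_jac ?F x)"
    by (rule qr_euclidean[OF qr c(1) d(1) x])
  show ?thesis
  proof (rule qr_harmonic_jacobian_pos[OF rep_analytic[OF c(1) d(1) x] metric_facts[OF M c] _ _ _ C])
    show "real_analytic_at (metric_mat N d) (?F ?x)" "positive_definite (metric_mat N d (?F ?x))"
      unfolding Fx by (rule metric_facts[OF N d])+
    have "\<forall>\<^sub>F x in nhds ?x. x \<in> ?S"
      by (rule eventually_nhds_in_open[OF open_map_rep_dom[OF c(1) d(1)] x])
    then show "\<forall>\<^sub>F x in nhds ?x. harmonic_in_coords (metric_mat M c) (metric_mat N d) ?F x"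
      by eventually_elim (use harm c(1) d(1) in \<open>simp add: harmonic_map_def\<close>)
    show "\<not> (\<forall>\<^sub>F x in nhds ?x. ?F x = ?F ?x)"
    proof
      assume "\<forall>\<^sub>F x in nhds ?x. ?F x = ?F ?x"
      with \<open>\<forall>\<^sub>F x in nhds ?x. x \<in> ?S\<close> have "\<forall>\<^sub>F x in nhds ?x. x \<in> ?S \<and> ?F x = ?F ?x"
        by (rule eventually_conj)
      then obtain e where e: "e > 0" "\<And>x. dist x ?x < e \<Longrightarrow> x \<in> ?S \<and> ?F x = ?F ?x"
        unfolding eventually_nhds_metric by blast
      define V where "V = {q \<in> chart_dom c. coord c q \<in> ball ?x e}"
      have B: "ball ?x e \<subseteq> ?S" using e(2) by (auto simp: dist_commute)
      have "openin (man_top M) V"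
        unfolding V_def by (rule openin_chart_preimage[OF atlas_is_chart(1)[OF c(1)] open_ball])
      moreover have "p \<in> V" using c(2) e(1) by (simp add: V_def)
      ultimately obtain q where q: "q \<in> V" "f q \<noteq> f p"
        using nowhere_locally_constant[OF conn] qr unfolding quasiregular_def by blast
      have "f q = f p"
        using q(1) e(2)[of "coord c q"] coord_ball_preimage[OF c(1) B, of q] c(2) d(2)
        by (intro rep_eq_imp_eq[OF c(1) d(1)]) (auto simp: V_def dist_commute)
      with q(2) show False ..
    qed
  qed
qed

lemma riem_jacobian_pos:
  assumes conn: "connected_space (man_top M)" and qr: "quasiregular K M N f" and harm: "harmonic_map M N f"
    and p: "p \<in> topspace (man_top M)"
  shows "riem_jacobian M N f p > 0"
proof -
  note ch = chart_at_facts[OF p]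
  let ?F = "coord_rep (chart_at M p) (chart_at N (f p)) f" and ?x = "coord (chart_at M p) p"
  have "partial_jac ?F ?x = jacobian ?F (at ?x)"
    by (intro partial_jac_eq_jacobian real_analytic_at_differentiable rep_analytic ch coord_in_rep_dom)
  then have "det (jacobian ?F (at ?x)) > 0"
    using partial_jac_pos[OF conn qr harm ch] by simp
  then show ?thesis
    unfolding coordinate_change(1)[OF p ch]
    using positive_definite_det_pos[OF metric_facts(2)[OF M ch(1,2)]]
      positive_definite_det_pos[OF metric_facts(2)[OF N ch(3,4)]] by simp
qed

section \<open>The analytic local inverse\<close>

lemma invertible_left_inverse:
  fixes A :: "real^'n^'n"
  assumes "det A \<noteq> 0"
  obtains B where "B ** A = mat 1"
  using assms invertible_det_nz[of A] unfolding invertible_def by blast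

text \<open>The entries of the differential are continuous and the operator norm is at most the sum
  of their absolute values, so the differential is continuous in operator norm, as the injectivity
  theorem requires.\<close>

lemma analytic_locally_injective:
  fixes F :: "real^3 \<Rightarrow> real^3"
  assumes S: "open S" "x \<in> S" and an: "\<And>y. y \<in> S \<Longrightarrow> real_analytic_at F y"
    and nz: "det (partial_jac F x) \<noteq> 0"
  obtains r where "r > 0" "ball x r \<subseteq> S" "inj_on F (ball x r)"
proof -
  obtain B where B: "B ** partial_jac F x = mat 1" using invertible_left_inverse[OF nz] by blast
  show thesis
  proof (rule has_derivative_locally_injective[of x S "\<lambda>h. B *v h" "\<lambda>y h. partial_jac F y *v h" F])
    show "(\<lambda>h. B *v h) \<circ> (\<lambda>h. partial_jac F x *v h) = id"
      by (auto simp: matrix_vector_mul_assoc B)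
    show "bounded_linear (\<lambda>h. B *v h)" by (rule matrix_vector_mul_bounded_linear)
    show "(F has_derivative (\<lambda>h. partial_jac F y *v h)) (at y)" if "y \<in> S" for y
    proof -
      have "F differentiable at y" by (rule real_analytic_at_differentiable[OF an[OF that]])
      then show ?thesis by (simp add: partial_jac_eq_jacobian jacobian_has_derivative)
    qed
    fix e :: real assume e: "e > 0"
    let ?s = "\<lambda>y. \<Sum>i\<in>UNIV. \<Sum>j\<in>UNIV. \<bar>(partial_jac F y - partial_jac F x) $ i $ j\<bar>"
    have "isCont ?s x" by (intro continuous_intros isCont_partial_jac an S)
    then have "\<forall>\<^sub>F y in nhds x. ?s y < e" by (rule isCont_eventually_less) (simp add: e)
    then obtain \<delta> where \<delta>: "\<delta> > 0" "\<And>y. dist y x < \<delta> \<Longrightarrow> ?s y < e"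
      unfolding eventually_nhds_metric by blast
    have "onorm (\<lambda>v. partial_jac F y *v v - partial_jac F x *v v) < e" if "dist x y < \<delta>" for y
    proof -
      have "(\<lambda>v. partial_jac F y *v v - partial_jac F x *v v) = (\<lambda>v. (partial_jac F y - partial_jac F x) *v v)"
        by (simp add: matrix_vector_mult_diff_rdistrib)
      then show ?thesis
        using onorm_le_matrix_component_sum[of "partial_jac F y - partial_jac F x"] \<delta>(2)[of y] that
        by (simp add: dist_commute)
    qed
    then show "\<exists>d>0. \<forall>y. dist x y < d \<longrightarrow> onorm (\<lambda>v. partial_jac F y *v v - partial_jac F x *v v) < e"
      using \<delta>(1) by blast
  qed (use S that in auto)
qed

text \<open>A single coordinate ball yields injectivity, invariance of domain yields openness and so
  continuity of the inverse, and the analytic inverse theorem is then applied separately in each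
  pair of charts.\<close>

lemma local_analytic_diffeo:
  assumes pos: "\<And>p c d. c \<in> atlas M \<Longrightarrow> p \<in> chart_dom c \<Longrightarrow> d \<in> atlas N \<Longrightarrow> f p \<in> chart_dom d \<Longrightarrow>
      det (partial_jac (coord_rep c d f) (coord c p)) > 0"
  shows "local_analytic_diffeo M N f"
  unfolding local_analytic_diffeo_def
proof
  fix p assume p: "p \<in> topspace (man_top M)"
  define c where "c = chart_at M p"
  define d where "d = chart_at N (f p)"
  have c: "c \<in> atlas M" "p \<in> chart_dom c" and d: "d \<in> atlas N" "f p \<in> chart_dom d"
    using chart_at_facts[OF p] by (auto simp: c_def d_def)
  note isc = atlas_is_chart(1)[OF c(1)] and isd = atlas_is_chart(2)[OF d(1)]
  let ?S = "rep_dom c d (topspace (man_top M)) f" and ?F = "coord_rep c d f"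
  obtain r where r: "r > 0" "ball (coord c p) r \<subseteq> ?S" "inj_on ?F (ball (coord c p) r)"
    using analytic_locally_injective[OF open_map_rep_dom[OF c(1) d(1)] coord_in_rep_dom[OF c d(2)]
        rep_analytic[OF c(1) d(1)]] pos[OF c d] by (metis less_irrefl)
  define U where "U = {q \<in> chart_dom c. coord c q \<in> ball (coord c p) r}"
  have oU: "openin (man_top M) U" unfolding U_def by (rule openin_chart_preimage[OF isc open_ball])
  have pU: "p \<in> U" using c(2) r(1) by (simp add: U_def)
  have U: "f q \<in> chart_dom d" "q \<in> topspace (man_top M)" "q \<in> chart_dom c" "coord c q \<in> ball (coord c p) r"
    if "q \<in> U" for q
    using coord_ball_preimage[OF c(1) r(2), of q] that by (auto simp: U_def)
  have Fq: "?F (coord c q) = coord d (f q)" if "q \<in> U" for q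
    by (rule coord_rep_coord[OF isc U(3)[OF that]])
  have inj: "inj_on f U"
  proof (rule inj_onI)
    fix q q' assume q: "q \<in> U" "q' \<in> U" "f q = f q'"
    then have "?F (coord c q) = ?F (coord c q')" by (simp add: Fq)
    then have "coord c q = coord c q'" by (rule inj_onD[OF r(3)]) (use U q in auto)
    then show "q = q'" by (rule inj_onD[OF inj_on_coord[OF isc]]) (use U q in auto)
  qed
  \<comment> \<open>Openness is shown for all open subsets of \<open>U\<close>: this is continuity
    of the inverse, and it also supplies the neighbourhoods used for its coordinate
    expressions.\<close>
  have opn: "openin (man_top N) (f ` W)" if W: "openin (man_top M) W" "W \<subseteq> U" for W
  proof -
    let ?V = "coord c ` {q \<in> chart_dom c. q \<in> W}"
    have Vsub: "?V \<subseteq> ball (coord c p) r" using U W(2) by auto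
    have "open (?F ` ?V)"
    proof (rule invariance_of_domain)
      show "open ?V" by (rule open_coord_image[OF isc W(1)])
      show "inj_on ?F ?V" by (rule inj_on_subset[OF r(3) Vsub])
      show "continuous_on ?V ?F"
        using Vsub r(2) by (intro continuous_at_imp_continuous_on ballI real_analytic_at_isCont rep_analytic[OF c(1) d(1)]) auto
    qed
    then have "openin (man_top N) {y \<in> chart_dom d. coord d y \<in> ?F ` ?V}"
      by (rule openin_chart_preimage[OF isd])
    moreover have "{y \<in> chart_dom d. coord d y \<in> ?F ` ?V} = f ` W"
    proof (intro set_eqI iffI)
      fix y assume "y \<in> {y \<in> chart_dom d. coord d y \<in> ?F ` ?V}"
      then obtain q where q: "y \<in> chart_dom d" "q \<in> W" "coord d y = ?F (coord c q)" by auto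
      then have "coord d y = coord d (f q)" using W(2) Fq by auto
      then have "y = f q" by (rule inj_onD[OF inj_on_coord[OF isd]]) (use q U W(2) in auto)
      then show "y \<in> f ` W" using q by blast
    next
      fix y assume "y \<in> f ` W"
      then obtain q where q: "q \<in> W" "y = f q" by blast
      then have "coord d y = ?F (coord c q)" "y \<in> chart_dom d" "q \<in> chart_dom c" using W(2) Fq[of q] U[of q] by auto
      then show "y \<in> {y \<in> chart_dom d. coord d y \<in> ?F ` ?V}" using q by auto
    qed
    ultimately show ?thesis by simp
  qed
  define g where "g = inv_into U f"
  have gf: "g (f q) = q" if "q \<in> U" for q unfolding g_def by (rule inv_into_f_f[OF inj that])
  have contg: "continuous_map (subtopology (man_top N) (f ` U)) (man_top M) g"
    unfolding continuous_map_def
  proof (intro conjI allI impI)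
    have top: "topspace (subtopology (man_top N) (f ` U)) = f ` U"
      using openin_subset[OF opn[OF oU]] by auto
    show "g \<in> topspace (subtopology (man_top N) (f ` U)) \<rightarrow> topspace (man_top M)"
      unfolding top using gf U(2) by auto
    fix W assume W: "openin (man_top M) W"
    have "{x \<in> f ` U. g x \<in> W} = f ` (U \<inter> W)" using gf by auto
    then show "openin (subtopology (man_top N) (f ` U)) {x \<in> topspace (subtopology (man_top N) (f ` U)). g x \<in> W}"
      unfolding top openin_open_subtopology[OF opn[OF oU order_refl]]
      using opn[OF openin_Int[OF oU W]] by auto
  qed
  have ang: "real_analytic_at (coord_rep d' c' g) y"
    if d': "d' \<in> atlas N" and c': "c' \<in> atlas M" and y: "y \<in> rep_dom d' c' (f ` U) g" for d' c' y
  proof -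
    note isc' = atlas_is_chart(1)[OF c'] and isd' = atlas_is_chart(2)[OF d']
    obtain q where q: "q \<in> U" "f q \<in> chart_dom d'" "q \<in> chart_dom c'" "y = coord d' (f q)"
      using y gf by (auto simp: rep_dom_def)
    let ?F' = "coord_rep c' d' f" and ?x = "coord c' q" and ?\<Phi> = "coord_rep d' c' g"
    have F'x: "?F' ?x = y" using coord_rep_coord[OF isc' q(3)] q(4) by simp
    have \<Phi>: "?\<Phi> (coord d' (f q')) = coord c' q'" if "q' \<in> U" "f q' \<in> chart_dom d'" for q'
      using coord_rep_coord[OF isd' that(2), of c' g] gf[OF that(1)] by simp
    have \<Phi>y: "?\<Phi> y = ?x" using \<Phi>[OF q(1,2)] q(4) by simp
    \<comment> \<open>One statement serves twice: for arbitrary \<open>O'\<close> it gives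
      continuity of the coordinate inverse at \<open>y\<close>, and for the whole space the identity
      of a right inverse near \<open>y\<close>.\<close>
    have near: "\<forall>\<^sub>F w in nhds y. ?\<Phi> w \<in> O' \<and> ?F' (?\<Phi> w) = w" if O': "open O'" "?x \<in> O'" for O'
    proof -
      define W where "W = U \<inter> {q' \<in> chart_dom c'. coord c' q' \<in> O'}"
      have oW: "openin (man_top M) W"
        unfolding W_def by (intro openin_Int oU openin_chart_preimage[OF isc' O'(1)])
      have "openin (man_top N) (f ` W)" by (rule opn[OF oW]) (auto simp: W_def)
      then have "open (coord d' ` {z \<in> chart_dom d'. z \<in> f ` W})" by (rule open_coord_image[OF isd'])
      moreover have "y \<in> coord d' ` {z \<in> chart_dom d'. z \<in> f ` W}"
        using q O'(2) by (auto simp: W_def)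
      ultimately have "\<forall>\<^sub>F w in nhds y. w \<in> coord d' ` {z \<in> chart_dom d'. z \<in> f ` W}"
        by (rule eventually_nhds_in_open)
      then show ?thesis
      proof eventually_elim
        case (elim w)
        then obtain q' where q': "q' \<in> W" "f q' \<in> chart_dom d'" "w = coord d' (f q')" by blast
        then have "?\<Phi> w = coord c' q'" using \<Phi>[of q'] by (simp add: W_def)
        moreover have "?F' (coord c' q') = w"
          using coord_rep_coord[OF isc', of q' d' f] q' by (simp add: W_def)
        ultimately show ?case using q'(1) by (simp add: W_def)
      qed
    qed
    have "(?\<Phi> \<longlongrightarrow> ?\<Phi> y) (nhds y)"
      unfolding \<Phi>y by (rule topological_tendstoI) (use near in \<open>force elim: eventually_mono\<close>)
    then have cont: "isCont ?\<Phi> (?F' ?x)" unfolding F'x isCont_def tendsto_at_iff_tendsto_nhds .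
    have "det (partial_jac ?F' ?x) \<noteq> 0" using pos[OF c' q(3) d' q(2)] by simp
    then obtain B where "B ** partial_jac ?F' ?x = mat 1" using invertible_left_inverse by blast
    then have "real_analytic_at ?\<Phi> (?F' ?x)"
    proof (intro real_analytic_at_local_inverse[OF rep_analytic[OF c' d' coord_in_rep_dom[OF c' q(3,2)]] _ cont])
      show "?\<Phi> (?F' ?x) = ?x" unfolding F'x by (rule \<Phi>y)
      show "\<forall>\<^sub>F w in nhds (?F' ?x). ?F' (?\<Phi> w) = w"
        unfolding F'x using near[OF open_UNIV UNIV_I] by (auto elim: eventually_mono)
    qed (simp add: partial_jac_def)
    then show ?thesis unfolding F'x .
  qed
  have "analytic_map_on M N U f"
    unfolding analytic_map_on_def
  proof (intro conjI ballI oU)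
    show "continuous_map (subtopology (man_top M) U) (man_top N) f"
      by (rule continuous_map_from_subtopology[OF map_continuous])
    fix c' d' assume cd: "c' \<in> atlas M" "d' \<in> atlas N"
    have "rep_dom c' d' U f \<subseteq> rep_dom c' d' (topspace (man_top M)) f"
      using U(2) by (auto simp: rep_dom_def)
    then show "real_analytic_on (coord_rep c' d' f) (rep_dom c' d' U f)"
      unfolding real_analytic_on_def using rep_analytic[OF cd] by blast
  qed
  moreover have "analytic_map_on N M (f ` U) g"
    unfolding analytic_map_on_def real_analytic_on_def
    using opn[OF oU order_refl] contg ang by blast
  ultimately show "\<exists>U. openin (man_top M) U \<and> p \<in> U \<and> openin (man_top N) (f ` U) \<and> inj_on f U \<and>
      analytic_map_on M N U f \<and> analytic_map_on N M (f ` U) (inv_into U f)"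
    using oU pU opn[OF oU order_refl] inj unfolding g_def by blast
qed

end

theorem corollary5p2:
  fixes M :: "'a riem3" and N :: "'b riem3" and f :: "'a \<Rightarrow> 'b" and K :: real
  assumes "oriented_analytic_riemannian3 M" and "connected_space (man_top M)"
    and "oriented_analytic_riemannian3 N" and "connected_space (man_top N)"
    and "quasiregular K M N f"
    and "analytic_map M N f" and "harmonic_map M N f"
  shows "(\<forall>p\<in>topspace (man_top M). riem_jacobian M N f p > 0) \<and> local_analytic_diffeo M N f"
proof -
  interpret analytic_riemannian_map M N f
    using assms(1,3,6) by unfold_locales
  show ?thesis
  proof (intro conjI ballI)
    show "riem_jacobian M N f p > 0" if "p \<in> topspace (man_top M)" for p
      by (rule riem_jacobian_pos[OF assms(2,5,7) that])
    show "local_analytic_diffeo M N f"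
      by (rule local_analytic_diffeo) (rule partial_jac_pos[OF assms(2,5,7)])
  qed
qed

end
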